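(* In the setting of the context, let $0\le p\le\varsigma-1$. Assume that the unbounded sectors $U_{\mathfrak{d}_p}$ and $U_{\mathfrak{d}_{p+1}}$ are wide enough so that $U_{\mathfrak{d}_p}\cap U_{\mathfrak{d}_{p+1}}$ contains the sector $U_{\mathfrak{d}_p,\mathfrak{d}_{p+1}}=\{\tau\in\mathbb{C}^\star:\arg(\tau)\in[\mathfrak{d}_p,\mathfrak{d}_{p+1}]\}$. Then there exist $K_1>0$ and $K_2\in\mathbb{R}$ such that $$|u^{\mathfrak{d}_{p+1}}(t,z,\epsilon)-u^{\mathfrak{d}_p}(t,z,\epsilon)|\le K_1\exp\Big(-\frac{k_2}{2\log(q)}\log^2|\epsilon|\Big)|\epsilon|^{K_2},$$ $$|f^{\mathfrak{d}_{p+1}}(t,z,\epsilon)-f^{\mathfrak{d}_p}(t,z,\epsilon)|\le K_1\exp\Big(-\frac{k_2}{2\log(q)}\log^2|\epsilon|\Big)|\epsilon|^{K_2},$$ for every $t\in\mathcal{T}$, $z\in H_{\beta'}$ and $\epsilon\in\mathcal{E}_p\cap\mathcal{E}_{p+1}$.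
   Context: Notation. $q>1$ is real. For $\gamma\in\mathbb{R}$, $\sigma_q^\gamma g(t)=g(q^\gamma t)$ whenever the right-hand side makes sense (acting on $t$, resp. $T$, $\tau$), $\sigma_q=\sigma_q^1$; equations are understood wherever all terms are defined. $D(0,r)$ is the open disc, $\overline D(0,r)$ its closure, $\mathbb{C}^\star=\mathbb{C}\setminus\{0\}$, and $c_k(n):=(q^{1/k})^{n(n-1)/2}$. $E_{(\beta,\mu)}$ is the Banach space of continuous $h:\mathbb{R}\to\mathbb{C}$ with $\|h\|_{(\beta,\mu)}=\sup_m(1+|m|)^\mu e^{\beta|m|}|h(m)|<\infty$. For $R\in\mathbb{C}[X]$, $(h_1\ast^Rh_2)(m)=\int_{-\infty}^\infty h_1(m-m_1)R(im_1)h_2(m_1)dm_1$ (acting in $m$ when other variables are present). $\mathcal{F}^{-1}(h)(z)=(2\pi)^{-1/2}\int_{-\infty}^\infty h(m)e^{izm}dm$, $H_\beta=\{z\in\mathbb{C}:|\Im z|<\beta\}$. For $k>0$: $\Theta_{q^{1/k}}(x)=\sum_{n\in\mathbb{Z}}q^{-n(n-1)/(2k)}x^n$, $\pi_{q^{1/k}}=\frac{\log q}{k}\prod_{n\ge0}(1-q^{-(n+1)/k})^{-1}$, and $\mathcal{L}^\gamma_{q;1/k}(f)(T)=\frac1{\pi_{q^{1/k}}}\int_{L_\gamma}\frac{f(u)}{\Theta_{q^{1/k}}(u/T)}\frac{du}{u}$ with $L_\gamma=(0,\infty)e^{i\gamma}$; the value does not depend on the choice of $\gamma$ in the sector where $f$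 is defined with suitable growth. Function spaces. For an unbounded sector $U_d$ with vertex $0$ and bisecting direction $d$, $\rho>0$, and $\delta>0$ with $\mathrm{dist}(U_d\cup D(0,\rho),-\delta)>0$, $\mathrm{Exp}^d_{(k,\beta,\mu,\alpha,\rho)}$ is the Banach space of continuous $h$ on $(U_d\cup\overline D(0,\rho))\times\mathbb{R}$, holomorphic in $\tau\in U_d\cup D(0,\rho)$, with norm $\sup(1+|m|)^\mu e^{\beta|m|}\exp(-\frac{k\log^2|\tau+\delta|}{2\log q}-\alpha\log|\tau+\delta|)|h(\tau,m)|<\infty$. For an infinite sector $S_d$ and a bounded domain $\mathcal{R}_d^b$, $\mathrm{Exp}^d_{(k,\beta,\mu,\nu)}$ is the Banach space of continuous $h$ on $(S_d\cup\overline{\mathcal{R}_d^b})\times\mathbb{R}$ (closure in $\mathbb{C}^\star$), holomorphic in $\tau\in S_d\cup\mathcal{R}_d^b$, with norm $\sup(1+|m|)^\mu e^{\beta|m|}\exp(-\frac{k\log^2|\tau|}{2\log q}-\nu\log|\tau|)|h(\tau,m)|<\infty$. Data. $1\le k_1<k_2$, $D\ge3$, $d_D\ge1$ are integers, $\frac1\kappa=\frac1{k_1}-\frac1{k_2}$. For $1\le\ell\le D-1$: $I_\ell$ is a finite nonempty set of nonnegative integers, $\delta_\ell\ge1$ an integer, and for $\lambda\in I_\ell$, $d_{\lambda,\ell}\ge1$, $\Delta_{\lambda,\ell}\ge0$ are integers. Assume $\delta_1=1$, $\delta_\ell<\delta_{\ell+1}$ ($1\le\ell\le D-2$), and for all $1\le\ell\le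 D-1$, $\lambda\in I_\ell$: $\Delta_{\lambda,\ell}\ge d_{\lambda,\ell}$, $\frac{d_{\lambda,\ell}}{k_2}+1\ge\delta_\ell$, $\frac{d_D-1}{k_2}+1\ge\delta_\ell$. $Q,R_1,\dots,R_D\in\mathbb{C}[X]$ with $\deg Q\ge\deg R_D\ge\deg R_\ell$ ($1\le\ell\le D-1$), $Q(im)\ne0$, $R_D(im)\neq0$ for $m\in\mathbb{R}$, and $\frac{Q(im)}{R_D(im)}\in S_{Q,R_D}=\{z:|z|\ge r_{Q,R_D},|\arg z-d_{Q,R_D}|\le\eta_{Q,R_D}\}$ for all $m\in\mathbb{R}$, with some $r_{Q,R_D},\eta_{Q,R_D}>0$, $d_{Q,R_D}\in\mathbb{R}$. Let $\beta>0$, $\mu>\deg(R_D)+1$, $\epsilon_0>0$. The maps $m\mapsto C_{\lambda,\ell}(m,\epsilon)$, $m\mapsto F_n(m,\epsilon)$ ($n\ge0$) lie in $E_{(\beta,\mu)}$, depend holomorphically on $\epsilon\in D(0,\epsilon_0)$, and $\|C_{\lambda,\ell}(\cdot,\epsilon)\|_{(\beta,\mu)}\le\tilde C_{\lambda,\ell}$, $\|F_n(\cdot,\epsilon)\|_{(\beta,\mu)}\le C_F\rho^{-n}q^{n(n-1)/(2k_1)}$ for all $\epsilon\in D(0,\epsilon_0)$. Put $c_{\lambda,\ell}(z,\epsilon)=\mathcal{F}^{-1}(m\mapsto C_{\lambda,\ell}(m,\epsilon))(z)$. Fix $0<\beta'<\beta$. Good covering. For an integer $\varsigma\ge2$, $(\mathcal{E}_p)_{0\le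 p\le\varsigma-1}$ is a good covering in $\mathbb{C}^\star$: each $\mathcal{E}_p$ is an open sector with vertex $0$ and radius $\epsilon_0$, $\mathcal{E}_j\cap\mathcal{E}_k\ne\emptyset$ iff $|j-k|\le1$ (indices cyclic, $\mathcal{E}_\varsigma:=\mathcal{E}_0$), and $\bigcup_p\mathcal{E}_p=\mathcal{U}\setminus\{0\}$ for a neighborhood $\mathcal{U}$ of $0$. All indices $p$ are cyclic mod $\varsigma$. Associated family. For each $p$, $U_{\mathfrak{d}_p}$ and $S_{\mathfrak{d}_p}$ are unbounded sectors with vertex $0$ and bisecting direction $\mathfrak{d}_p$; $\delta>0$ has positive distance from $-\delta$ to each $U_{\mathfrak{d}_p}\cup D(0,\rho)$; $\tilde\delta>0$; $\mathcal{R}_{\mathfrak{d}_p,\tilde\delta}=\{T\in\mathbb{C}^\star:|1+e^{i\mathfrak{d}_p}r/T|>\tilde\delta\ \forall r\ge0\}$; $\mathcal{T}$ is an open bounded sector with vertex $0$ and radius $r_{\mathcal{T}}>0$; $\mathcal{R}^b_{\mathfrak{d}_p}=\mathcal{R}_{\mathfrak{d}_p,\tilde\delta}\cap D(0,\epsilon_0r_{\mathcal{T}})\subseteq\overline D(0,\rho)$; $S_{\mathfrak{d}_p}\subseteq\mathcal{R}_{\mathfrak{d}_p,\tilde\delta}$. Assume $0<\epsilon_0,r_{\mathcal{T}}<1$, $\nu+\frac{k_2}{\log q}\log r_{\mathcal{T}}<0$, $\alpha+\frac{\kappa}{\log q}\log(\epsilon_0r_{\mathcal{T}})<0$, $\epsilon_0r_{\mathcal{T}}\le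 q^{(\frac12-\nu)/k_2}/2$ ($\alpha,\nu$ introduced below). Let $q_l(m)$, $0\le l\le d_D-1$, be the roots of $P_m(\tau)=\frac{Q(im)}{c_{k_2}(k_2)}-\frac{R_D(im)}{c_{k_2}(d_D+k_2)}\tau^{d_D}$. Assume: (1) there is $M_1>0$ with $|\tau-q_l(m)|\ge M_1(1+|\tau|)$ for all $l$, $m\in\mathbb{R}$, $p$, $\tau\in S_{\mathfrak{d}_p}\cup\overline D(0,\rho)$; (2) there are $M_2>0$ and $l_0$ with $|\tau-q_{l_0}(m)|\ge M_2|q_{l_0}(m)|$ for all $m$, $p$, $\tau\in S_{\mathfrak{d}_p}\cup\overline D(0,\rho)$; (3) $\mathcal{R}^b_{\mathfrak{d}_p}\cap\mathcal{R}^b_{\mathfrak{d}_{p+1}}\ne\emptyset$ and $\epsilon t\in\mathcal{R}^b_{\mathfrak{d}_p}$ for all $t\in\mathcal{T}$, $\epsilon\in\mathcal{E}_p$, all $p$. Forcing term. $\psi_{k_1}(\tau,m,\epsilon)=\sum_{n\ge0}F_n(m,\epsilon)\tau^n/c_{k_1}(n)$ (convergent on $D(0,\rho)$) extends analytically in $\tau$ to $U_{\mathfrak{d}_p}$ as $\psi_{k_1}^{\mathfrak{d}_p}\in\mathrm{Exp}^{\mathfrak{d}_p}_{(k_1,\beta,\mu,\alpha,\rho)}$ for some $\alpha>0$, with norm bounded by a constant $\zeta_{\psi_{k_1}}$ independent of $\epsilon\in D(0,\epsilon_0)$. Then $\psi_{k_2}^{\mathfrak{d}_p}(\tau,m,\epsilon):=\mathcal{L}^{\mathfrak{d}_p}_{q;1/\kappa}(h\mapsto\psi_{k_1}^{\mathfrak{d}_p}(h,m,\epsilon))(\tau)$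 lies in $\mathrm{Exp}^{\mathfrak{d}_p}_{(k_2,\beta,\mu,\nu)}$, uniformly in $\epsilon$, for some $\nu\in\mathbb{R}$ (depending only on $q,k_1,k_2,\alpha$), which is fixed. Put $F^{\mathfrak{d}_p}(T,m,\epsilon)=\mathcal{L}^{\mathfrak{d}_p}_{q;1/k_2}(\tau\mapsto\psi_{k_2}^{\mathfrak{d}_p}(\tau,m,\epsilon))(T)$ and $f^{\mathfrak{d}_p}(t,z,\epsilon)=\mathcal{F}^{-1}(m\mapsto F^{\mathfrak{d}_p}(\epsilon t,m,\epsilon))(z)$, bounded holomorphic on $\mathcal{T}\times H_{\beta'}\times\mathcal{E}_p$. Problem $(E_p)$: $$Q(\partial_z)\sigma_qu^{\mathfrak{d}_p}=(\epsilon t)^{d_D}\sigma_q^{\frac{d_D}{k_2}+1}R_D(\partial_z)u^{\mathfrak{d}_p}+\sum_{\ell=1}^{D-1}\Big(\sum_{\lambda\in I_\ell}t^{d_{\lambda,\ell}}\epsilon^{\Delta_{\lambda,\ell}}\sigma_q^{\delta_\ell}c_{\lambda,\ell}(z,\epsilon)R_\ell(\partial_z)u^{\mathfrak{d}_p}\Big)+\sigma_qf^{\mathfrak{d}_p}(t,z,\epsilon).$$ Construction of the solutions. It is assumed that $r_{Q,R_D}$ is large enough, and that (depending on it) $\zeta_{\psi_{k_1}}$ and the $\tilde C_{\lambda,\ell}$ are small enough, so that for a fixed $\varpi>0$ and each $p$ and $\epsilon\in D(0,\epsilon_0)$: (i) the equation $Q(im)\frac{\tau^{k_1}}{c_{k_1}(k_1)}w=\frac{\tau^{d_D+k_1}}{c_{k_1}(d_D+k_1)}\sigma_q^{-d_D/\kappa}R_D(im)w+\sum_{\ell,\lambda}\frac{\epsilon^{\Delta_{\lambda,\ell}-d_{\lambda,\ell}}\tau^{d_{\lambda,\ell}+k_1}}{c_{k_1}(d_{\lambda,\ell}+k_1)}\sigma_q^{\delta_\ell-\frac{d_{\lambda,\ell}}{k_1}-1}\frac{1}{(2\pi)^{1/2}}(C_{\lambda,\ell}\ast^{R_\ell}w)+\frac{\tau^{k_1}}{c_{k_1}(k_1)}\psi_{k_1}^{\mathfrak{d}_p}$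 has a unique solution $w_{k_1}^{\mathfrak{d}_p}$ in the closed ball of radius $\varpi$ of $\mathrm{Exp}^{\mathfrak{d}_p}_{(\kappa,\beta,\mu,\alpha,\rho)}$; (ii) the equation $Q(im)\frac{\tau^{k_2}}{c_{k_2}(k_2)}w=R_D(im)\frac{\tau^{d_D+k_2}}{c_{k_2}(d_D+k_2)}w+\sum_{\ell,\lambda}\frac{\epsilon^{\Delta_{\lambda,\ell}-d_{\lambda,\ell}}\tau^{d_{\lambda,\ell}+k_2}}{c_{k_2}(d_{\lambda,\ell}+k_2)}\sigma_q^{\delta_\ell-\frac{d_{\lambda,\ell}}{k_2}-1}\frac{1}{(2\pi)^{1/2}}(C_{\lambda,\ell}\ast^{R_\ell}w)+\frac{\tau^{k_2}}{c_{k_2}(k_2)}\psi_{k_2}^{\mathfrak{d}_p}$ has a unique solution $w_{k_2}^{\mathfrak{d}_p}$ in $\mathrm{Exp}^{\mathfrak{d}_p}_{(k_2,\beta,\mu,\nu)}$, of norm $\le\varpi$; (iii) both are holomorphic in $\epsilon\in D(0,\epsilon_0)$, and $w_{k_2}^{\mathfrak{d}_p}$ is the analytic continuation in $\tau$ of $\mathcal{L}^{\mathfrak{d}_p}_{q;1/\kappa}(w_{k_1}^{\mathfrak{d}_p})(\tau,m,\epsilon)$. The solution of $(E_p)$ is $$u^{\mathfrak{d}_p}(t,z,\epsilon)=\frac1{(2\pi)^{1/2}}\frac1{\pi_{q^{1/k_2}}}\int_{-\infty}^\infty\int_{L_{\gamma_p}}\frac{w_{k_2}^{\mathfrak{d}_p}(u,m,\epsilon)}{\Theta_{q^{1/k_2}}(\frac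 u{\epsilon t})}\frac{du}ue^{izm}dm,$$ with a halfline $L_{\gamma_p}\subseteq S_{\mathfrak{d}_p}$ whose direction may depend on $\epsilon t$; it is bounded holomorphic on $\mathcal{T}\times H_{\beta'}\times\mathcal{E}_p$.
   Formalization: The sector arg(τ) in [d_p,d_{p+1}] is read, for each t in T and ε in E_p∩E_{p+1}, as the one of the two sectors between these directions not containing -εt; L_{γ_p} is reached from d_p inside S_{d_p} without crossing -εt. Otherwise the bound can fail, e.g. for ς=2. *)

theory Defs
  imports "HOL-Complex_Analysis.Complex_Analysis"
begin

section \<open>Special functions and integral transforms\<close>

definition qc :: "real \<Rightarrow> real \<Rightarrow> nat \<Rightarrow> real" where
  "qc q k n = q powr (real n * (real n - 1) / (2 * k))"

definition qTheta :: "real \<Rightarrow> real \<Rightarrow> complex \<Rightarrow> complex" where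
  "qTheta q k x =
     (\<Sum>\<^sub>\<infinity>n::int. complex_of_real (q powr (- (of_int n * (of_int n - 1) / (2 * k)))) * x powi n)"

definition qPi :: "real \<Rightarrow> real \<Rightarrow> real" where
  "qPi q k = ln q / k * (\<Prod>n. inverse (1 - q powr (- (real n + 1) / k)))"

text \<open>The half-line of direction \<open>\<gamma>\<close> is parametrised by \<open>u = r e\<^sup>i\<^sup>\<gamma>\<close>, \<open>r > 0\<close>, so that
  \<open>du / u = dr / r\<close>.\<close>

definition q_laplace :: "real \<Rightarrow> real \<Rightarrow> real \<Rightarrow> (complex \<Rightarrow> complex) \<Rightarrow> complex \<Rightarrow> complex" where
  "q_laplace q k \<gamma> f T =
     1 / complex_of_real (qPi q k) *
     (LINT r:{0<..}|lborel.
        f (complex_of_real r * cis \<gamma>) / qTheta q k (complex_of_real r * cis \<gamma> / T) / complex_of_real r)"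

definition inv_fourier :: "(real \<Rightarrow> complex) \<Rightarrow> complex \<Rightarrow> complex" where
  "inv_fourier h z =
     1 / complex_of_real (sqrt (2 * pi)) *
     (LINT m|lborel. h m * exp (\<i> * z * complex_of_real m))"

definition conv :: "complex poly \<Rightarrow> (real \<Rightarrow> complex) \<Rightarrow> (real \<Rightarrow> complex) \<Rightarrow> real \<Rightarrow> complex" where
  "conv R h1 h2 m =
     (LINT m1|lborel. h1 (m - m1) * poly R (\<i> * complex_of_real m1) * h2 m1)"


section \<open>Function spaces\<close>

definition E_norm :: "real \<Rightarrow> real \<Rightarrow> (real \<Rightarrow> complex) \<Rightarrow> real" where
  "E_norm \<beta> \<mu> h = (SUP m. (1 + \<bar>m\<bar>) powr \<mu> * exp (\<beta> * \<bar>m\<bar>) * cmod (h m))"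

definition E_space :: "real \<Rightarrow> real \<Rightarrow> (real \<Rightarrow> complex) set" where
  "E_space \<beta> \<mu> =
     {h. continuous_on UNIV h \<and>
         bdd_above (range (\<lambda>m. (1 + \<bar>m\<bar>) powr \<mu> * exp (\<beta> * \<bar>m\<bar>) * cmod (h m)))}"

definition Exp_weighted ::
  "real \<Rightarrow> real \<Rightarrow> real \<Rightarrow> real \<Rightarrow> real \<Rightarrow> real \<Rightarrow> (complex \<Rightarrow> real \<Rightarrow> complex) \<Rightarrow> complex \<times> real \<Rightarrow> real"
where
  "Exp_weighted q k \<beta> \<mu> a \<delta> h = (\<lambda>(\<tau>, m).
     (1 + \<bar>m\<bar>) powr \<mu> * exp (\<beta> * \<bar>m\<bar>) *
     exp (- (k * (ln (cmod (\<tau> + complex_of_real \<delta>)))\<^sup>2 / (2 * ln q))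
          - a * ln (cmod (\<tau> + complex_of_real \<delta>))) * cmod (h \<tau> m))"

text \<open>The two kinds of spaces below are instances of one construction: \<open>A\<close> is the set carrying
  continuity and the norm, \<open>B\<close> the set carrying holomorphy.  Elements are total functions of which
  only the values on \<open>A \<times> \<real>\<close> matter.\<close>

definition Exp_gen_norm ::
  "complex set \<Rightarrow> real \<Rightarrow> real \<Rightarrow> real \<Rightarrow> real \<Rightarrow> real \<Rightarrow> real \<Rightarrow> (complex \<Rightarrow> real \<Rightarrow> complex) \<Rightarrow> real"
where
  "Exp_gen_norm A q k \<beta> \<mu> a \<delta> h = (SUP x\<in>A \<times> UNIV. Exp_weighted q k \<beta> \<mu> a \<delta> h x)"

definition Exp_gen_space ::
  "complex set \<Rightarrow> complex set \<Rightarrow> real \<Rightarrow> real \<Rightarrow> real \<Rightarrow> real \<Rightarrow> real \<Rightarrow> real \<Rightarrow>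
    (complex \<Rightarrow> real \<Rightarrow> complex) set"
where
  "Exp_gen_space A B q k \<beta> \<mu> a \<delta> =
     {h. continuous_on (A \<times> UNIV) (\<lambda>(\<tau>, m). h \<tau> m) \<and>
         (\<forall>m. (\<lambda>\<tau>. h \<tau> m) holomorphic_on B) \<and>
         bdd_above (Exp_weighted q k \<beta> \<mu> a \<delta> h ` (A \<times> UNIV))}"

definition disc_dom :: "complex set \<Rightarrow> real \<Rightarrow> complex set" where
  "disc_dom U \<rho> = U \<union> cball 0 \<rho>"

definition Exp_disc_norm where
  "Exp_disc_norm U \<rho> \<delta> q k \<beta> \<mu> \<alpha> = Exp_gen_norm (disc_dom U \<rho>) q k \<beta> \<mu> \<alpha> \<delta>"

definition Exp_disc_space where
  "Exp_disc_space U \<rho> \<delta> q k \<beta> \<mu> \<alpha> = Exp_gen_space (disc_dom U \<rho>) (U \<union> ball 0 \<rho>) q k \<beta> \<mu> \<alpha> \<delta>"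

text \<open>Closure of the bounded domain in the punctured plane; no shift \<open>\<delta>\<close> in the weight.\<close>

definition sect_dom :: "complex set \<Rightarrow> complex set \<Rightarrow> complex set" where
  "sect_dom S Rb = S \<union> (closure Rb - {0})"

definition Exp_sect_norm where
  "Exp_sect_norm S Rb q k \<beta> \<mu> \<nu> = Exp_gen_norm (sect_dom S Rb) q k \<beta> \<mu> \<nu> 0"

definition Exp_sect_space where
  "Exp_sect_space S Rb q k \<beta> \<mu> \<nu> = Exp_gen_space (sect_dom S Rb) (S \<union> Rb) q k \<beta> \<mu> \<nu> 0"


section \<open>Sectors and coverings\<close>

definition sector :: "real \<Rightarrow> real \<Rightarrow> complex set" where
  "sector d \<eta> = {complex_of_real r * cis \<theta> | r \<theta>. r > 0 \<and> \<bar>\<theta> - d\<bar> < \<eta>}"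

definition unbounded_sector :: "real \<Rightarrow> complex set \<Rightarrow> bool" where
  "unbounded_sector d U \<longleftrightarrow> (\<exists>\<eta>. 0 < \<eta> \<and> \<eta> \<le> pi \<and> U = sector d \<eta>)"

definition bounded_sector :: "real \<Rightarrow> complex set \<Rightarrow> bool" where
  "bounded_sector r V \<longleftrightarrow> (\<exists>d \<eta>. 0 < \<eta> \<and> \<eta> \<le> pi \<and> V = sector d \<eta> \<inter> ball 0 r)"

definition R_set :: "real \<Rightarrow> real \<Rightarrow> complex set" where
  "R_set d \<delta>' = {T. T \<noteq> 0 \<and> (\<forall>r\<ge>0. cmod (1 + cis d * complex_of_real r / T) > \<delta>')}"

definition cyc_adjacent :: "nat \<Rightarrow> nat \<Rightarrow> nat \<Rightarrow> bool" where
  "cyc_adjacent n j k \<longleftrightarrow> j = k \<or> Suc j mod n = k \<or> Suc k mod n = j"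

definition good_covering :: "nat \<Rightarrow> real \<Rightarrow> (nat \<Rightarrow> complex set) \<Rightarrow> bool" where
  "good_covering n \<epsilon>0 E \<longleftrightarrow>
     n \<ge> 2 \<and> (\<forall>p<n. bounded_sector \<epsilon>0 (E p)) \<and>
     (\<forall>j<n. \<forall>k<n. E j \<inter> E k \<noteq> {} \<longleftrightarrow> cyc_adjacent n j k) \<and>
     (\<exists>V. 0 \<in> interior V \<and> (\<Union>p<n. E p) = V - {0})"

text \<open>A condition \<open>arg \<tau> \<in> [d, d']\<close> on two directions only makes sense once a determination of the
  argument is chosen; \<open>arc_sector x d d'\<close> uses the one that is cut along the half-line opposite to
  \<open>x\<close>.  For \<open>x = \<epsilon> t\<close> this half-line carries the zeros of \<open>u \<mapsto> qTheta q k (u / (\<epsilon> t))\<close>.\<close>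

definition arc_sector :: "complex \<Rightarrow> real \<Rightarrow> real \<Rightarrow> complex set" where
  "arc_sector x d d' =
     {\<tau>. \<tau> \<noteq> 0 \<and> Arg (\<tau> / x) \<in> closed_segment (Arg (cis d / x)) (Arg (cis d' / x))}"

lemma arc_sector_eq:
  assumes "s > 0" "\<bar>d - \<theta>\<bar> < pi" "\<bar>d' - \<theta>\<bar> < pi" "d \<le> d'"
  shows "arc_sector (complex_of_real s * cis \<theta>) d d' =
         {complex_of_real r * cis \<phi> | r \<phi>. r > 0 \<and> \<phi> \<in> {d..d'}}"
proof -
  let ?x = "complex_of_real s * cis \<theta>"
  have x0: "?x \<noteq> 0" using assms(1) by simp
  have arg: "Arg (complex_of_real r * cis \<phi> / ?x) = \<phi> - \<theta>" if "r > 0" "\<bar>\<phi> - \<theta>\<bar> < pi" for r \<phi>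
  proof -
    have "complex_of_real r * cis \<phi> / ?x = complex_of_real (r / s) * cis (\<phi> - \<theta>)"
      by (simp add: cis_divide[symmetric])
    also have "Arg \<dots> = Arg (cis (\<phi> - \<theta>))"
      using that assms(1) by (simp add: Arg_times_of_real)
    also have "\<dots> = \<phi> - \<theta>"
      using that by (intro Arg_cis) auto
    finally show ?thesis .
  qed
  have ad: "Arg (cis d / ?x) = d - \<theta>" "Arg (cis d' / ?x) = d' - \<theta>"
    using arg[of 1 d] arg[of 1 d'] assms by simp_all
  have seg: "closed_segment (d - \<theta>) (d' - \<theta>) = {d - \<theta>..d' - \<theta>}"
    using assms(4) by (simp add: closed_segment_eq_real_ivl)
  show ?thesis
  proof (intro equalityI subsetI)
    fix \<tau> assume "\<tau> \<in> arc_sector ?x d d'"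
    then have t: "\<tau> \<noteq> 0" "Arg (\<tau> / ?x) \<in> {d - \<theta>..d' - \<theta>}"
      by (auto simp: arc_sector_def ad seg)
    let ?\<phi> = "Arg (\<tau> / ?x) + \<theta>"
    have "\<tau> / ?x = complex_of_real (cmod (\<tau> / ?x)) * cis (Arg (\<tau> / ?x))"
      using rcis_cmod_Arg[of "\<tau> / ?x"] by (simp add: rcis_def)
    then have "\<tau> = complex_of_real (cmod (\<tau> / ?x)) * cis (Arg (\<tau> / ?x)) * ?x"
      using x0 by (metis nonzero_eq_divide_eq)
    also have "\<dots> = complex_of_real (cmod (\<tau> / ?x) * s) * cis ?\<phi>"
      by (simp add: cis_mult[symmetric] mult_ac)
    finally have "\<tau> = complex_of_real (cmod (\<tau> / ?x) * s) * cis ?\<phi>" .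
    moreover have "cmod (\<tau> / ?x) * s > 0" using t(1) x0 assms(1) by simp
    moreover have "?\<phi> \<in> {d..d'}" using t(2) by auto
    ultimately show "\<tau> \<in> {complex_of_real r * cis \<phi> | r \<phi>. r > 0 \<and> \<phi> \<in> {d..d'}}"
      by blast
  next
    fix \<tau> assume "\<tau> \<in> {complex_of_real r * cis \<phi> | r \<phi>. r > 0 \<and> \<phi> \<in> {d..d'}}"
    then obtain r \<phi> where r: "\<tau> = complex_of_real r * cis \<phi>" "r > 0" "\<phi> \<in> {d..d'}" by blast
    then have "\<bar>\<phi> - \<theta>\<bar> < pi" using assms by auto
    then have "Arg (\<tau> / ?x) = \<phi> - \<theta>" using arg r by simp
    then show "\<tau> \<in> arc_sector ?x d d'" using r by (auto simp: arc_sector_def ad seg)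
  qed
qed


section \<open>The auxiliary equations in the Borel plane\<close>

text \<open>Both auxiliary convolution equations have this form on their domain \<open>A\<close>: for level \<open>k1\<close> the
  leading term carries the dilation exponent \<open>e = - dD / \<kappa>\<close>, for level \<open>k2\<close> it carries \<open>e = 0\<close>.
  All dilation exponents are nonpositive, so every term is defined on all of \<open>A\<close>.\<close>

definition aux_equation ::
  "complex set \<Rightarrow> real \<Rightarrow> nat \<Rightarrow> real \<Rightarrow> complex poly \<Rightarrow> (nat \<Rightarrow> complex poly) \<Rightarrow> nat \<Rightarrow> nat \<Rightarrow>
    (nat \<Rightarrow> nat set) \<Rightarrow> (nat \<Rightarrow> nat) \<Rightarrow> (nat \<Rightarrow> nat \<Rightarrow> nat) \<Rightarrow> (nat \<Rightarrow> nat \<Rightarrow> nat) \<Rightarrow>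
    (nat \<Rightarrow> nat \<Rightarrow> real \<Rightarrow> complex \<Rightarrow> complex) \<Rightarrow> complex \<Rightarrow>
    (complex \<Rightarrow> real \<Rightarrow> complex) \<Rightarrow> (complex \<Rightarrow> real \<Rightarrow> complex) \<Rightarrow> bool"
where
  "aux_equation A q k e Q R D dD I dl d \<Delta> C \<epsilon> \<psi> w \<longleftrightarrow>
    (\<forall>\<tau>\<in>A. \<forall>m::real.
      poly Q (\<i> * complex_of_real m) * \<tau> ^ k / complex_of_real (qc q k k) * w \<tau> m =
        \<tau> ^ (dD + k) / complex_of_real (qc q k (dD + k)) *
          poly (R D) (\<i> * complex_of_real m) * w (complex_of_real (q powr e) * \<tau>) m
      + (\<Sum>l\<in>{1..D-1}. \<Sum>j\<in>I l.
          \<epsilon> ^ (\<Delta> j l - d j l) * \<tau> ^ (d j l + k) / complex_of_real (qc q k (d j l + k)) *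
          (1 / complex_of_real (sqrt (2 * pi))) *
          conv (R l) (\<lambda>m'. C j l m' \<epsilon>)
            (\<lambda>m'. w (complex_of_real (q powr (real (dl l) - real (d j l) / real k - 1)) * \<tau>) m') m)
      + \<tau> ^ k / complex_of_real (qc q k k) * \<psi> \<tau> m)"

end

theory Submission
  imports Defs "HOL-Real_Asymp.Real_Asymp"
begin

text \<open>Write \<open>x = \<epsilon> t\<close>, and call a Laplace transform of order \<open>\<kappa>\<close> of a function of level one a function
  of level two. The two solutions, and also the two forcing terms, are obtained from functions of
  level two by a Laplace transform of order \<open>k2\<close> along two different directions. The claim holds because
  these transforms differ only by what the integrands do at distance at least \<open>R\<close> from the origin,
  for a fixed radius \<open>R\<close>.

  \<^item> \<^bold>\<open>The functions of level one agree.\<close> On the disc of radius \<open>\<rho>\<close> the forcing terms of level one are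
  sums of the same power series, hence the solutions of level one satisfy the same convolution
  equation there. After division by \<open>\<tau>\<^sup>k\<close> every term with the unknown on the right carries a positive
  power of \<open>\<tau>\<close>, so that near the origin the difference of two solutions is at most half of itself
  (\<open>aux_equation_unique_near_0\<close>). The identity theorem carries the equality to the common
  part of the two sectors (\<open>holomorphic_eq_disc_cone\<close>).

  \<^item> \<^bold>\<open>The functions of level two agree on the ray of x.\<close> For \<open>\<tau>\<close> on this ray the zeros of
  \<open>u \<mapsto> \<Theta>(u/\<tau>)\<close> lie opposite to \<open>x\<close>. So one ray of integration can be rotated to the other one through
  the sector between them, on which the functions of level one agree (\<open>level1_agree\<close>).

  \<^item> \<^bold>\<open>The difference is flat.\<close> In the transforms of level two, the part of each ray of integration
  within distance \<open>R\<close> is rotated to the ray of \<open>x\<close>. There the two parts cancel, and two arcs of radius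
  \<open>R\<close> and two rays beyond \<open>R\<close> remain (\<open>level2_to_middle\<close>). On them the growth
  \<open>exp (k2 ln\<^sup>2|u| / (2 ln q))\<close> of the functions of level two meets the decay
  \<open>exp (- k2 ln\<^sup>2|u/x| / (2 ln q))\<close> of \<open>1/\<Theta>(u/x)\<close>. The squares of \<open>ln |u|\<close> cancel and leave
  \<open>exp (- k2 ln\<^sup>2|x| / (2 ln q))\<close> times a power of \<open>|x|\<close> (\<open>outer_weight_over_theta_le\<close>). As \<open>|\<epsilon>|\<close> and \<open>|t|\<close>
  are less than \<open>1\<close>, this is bounded by such an expression in \<open>|\<epsilon>|\<close>, uniformly in \<open>t\<close>
  (\<open>tail_bound_product\<close>).

  \<^item> \<^bold>\<open>The Theta function is large.\<close> All estimates rest on a lower bound for \<open>|\<Theta>|\<close> away from the negative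
  axis (\<open>qTheta_lower_bound\<close>). The functional equation reduces it to a compact part of an annulus,
  where it suffices that \<open>\<Theta>\<close> has no zero; this follows from the Jacobi triple product
  (\<open>qTheta_nonzero\<close>). The constant depends on the angle to the negative axis. The rays of direction
  \<open>\<gamma>\<close> do not control this angle uniformly and are therefore first rotated to the bisectors of their
  sectors (\<open>level2_rotate\<close>).\<close>

section \<open>The Jacobi triple product\<close>

text \<open>The \<open>q\<close>-Pochhammer symbol \<open>(P; P)\<^sub>n\<close>, from which the Gaussian binomial coefficients are formed.\<close>

definition qfac :: "real \<Rightarrow> nat \<Rightarrow> real" where
  "qfac P n = (\<Prod>i<n. 1 - P ^ Suc i)"

definition qbin :: "real \<Rightarrow> nat \<Rightarrow> nat \<Rightarrow> real" where
  "qbin P n k = (if k \<le> n then qfac P n / (qfac P k * qfac P (n - k)) else 0)"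

lemma qfac_pos: "0 < P \<Longrightarrow> P < 1 \<Longrightarrow> 0 < qfac P n"
  unfolding qfac_def by (intro prod_pos) (auto simp del: power_Suc simp: power_Suc_less_one)

lemma qbin_Suc:
  assumes "0 < P" "P < 1" "k \<le> n"
  shows "qbin P (Suc n) (Suc k) = qbin P n (Suc k) + P ^ (n - k) * qbin P n k"
proof (cases "k = n")
  case True
  then show ?thesis using qfac_pos[OF assms(1,2)]
    by (simp add: qbin_def qfac_def[of P 0] less_imp_neq[symmetric])
next
  case False
  with assms obtain j where j: "n = Suc (k + j)" using less_iff_Suc_add[of k n] by auto
  note pos = qfac_pos[OF assms(1,2)]
  have a: "qfac P (Suc (Suc (k + j))) = qfac P (Suc (k+j)) * (1 - P ^ (k + j + 2))"
    "qfac P (Suc k) = qfac P k * (1 - P ^ Suc k)" "qfac P (Suc j) = qfac P j * (1 - P ^ Suc j)"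
    by (simp_all add: qfac_def)
  have nz: "qfac P k \<noteq> 0" "qfac P j \<noteq> 0" "1 - P ^ Suc k \<noteq> 0" "1 - P ^ Suc j \<noteq> 0"
    using pos[of k] pos[of j] pos[of "Suc k"] pos[of "Suc j"] unfolding a by auto
  have d: "n - k = Suc j" "Suc n - Suc k = Suc j" "n - Suc k = j" using j by auto
  have e: "Suc k \<le> Suc n" "Suc k \<le> n" "k \<le> n" using j by auto
  show ?thesis
    unfolding qbin_def d if_P[OF e(1)] if_P[OF e(2)] if_P[OF e(3)] unfolding j a
    using nz by (simp add: divide_simps del: power_Suc) (simp add: algebra_simps power_add)
qed

text \<open>Gauss's \<open>q\<close>-binomial theorem.\<close>

lemma qbinomial_theorem:
  fixes y :: complex
  assumes "0 < P" "P < 1"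
  shows "(\<Prod>i<n. 1 + y * of_real P ^ i)
    = (\<Sum>k\<le>n. of_real (qbin P n k * P ^ (k choose 2)) * y ^ k)"
proof (induction n)
  case 0
  then show ?case by (simp add: qbin_def qfac_def numeral_2_eq_2)
next
  case (Suc n)
  let ?c = "\<lambda>n k. complex_of_real (qbin P n k * P ^ (k choose 2)) * y ^ k"
  have z: "qbin P m 0 = 1" for m
    using qfac_pos[OF assms, of m] by (simp add: qbin_def qfac_def[of P 0])
  have step: "?c (Suc n) (Suc k) = ?c n (Suc k) + y * of_real P ^ n * ?c n k" if "k \<le> n" for k
  proof -
    have "P ^ (n - k) * P ^ (Suc k choose 2) = P ^ n * P ^ (k choose 2)"
      using that by (simp add: power_add[symmetric] numeral_2_eq_2)
    then have "qbin P (Suc n) (Suc k) * P ^ (Suc k choose 2)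
      = qbin P n (Suc k) * P ^ (Suc k choose 2) + P ^ n * (qbin P n k * P ^ (k choose 2))"
      unfolding qbin_Suc[OF assms that] by (simp add: algebra_simps)
    then have "complex_of_real (qbin P (Suc n) (Suc k) * P ^ (Suc k choose 2))
      = of_real (qbin P n (Suc k) * P ^ (Suc k choose 2)) + of_real (P ^ n * (qbin P n k * P ^ (k choose 2)))"
      by (simp only: of_real_add)
    then show ?thesis by (simp add: algebra_simps)
  qed
  have "(\<Sum>k\<le>Suc n. ?c (Suc n) k) = ?c (Suc n) 0 + (\<Sum>k\<le>n. ?c (Suc n) (Suc k))"
    by (rule sum.atMost_Suc_shift)
  also have "\<dots> = ?c n 0 + (\<Sum>k\<le>n. ?c n (Suc k)) + (\<Sum>k\<le>n. y * of_real P ^ n * ?c n k)"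
    using step by (simp add: z sum.distrib)
  also have "?c n 0 + (\<Sum>k\<le>n. ?c n (Suc k)) = (\<Sum>k\<le>Suc n. ?c n k)"
    by (rule sum.atMost_Suc_shift[symmetric])
  also have "\<dots> = (\<Sum>k\<le>n. ?c n k)" by (simp add: qbin_def)
  also have "(\<Sum>k\<le>n. y * of_real P ^ n * ?c n k) = y * of_real P ^ n * (\<Sum>k\<le>n. ?c n k)"
    by (simp only: sum_distrib_left)
  finally show ?case using Suc by (simp add: algebra_simps)
qed

text \<open>The \<open>q\<close>-binomial theorem with \<open>2 n + 1\<close> factors, in which \<open>x\<close> is divided by \<open>P\<^sup>n\<close> and the first \<open>n\<close>
  factors \<open>1 + x P\<^sup>-\<^sup>i\<close> are rewritten as \<open>x P\<^sup>-\<^sup>i (1 + P\<^sup>i/x)\<close>. The odd number of factors makes the exponents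
  \<open>j + 1\<close> and \<open>- j\<close> have equal coefficients, as in the Theta series.\<close>

lemma finite_triple_product:
  fixes x :: complex
  assumes P: "0 < P" "P < 1" and x: "x \<noteq> 0"
  shows "(\<Prod>i\<le>n. 1 + x * of_real P ^ i) * (\<Prod>i<n. 1 + of_real P ^ Suc i / x)
    = (\<Sum>j\<le>n. of_real (qbin P (2 * n + 1) (n - j) * P powr (real j * (real j + 1) / 2)) * (x ^ Suc j + inverse x ^ j))"
    (is "?L = _")
proof -
  let ?N = "2 * n + 1"
  define y where "y = x / of_real P ^ n"
  have P0: "P \<noteq> 0" using P by auto
  have yP: "y * of_real P ^ n = x" using P0 by (simp add: y_def)
  have tw: "(\<Prod>i<n. 1 + y * of_real P ^ i)
    = (\<Prod>i<n. (x / of_real P ^ Suc i) * (1 + of_real P ^ Suc i / x))"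
  proof (rule prod.reindex_bij_witness[of _ "\<lambda>i. n - Suc i" "\<lambda>i. n - Suc i"])
    fix i assume i: "i \<in> {..<n}"
    have "y * of_real P ^ i = x / of_real P ^ Suc (n - Suc i)"
    proof -
      have "complex_of_real P ^ n = of_real P ^ i * of_real P ^ Suc (n - Suc i)"
        using i by (simp add: power_add[symmetric] del: power_Suc)
      then show ?thesis using P0 by (simp add: y_def)
    qed
    then show "x / of_real P ^ Suc (n - Suc i) * (1 + of_real P ^ Suc (n - Suc i) / x) = 1 + y * of_real P ^ i"
      using P0 x by (simp add: algebra_simps)
  qed auto
  have tn: "(\<Prod>i<n. of_real P ^ Suc i) = complex_of_real (P powr (real n * (real n + 1) / 2))" for n
  proof (induction n)
    case (Suc n)
    have "P powr (real (Suc n) * (real (Suc n) + 1) / 2) = P powr (real n * (real n + 1) / 2) * P ^ Suc n"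
      using P by (simp add: powr_realpow[symmetric] powr_add[symmetric] algebra_simps add_divide_distrib del: power_Suc)
    then show ?case using Suc by (simp add: mult_ac)
  qed (use P in auto)
  define t where "t = complex_of_real (P powr (real n * (real n + 1) / 2))"
  have t0: "t \<noteq> 0" using P0 by (simp add: t_def)
  have tw2: "(\<Prod>i<n. 1 + y * of_real P ^ i) = x ^ n / t * (\<Prod>i<n. 1 + of_real P ^ Suc i / x)"
    unfolding tw t_def tn[symmetric] by (simp add: prod.distrib prod_dividef)
  have sp: "(\<Prod>i<m + k. f i) = (\<Prod>i<m. f i) * (\<Prod>i<k. f (m + i))" for f :: "nat \<Rightarrow> complex" and m k
    by (induction k) (simp_all add: mult_ac)
  have "(\<Prod>i<?N. 1 + y * of_real P ^ i) = (\<Prod>i<n. 1 + y * of_real P ^ i) * (\<Prod>i<Suc n. 1 + y * of_real P ^ (n + i))"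
    using sp[of "\<lambda>i. 1 + y * of_real P ^ i" n "Suc n"] by (simp add: mult_2)
  also have "(\<Prod>i<Suc n. 1 + y * of_real P ^ (n + i)) = (\<Prod>i\<le>n. 1 + x * of_real P ^ i)"
    unfolding lessThan_Suc_atMost by (simp add: power_add mult.assoc[symmetric] yP)
  finally have L: "?L = t * inverse x ^ n * (\<Prod>i<?N. 1 + y * of_real P ^ i)"
    unfolding tw2 using t0 x by (simp add: field_simps)
  let ?g = "\<lambda>k. complex_of_real (qbin P ?N k * P ^ (k choose 2)) * y ^ k"
  let ?T = "\<lambda>j. P powr (real j * (real j + 1) / 2)"
  have pc: "P ^ (k choose 2) = P powr (real k * (real k - 1) / 2)" for k
  proof -
    have "real (k choose 2) = real k * (real k - 1) / 2"
      by (induction k) (simp_all add: numeral_2_eq_2 field_simps)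
    then show ?thesis using P powr_realpow[of P "k choose 2"] by metis
  qed
  have yk: "y ^ k = of_real (P powr (- real n * real k)) * x ^ k" for k
  proof -
    have "P powr (- real n * real k) = inverse (P ^ (n * k))"
      using P powr_realpow[of P "n * k"] by (simp add: powr_minus)
    then have "complex_of_real (P powr (- real n * real k)) = inverse ((of_real P ^ n) ^ k)"
      by (simp add: power_mult)
    then show ?thesis by (simp add: y_def power_divide divide_inverse power_mult_distrib power_inverse)
  qed
  have ex: "P powr a * (P powr b * P powr c) = P powr d" if "a + b + c = d" for a b c d
    using that by (simp add: powr_add[symmetric] add.assoc)
  have up: "t * inverse x ^ n * ?g (n + 1 + j) = of_real (qbin P ?N (n - j) * ?T j) * x ^ Suc j"
    if "j \<le> n" for j
  proof -
    have sy: "qbin P ?N (n + 1 + j) = qbin P ?N (n - j)"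
    proof -
      have "?N - (n + 1 + j) = n - j" "?N - (n - j) = n + 1 + j" using that by auto
      moreover have "n + 1 + j \<le> ?N" "n - j \<le> ?N" using that by auto
      ultimately show ?thesis by (simp only: qbin_def if_True mult.commute)
    qed
    have E: "P powr (real n * (real n + 1) / 2) * (P ^ ((n + 1 + j) choose 2) * P powr (- real n * real (n + 1 + j))) = ?T j"
      unfolding pc by (rule ex) (simp add: field_simps)
    have X: "inverse x ^ n * x ^ (n + 1 + j) = x ^ Suc j" using x by (simp add: power_add field_simps)
    have "t * inverse x ^ n * ?g (n + 1 + j) = of_real (qbin P ?N (n + 1 + j)) *
       of_real (P powr (real n * (real n + 1) / 2) * (P ^ ((n + 1 + j) choose 2) * P powr (- real n * real (n + 1 + j))))
       * (inverse x ^ n * x ^ (n + 1 + j))"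
      unfolding t_def yk by (simp only: of_real_mult mult_ac)
    then show ?thesis unfolding E X sy by simp
  qed
  have dn: "t * inverse x ^ n * ?g (n - j) = of_real (qbin P ?N (n - j) * ?T j) * inverse x ^ j"
    if "j \<le> n" for j
  proof -
    have E: "P powr (real n * (real n + 1) / 2) * (P ^ ((n - j) choose 2) * P powr (- real n * real (n - j))) = ?T j"
      unfolding pc by (rule ex) (use that in \<open>simp add: field_simps of_nat_diff\<close>)
    have "inverse x ^ n = inverse x ^ j * inverse x ^ (n - j)" using that by (simp add: power_add[symmetric])
    then have X: "inverse x ^ n * x ^ (n - j) = inverse x ^ j" using x by (simp add: field_simps)
    have "t * inverse x ^ n * ?g (n - j) = of_real (qbin P ?N (n - j)) *
       of_real (P powr (real n * (real n + 1) / 2) * (P ^ ((n - j) choose 2) * P powr (- real n * real (n - j))))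
       * (inverse x ^ n * x ^ (n - j))"
      unfolding t_def yk by (simp only: of_real_mult mult_ac)
    then show ?thesis unfolding E X by simp
  qed
  have "(\<Sum>k\<le>?N. ?g k) = (\<Sum>k\<le>n. ?g k) + (\<Sum>k\<in>{n+1..?N}. ?g k)"
  proof -
    have "{..?N} = {..n} \<union> {n+1..?N}" by auto
    then show ?thesis by (simp only:) (rule sum.union_disjoint, auto)
  qed
  also have "(\<Sum>k\<le>n. ?g k) = (\<Sum>j\<le>n. ?g (n - j))"
    by (rule sum.reindex_bij_witness[of _ "\<lambda>k. n - k" "\<lambda>k. n - k"]) auto
  also have "(\<Sum>k\<in>{n+1..?N}. ?g k) = (\<Sum>j\<le>n. ?g (n + 1 + j))"
    by (rule sum.reindex_bij_witness[of _ "\<lambda>k. n + 1 + k" "\<lambda>k. k - (n + 1)"]) auto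
  finally have S: "(\<Prod>i<?N. 1 + y * of_real P ^ i) = (\<Sum>j\<le>n. ?g (n - j) + ?g (n + 1 + j))"
    unfolding qbinomial_theorem[OF P] by (simp add: sum.distrib)
  show ?thesis unfolding L S sum_distrib_left
    by (rule sum.cong[OF refl]) (use up dn in \<open>simp add: distrib_left del: power_Suc\<close>)
qed

lemma qfac_limit:
  assumes P: "0 < P" "P < 1"
  obtains L where "0 < L" "qfac P \<longlonglongrightarrow> L" "\<And>n. L \<le> qfac P n" "\<And>n. qfac P n \<le> 1"
proof -
  let ?f = "\<lambda>i. 1 - P ^ Suc i"
  have f01: "0 < ?f i" "?f i < 1" for i using P by (auto simp del: power_Suc simp: power_Suc_less_one)
  have "summable (\<lambda>i. norm (?f i - 1))"
    using P by (simp add: norm_mult norm_power summable_mult summable_geometric)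
  then have conv: "convergent_prod ?f"
    by (intro abs_convergent_prod_imp_convergent_prod summable_imp_abs_convergent_prod)
  define L where "L = prodinf ?f"
  have L0: "L \<noteq> 0" unfolding L_def using f01 by (intro prodinf_nonzero conv) (metis less_irrefl)
  have lim: "qfac P \<longlonglongrightarrow> L"
  proof (rule LIMSEQ_imp_Suc)
    show "(\<lambda>n. qfac P (Suc n)) \<longlonglongrightarrow> L"
      using convergent_prod_LIMSEQ[OF conv] unfolding L_def qfac_def lessThan_Suc_atMost .
  qed
  have dec: "decseq (qfac P)"
  proof (rule decseq_SucI)
    fix n show "qfac P (Suc n) \<le> qfac P n"
      using qfac_pos[OF P, of n] f01[of n] mult_left_mono[of "?f n" 1 "qfac P n"]
      by (simp add: qfac_def mult.commute)
  qed
  have ge: "L \<le> qfac P n" for n using decseq_ge[OF dec lim] .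
  have "0 \<le> L" by (rule LIMSEQ_le_const[OF lim]) (use qfac_pos[OF P] in \<open>auto intro: less_imp_le\<close>)
  with L0 have "0 < L" by simp
  moreover have "qfac P n \<le> 1" for n
    using decseqD[OF dec, of 0 n] by (simp add: qfac_def)
  ultimately show ?thesis using lim ge that by blast
qed

section \<open>Zeros and size of the Theta function\<close>

text \<open>The coefficient of both \<open>x\<^sup>j\<^sup>+\<^sup>1\<close> and \<open>x\<^sup>-\<^sup>j\<close> in the Theta series, for \<open>P = q\<^sup>-\<^sup>1\<^sup>/\<^sup>k\<close>.\<close>

definition theta_coeff :: "real \<Rightarrow> nat \<Rightarrow> real" where
  "theta_coeff P j = P powr (real j * (real j + 1) / 2)"

lemma theta_coeff_pos: "0 < P \<Longrightarrow> 0 < theta_coeff P j"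
  by (simp add: theta_coeff_def)

lemma theta_coeff_summable:
  assumes P: "0 < P" "P < 1"
  shows "summable (\<lambda>j. theta_coeff P j * r ^ j)"
proof -
  have "(\<lambda>j. P ^ Suc j * \<bar>r\<bar>) \<longlonglongrightarrow> 0 * \<bar>r\<bar>"
    using P by (intro tendsto_mult tendsto_const LIMSEQ_Suc LIMSEQ_power_zero) auto
  then have "\<forall>\<^sub>F j in sequentially. P ^ Suc j * \<bar>r\<bar> < 1 / 2" by (intro order_tendstoD) auto
  then obtain N where N: "\<And>j. j \<ge> N \<Longrightarrow> P ^ Suc j * \<bar>r\<bar> < 1 / 2"
    unfolding eventually_sequentially by blast
  have S: "theta_coeff P (Suc j) = theta_coeff P j * P ^ Suc j" for j
    using P by (simp add: theta_coeff_def powr_realpow[symmetric] powr_add[symmetric] algebra_simps add_divide_distrib del: power_Suc)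
  show ?thesis
  proof (rule summable_ratio_test[of "1 / 2" N])
    fix j assume "j \<ge> N"
    then have "P ^ Suc j * \<bar>r\<bar> \<le> 1 / 2" using N by fastforce
    then have "P ^ Suc j * \<bar>r\<bar> * (theta_coeff P j * \<bar>r\<bar> ^ j) \<le> 1 / 2 * (theta_coeff P j * \<bar>r\<bar> ^ j)"
      using theta_coeff_pos[OF P(1), of j] by (intro mult_right_mono) auto
    then show "norm (theta_coeff P (Suc j) * r ^ Suc j) \<le> 1 / 2 * norm (theta_coeff P j * r ^ j)"
      using theta_coeff_pos[OF P(1), of j] P unfolding S by (simp add: abs_mult power_abs mult_ac)
  qed simp
qed

lemma powr_base_unit_interval: fixes q k :: real assumes "q > 1" "k > 0" shows "0 < q powr (- 1 / k)" "q powr (- 1 / k) < 1"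
  using assms powr_less_one[of q "- 1 / k"] by (simp_all add: divide_neg_pos)

lemma theta_terms_summable:
  fixes x :: complex
  assumes P: "0 < P" "P < 1"
  shows "summable (\<lambda>j. theta_coeff P j * norm x ^ Suc j)" "summable (\<lambda>j. theta_coeff P j * norm (inverse x) ^ j)"
  using summable_mult2[OF theta_coeff_summable[OF P, of "norm x"], of "norm x"]
    theta_coeff_summable[OF P, of "norm (inverse x)"]
  by (simp_all only: power_Suc2 mult.assoc)

lemma qTheta_has_sum:
  fixes x :: complex
  assumes q: "q > 1" "k > 0"
  defines "P \<equiv> q powr (- 1 / k)"
  shows "((\<lambda>n::int. complex_of_real (q powr (- (of_int n * (of_int n - 1) / (2 * k)))) * x powi n)
    has_sum ((\<Sum>j. of_real (theta_coeff P j) * x ^ Suc j) + (\<Sum>j. of_real (theta_coeff P j) * inverse x ^ j))) UNIV"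
    (is "(?t has_sum _) _")
proof -
  have P: "0 < P" "P < 1" using powr_base_unit_interval[OF q] by (auto simp: P_def)
  have c: "q powr (- (a * (a - 1) / (2 * k))) = theta_coeff P j" if "a * (a - 1) = real j * (real j + 1)" for a j
    using that q by (simp add: theta_coeff_def P_def powr_powr mult.commute)
  have "summable (\<lambda>j. norm (of_real (theta_coeff P j) * x ^ Suc j))"
    using theta_terms_summable(1)[OF P, of x] theta_coeff_pos[OF P(1)]
    by (simp add: norm_mult norm_power abs_of_pos del: power_Suc)
  then have 1: "((\<lambda>j. of_real (theta_coeff P j) * x ^ Suc j) has_sum (\<Sum>j. of_real (theta_coeff P j) * x ^ Suc j)) UNIV"
    by (intro norm_summable_imp_has_sum) (auto intro: summable_sums summable_norm_cancel)
  have "summable (\<lambda>j. norm (of_real (theta_coeff P j) * inverse x ^ j))"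
    using theta_terms_summable(2)[OF P, of x] theta_coeff_pos[OF P(1)]
    by (simp add: norm_mult norm_power abs_of_pos del: power_Suc)
  then have 2: "((\<lambda>j. of_real (theta_coeff P j) * inverse x ^ j) has_sum (\<Sum>j. of_real (theta_coeff P j) * inverse x ^ j)) UNIV"
    by (intro norm_summable_imp_has_sum) (auto intro: summable_sums summable_norm_cancel)
  have e1: "?t \<circ> (\<lambda>j. int j + 1) = (\<lambda>j. of_real (theta_coeff P j) * x ^ Suc j)"
  proof
    fix j
    have "x powi (int j + 1) = x ^ Suc j" using power_int_of_nat[of x "Suc j"] by (simp add: add.commute)
    then show "(?t \<circ> (\<lambda>j. int j + 1)) j = of_real (theta_coeff P j) * x ^ Suc j"
      unfolding o_def by (subst c[of _ j]) (simp_all add: mult.commute)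
  qed
  have e2: "?t \<circ> (\<lambda>j. - int j) = (\<lambda>j. of_real (theta_coeff P j) * inverse x ^ j)"
  proof
    fix j
    show "(?t \<circ> (\<lambda>j. - int j)) j = of_real (theta_coeff P j) * inverse x ^ j"
      unfolding o_def by (subst c[of _ j]) (simp_all add: algebra_simps power_int_minus power_inverse)
  qed
  have 3: "(?t has_sum (\<Sum>j. of_real (theta_coeff P j) * x ^ Suc j)) (range (\<lambda>j. int j + 1))"
    using 1 by (subst has_sum_reindex) (auto simp: e1 inj_on_def)
  have 4: "(?t has_sum (\<Sum>j. of_real (theta_coeff P j) * inverse x ^ j)) (range (\<lambda>j. - int j))"
    using 2 by (subst has_sum_reindex) (auto simp: e2 inj_on_def)
  have U: "range (\<lambda>j. int j + 1) \<union> range (\<lambda>j. - int j) = UNIV"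
  proof -
    have "n \<in> range (\<lambda>j. int j + 1) \<union> range (\<lambda>j. - int j)" for n :: int
    proof (cases "n > 0")
      case True then have "n = int (nat (n - 1)) + 1" by simp
      then show ?thesis by blast
    next
      case False then have "n = - int (nat (- n))" by simp
      then show ?thesis by blast
    qed
    then show ?thesis by blast
  qed
  show ?thesis
    using has_sum_Un_disjoint[OF 3 4] unfolding U by fastforce
qed

lemma qTheta_eq:
  assumes "q > 1" "k > 0"
  shows "qTheta q k x = (\<Sum>j. of_real (theta_coeff (q powr (- 1 / k)) j) * x ^ Suc j)
    + (\<Sum>j. of_real (theta_coeff (q powr (- 1 / k)) j) * inverse x ^ j)"
  unfolding qTheta_def by (rule infsumI[OF qTheta_has_sum[OF assms]])

lemma qTheta_shift:
  assumes q: "q > 1" "k > 0" and x: "x \<noteq> 0"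
  defines "P \<equiv> q powr (- 1 / k)"
  shows "qTheta q k (x / of_real P) = x / of_real P * qTheta q k x"
proof -
  let ?c = "\<lambda>n::int. complex_of_real (q powr (- (of_int n * (of_int n - 1) / (2 * k))))"
  have P: "0 < P" using powr_base_unit_interval[OF q] by (auto simp: P_def)
  have Pn: "P powi n = q powr (- of_int n / k)" for n
    using q by (simp add: P_def powr_real_of_int'[symmetric] powr_powr)
  have "?c n * (x / of_real P) powi n = x / of_real P * (?c (n - 1) * x powi (n - 1))" for n
  proof -
    have "q powr (- (of_int n * (of_int n - 1) / (2 * k))) = q powr (- (of_int (n - 1) * (of_int (n - 1) - 1) / (2 * k))) * P powi n / P"
    proof -
      have "- (of_int n * (of_int n - 1) / (2 * k))
        = - (of_int (n - 1) * (of_int (n - 1) - 1) / (2 * k)) + (- of_int n / k) - (- 1 / k)"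
        using q by (simp add: field_simps)
      then show ?thesis unfolding Pn unfolding P_def by (simp only: powr_add powr_diff)
    qed
    then have "?c n * (x / of_real P) powi n = ?c (n - 1) * P powi n / P * (x / of_real P) powi n"
      by (simp only: of_real_mult of_real_divide)
    also have "\<dots> = ?c (n - 1) / P * x powi n"
      using P by (simp add: power_int_divide_distrib)
    also have "x powi n = x * x powi (n - 1)"
      using x by (simp add: power_int_diff)
    finally show ?thesis by (simp add: mult_ac)
  qed
  then have "qTheta q k (x / of_real P) = (\<Sum>\<^sub>\<infinity>n. x / of_real P * (?c (n - 1) * x powi (n - 1)))"
    unfolding qTheta_def by simp
  also have "\<dots> = x / of_real P * (\<Sum>\<^sub>\<infinity>n. ?c (n - 1) * x powi (n - 1))"
    by (rule infsum_cmult_right')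
  also have "(\<Sum>\<^sub>\<infinity>n. ?c (n - 1) * x powi (n - 1)) = qTheta q k x"
    unfolding qTheta_def
    by (rule infsum_reindex_bij_witness[of _ "\<lambda>n. n + 1" "\<lambda>n. n - 1"]) auto
  finally show ?thesis .
qed

lemma qTheta_holomorphic:
  assumes q: "q > 1" "k > 0"
  shows "qTheta q k holomorphic_on - {0}"
proof -
  define P where "P = q powr (- 1 / k)"
  have P: "0 < P" "P < 1" using powr_base_unit_interval[OF q] by (auto simp: P_def)
  define g where "g = (\<lambda>y::complex. \<Sum>j. of_real (theta_coeff P j) * y ^ j)"
  have g: "g holomorphic_on UNIV"
  proof -
    have "(\<lambda>j. complex_of_real (theta_coeff P j) * (w - 0) ^ j) sums g w" for w :: complex
    proof -
      have "summable (\<lambda>j. norm (complex_of_real (theta_coeff P j) * w ^ j))"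
        using theta_coeff_summable[OF P, of "norm w"] theta_coeff_pos[OF P(1)]
        by (simp add: norm_mult norm_power abs_of_pos)
      then show ?thesis unfolding g_def diff_zero by (rule summable_sums[OF summable_norm_cancel])
    qed
    then have *: "g holomorphic_on ball 0 r" for r
      by (rule power_series_holomorphic[of 0 r "\<lambda>j. complex_of_real (theta_coeff P j)"])
    have "g field_differentiable at x" for x
      by (rule holomorphic_on_imp_differentiable_at[OF *[of "norm x + 1"]]) auto
    then show ?thesis by (simp add: holomorphic_on_def field_differentiable_at_within)
  qed
  have "qTheta q k = (\<lambda>x. x * g x + g (inverse x))"
  proof
    fix x
    have "summable (\<lambda>j. complex_of_real (theta_coeff P j) * x ^ j)"
      by (rule summable_norm_cancel)
        (use theta_coeff_summable[OF P, of "norm x"] theta_coeff_pos[OF P(1)] in \<open>simp add: norm_mult norm_power abs_of_pos\<close>)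
    from suminf_mult[OF this, of x] show "qTheta q k x = x * g x + g (inverse x)"
      unfolding qTheta_eq[OF q] P_def[symmetric] g_def by (simp add: mult_ac)
  qed
  moreover have "(\<lambda>x. x * g x + g (inverse x)) holomorphic_on - {0}"
    by (intro holomorphic_intros holomorphic_on_subset[OF g]
      holomorphic_on_compose[of inverse "-{0}" g, unfolded o_def]) (auto intro!: holomorphic_intros)
  ultimately show ?thesis by (simp only:)
qed

text \<open>The limit \<open>n \<rightarrow> \<infinity>\<close> of the finite triple product: Tannery's theorem turns the right side into
  \<open>\<Theta> x\<close> times a constant, while the left side tends to two convergent products without zero factor.\<close>

lemma qTheta_nonzero:
  assumes q: "q > 1" "k > 0" and x: "x \<notin> \<real>\<^sub>\<le>\<^sub>0"
  shows "qTheta q k x \<noteq> 0"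
proof -
  define P where "P = q powr (- 1 / k)"
  have P: "0 < P" "P < 1" using powr_base_unit_interval[OF q] by (auto simp: P_def)
  have x0: "x \<noteq> 0" using x by auto
  obtain L where L: "0 < L" "qfac P \<longlonglongrightarrow> L" "\<And>n. L \<le> qfac P n" "\<And>n. qfac P n \<le> 1"
    by (rule qfac_limit[OF P]) blast
  define s where "s j = complex_of_real (theta_coeff P j) * (x ^ Suc j + inverse x ^ j)" for j
  define b where "b n j = (if j \<le> n then qbin P (2 * n + 1) (n - j) else 0)" for n j
  have Ln: "norm (s j) \<le> theta_coeff P j * norm x ^ Suc j + theta_coeff P j * norm (inverse x) ^ j" for j
    unfolding s_def norm_mult using theta_coeff_pos[OF P(1), of j]
    by (auto simp: norm_power[symmetric] distrib_left[symmetric] abs_of_pos simp del: power_Suc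
        intro!: mult_left_mono norm_triangle_ineq)
  have sumM: "summable (\<lambda>j. theta_coeff P j * norm x ^ Suc j + theta_coeff P j * norm (inverse x) ^ j)"
    by (intro summable_add theta_terms_summable P)
  have ns: "summable (\<lambda>j. norm (s j))"
    by (rule summable_comparison_test[OF _ sumM]) (use Ln in auto)
  have Theta: "qTheta q k x = suminf s"
  proof -
    have "summable (\<lambda>j. complex_of_real (theta_coeff P j) * x ^ Suc j)"
      by (rule summable_norm_cancel)
        (use theta_terms_summable(1)[OF P, of x] theta_coeff_pos[OF P(1)] in \<open>simp add: norm_mult norm_power abs_of_pos\<close>)
    moreover have "summable (\<lambda>j. complex_of_real (theta_coeff P j) * inverse x ^ j)"
      by (rule summable_norm_cancel)
        (use theta_terms_summable(2)[OF P, of x] theta_coeff_pos[OF P(1)] in \<open>simp add: norm_mult norm_power abs_of_pos\<close>)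
    ultimately show ?thesis
      unfolding qTheta_eq[OF q] P_def[symmetric] s_def by (simp add: suminf_add distrib_left del: power_Suc)
  qed
  have bpos: "0 \<le> b n j" and ble: "b n j \<le> 1 / L\<^sup>2" for n j
  proof -
    show "0 \<le> b n j" using qfac_pos[OF P] by (auto simp: b_def qbin_def less_imp_le)
    have "qfac P m / (qfac P a * qfac P c) \<le> 1 / (L * L)" for m a c
      using L(1,3,4) qfac_pos[OF P] by (intro frac_le mult_mono) (auto intro: less_imp_le)
    then show "b n j \<le> 1 / L\<^sup>2" by (auto simp: b_def qbin_def power2_eq_square)
  qed
  have blim: "(\<lambda>n. b n j) \<longlonglongrightarrow> L / (L * L)" for j
  proof (rule Lim_transform_eventually)
    have sub: "(\<lambda>n. qfac P (h n)) \<longlonglongrightarrow> L" if "filterlim h sequentially sequentially" for h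
      using filterlim_compose[OF L(2) that] .
    show "(\<lambda>n. qfac P (2 * n + 1) / (qfac P (n - j) * qfac P (n + j + 1))) \<longlonglongrightarrow> L / (L * L)"
    proof (intro tendsto_divide tendsto_mult sub)
      show "filterlim (\<lambda>n::nat. 2 * n + 1) sequentially sequentially"
        by (rule filterlim_at_top_mono[OF filterlim_ident]) auto
      show "filterlim (\<lambda>n::nat. n - j) sequentially sequentially" by (rule filterlim_minus_const_nat_at_top)
      show "filterlim (\<lambda>n::nat. n + j + 1) sequentially sequentially"
        by (rule filterlim_at_top_mono[OF filterlim_ident]) auto
    qed (use L(1) in auto)
    show "\<forall>\<^sub>F n in sequentially. qfac P (2 * n + 1) / (qfac P (n - j) * qfac P (n + j + 1)) = b n j"
      using eventually_ge_at_top[of j]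
    proof eventually_elim
      case (elim n)
      then have "2 * n + 1 - (n - j) = n + j + 1" "n - j \<le> 2 * n + 1" by auto
      with elim show ?case by (simp add: b_def qbin_def)
    qed
  qed
  have tann: "(\<lambda>n. suminf (\<lambda>j. of_real (b n j) * s j)) \<longlonglongrightarrow> suminf (\<lambda>j. of_real (L / (L * L)) * s j)"
  proof -
    have bd: "norm (complex_of_real (b n j) * s j) \<le> 1 / L\<^sup>2 * norm (s j)" for n j
      using bpos[of n j] mult_right_mono[OF ble[of n j] norm_ge_zero[of "s j"]] by (simp add: norm_mult)
    have "\<forall>\<^sub>F (j, n) in at_top \<times>\<^sub>F sequentially. norm (complex_of_real (b n j) * s j) \<le> 1 / L\<^sup>2 * norm (s j)"
      using bd by (intro always_eventually) auto
    from tannerys_theorem[OF tendsto_mult[OF tendsto_of_real[OF blim] tendsto_const] this summable_mult[OF ns]]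
    show ?thesis by simp
  qed
  have fin: "suminf (\<lambda>j. of_real (b n j) * s j) = (\<Prod>i\<le>n. 1 + x * of_real P ^ i) * (\<Prod>i<n. 1 + of_real P ^ Suc i / x)" for n
  proof -
    have "suminf (\<lambda>j. of_real (b n j) * s j) = (\<Sum>j\<le>n. of_real (b n j) * s j)"
      by (rule suminf_finite) (auto simp: b_def)
    also have "\<dots> = (\<Prod>i\<le>n. 1 + x * of_real P ^ i) * (\<Prod>i<n. 1 + of_real P ^ Suc i / x)"
      unfolding finite_triple_product[OF P x0] by (rule sum.cong) (auto simp: b_def s_def theta_coeff_def)
    finally show ?thesis .
  qed
  have nr: "1 + of_real r * y \<noteq> 0" if "r \<ge> 0" "y \<notin> \<real>\<^sub>\<le>\<^sub>0" for r and y :: complex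
  proof
    assume a: "1 + of_real r * y = 0"
    then have "r \<noteq> 0" by auto
    moreover from a have "of_real r * y = of_real (- 1)" by (simp add: add_eq_0_iff)
    ultimately have "y = of_real (- 1 / r)" by (simp add: field_simps)
    then show False using that \<open>r \<noteq> 0\<close>
      by (metis divide_nonpos_nonneg neg_le_0_iff_le nonpos_Reals_of_real_iff zero_le_one)
  qed
  have ix: "inverse x \<notin> \<real>\<^sub>\<le>\<^sub>0" using x by simp
  have cp: "convergent_prod (\<lambda>i. 1 + of_real (P ^ i) * y)" for y :: complex
    using P by (intro abs_convergent_prod_imp_convergent_prod summable_imp_abs_convergent_prod)
      (simp add: norm_mult norm_power summable_mult2 summable_geometric)
  have cp': "convergent_prod (\<lambda>i. 1 + of_real (P ^ Suc i) * y)" for y :: complex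
    using P by (intro abs_convergent_prod_imp_convergent_prod summable_imp_abs_convergent_prod)
      (simp add: norm_mult norm_power summable_mult summable_mult2 summable_geometric)
  define A where "A = prodinf (\<lambda>i. 1 + of_real (P ^ i) * x)"
  define B where "B = prodinf (\<lambda>i. 1 + of_real (P ^ Suc i) * inverse x)"
  have AB: "A \<noteq> 0" "B \<noteq> 0" unfolding A_def B_def
    using P nr[OF _ x] nr[OF _ ix] by (intro prodinf_nonzero cp cp'; simp del: power_Suc of_real_power)+
  have "(\<lambda>n. (\<Prod>i\<le>n. 1 + of_real (P ^ i) * x) * (\<Prod>i<n. 1 + of_real (P ^ Suc i) * inverse x)) \<longlonglongrightarrow> A * B"
    unfolding A_def B_def
    by (intro tendsto_mult convergent_prod_LIMSEQ cp
        LIMSEQ_imp_Suc[of "\<lambda>n. prod _ {..<n}", unfolded lessThan_Suc_atMost] cp')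
  then have "(\<lambda>n. suminf (\<lambda>j. of_real (b n j) * s j)) \<longlonglongrightarrow> A * B"
    unfolding fin by (simp add: mult.commute divide_inverse)
  with tann have "suminf (\<lambda>j. of_real (L / (L * L)) * s j) = A * B" by (rule LIMSEQ_unique)
  also have "suminf (\<lambda>j. of_real (L / (L * L)) * s j) = of_real (L / (L * L)) * qTheta q k x"
    unfolding Theta by (rule suminf_mult[OF summable_norm_cancel[OF ns]])
  finally show ?thesis using AB by auto
qed

text \<open>The size of \<open>|\<Theta> x|\<close> at \<open>|x| = r\<close>: the factor that \<open>x \<mapsto> q\<^sup>1\<^sup>/\<^sup>k x\<close> produces is the same for both.\<close>

definition theta_weight :: "real \<Rightarrow> real \<Rightarrow> real \<Rightarrow> real" where
  "theta_weight q k r = exp (k * (ln r)\<^sup>2 / (2 * ln q) + ln r / 2)"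

text \<open>The quotient \<open>|\<Theta> x| / theta_weight |x|\<close> is invariant under \<open>x \<mapsto> q\<^sup>1\<^sup>/\<^sup>k x\<close>, so its infimum on the
  cone is attained in the compact part between the radii \<open>1\<close> and \<open>q\<^sup>1\<^sup>/\<^sup>k\<close>. For \<open>c < 1\<close> the cone avoids the
  negative axis, which carries all zeros.\<close>

lemma qTheta_lower_bound:
  assumes q: "q > 1" "k > 0" and c: "c < 1"
  obtains b where "b > 0"
    "\<And>x. x \<noteq> 0 \<Longrightarrow> Re x \<ge> - c * norm x \<Longrightarrow> norm (qTheta q k x) \<ge> b * theta_weight q k (norm x)"
proof -
  define lm where "lm = ln q / k"
  have lam: "lm > 0" using q by (simp add: lm_def)
  have P: "q powr (- 1 / k) = exp (- lm)" using q by (simp add: powr_def lm_def)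
  define \<Phi> where "\<Phi> x = norm (qTheta q k x) / theta_weight q k (norm x)" for x
  have tw: "theta_weight q k r = exp ((ln r)\<^sup>2 / (2 * lm) + ln r / 2)" for r
    using q by (simp add: theta_weight_def lm_def)
  have inv: "\<Phi> (x * of_real (exp lm)) = \<Phi> x" if "x \<noteq> 0" for x
  proof -
    have "qTheta q k (x * of_real (exp lm)) = x * of_real (exp lm) * qTheta q k x"
      using qTheta_shift[OF q that] unfolding P
      by (simp add: exp_minus divide_inverse exp_of_real)
    moreover have "theta_weight q k (norm x * exp lm) = norm x * exp lm * theta_weight q k (norm x)"
    proof -
      have l: "ln (norm x * exp lm) = ln (norm x) + lm" using that by (simp add: ln_mult)
      have "(ln (norm x) + lm)\<^sup>2 / (2 * lm) + (ln (norm x) + lm) / 2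
         = ln (norm x) + lm + ((ln (norm x))\<^sup>2 / (2 * lm) + ln (norm x) / 2)"
        using lam by (simp add: field_simps power2_eq_square)
      then show ?thesis unfolding tw l using that by (simp only: exp_add) simp
    qed
    ultimately show ?thesis using that by (simp add: \<Phi>_def norm_mult)
  qed
  have invn: "\<Phi> (x * of_real (exp (lm * real n))) = \<Phi> x" if "x \<noteq> 0" for x n
  proof (induction n)
    case (Suc n)
    have "\<Phi> (x * of_real (exp (lm * real n)) * of_real (exp lm)) = \<Phi> (x * of_real (exp (lm * real n)))"
      by (rule inv) (use that in auto)
    then show ?case using Suc by (simp add: exp_add distrib_left mult_ac)
  qed simp
  have invi: "\<Phi> (x * of_real (exp (lm * of_int n))) = \<Phi> x" if "x \<noteq> 0" for x and n :: int
  proof (cases "n \<ge> 0")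
    case True then show ?thesis using invn[OF that, of "nat n"] by simp
  next
    case False
    have "\<Phi> (x * of_real (exp (lm * of_int n)) * of_real (exp (lm * real (nat (- n))))) = \<Phi> (x * of_real (exp (lm * of_int n)))"
      by (rule invn) (use that in auto)
    moreover have "exp (lm * of_int n) * exp (lm * real (nat (- n))) = 1" using False by (simp add: exp_add[symmetric])
    then have "x * of_real (exp (lm * of_int n)) * of_real (exp (lm * real (nat (- n)))) = x"
      by (metis mult.assoc mult.right_neutral of_real_1 of_real_mult)
    ultimately show ?thesis by simp
  qed
  \<comment> \<open>The part of the cone in the closed annulus between the radii 1 and \<open>exp lm\<close>.\<close>
  define K where "K = {x. Re x \<ge> - c * norm x} \<inter> {x. 1 \<le> norm x} \<inter> cball 0 (exp lm)"
  have K: "compact K" unfolding K_def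
    by (intro closed_Int_compact closed_Int closed_Collect_le continuous_intros compact_cball)
  have cont: "continuous_on K \<Phi>" unfolding \<Phi>_def tw
    by (intro continuous_intros continuous_on_subset[OF holomorphic_on_imp_continuous_on[OF qTheta_holomorphic[OF q]]])
      (use lam in \<open>auto simp: K_def\<close>)
  have pos: "\<Phi> x > 0" if "x \<in> K" for x
  proof -
    have "x \<notin> \<real>\<^sub>\<le>\<^sub>0"
    proof
      assume "x \<in> \<real>\<^sub>\<le>\<^sub>0"
      then have x: "Re x = - norm x" by (auto elim!: nonpos_Reals_cases)
      have "norm x \<ge> 1" "- norm x \<ge> - c * norm x" using that unfolding K_def x[symmetric] by auto
      then have "norm x * (1 - c) \<le> 0" by (simp add: algebra_simps)
      then show False using c \<open>norm x \<ge> 1\<close> by (auto simp: mult_le_0_iff)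
    qed
    then have "qTheta q k x \<noteq> 0" by (rule qTheta_nonzero[OF q])
    then show ?thesis by (simp add: \<Phi>_def theta_weight_def)
  qed
  obtain b where b: "b > 0" "\<And>x. x \<in> K \<Longrightarrow> \<Phi> x \<ge> b"
  proof (cases "K = {}")
    case True then show ?thesis using that[of 1] by auto
  next
    case False
    from continuous_attains_inf[OF K False cont] pos that show ?thesis by blast
  qed
  show ?thesis
  proof (rule that[OF b(1)])
    fix x :: complex assume x: "x \<noteq> 0" "Re x \<ge> - c * norm x"
    \<comment> \<open>The power of \<open>q\<^sup>1\<^sup>/\<^sup>k\<close> that moves \<open>x\<close> into the annulus.\<close>
    define n where "n = \<lfloor>ln (norm x) / lm\<rfloor>"
    define r where "r = exp (lm * of_int (- n))"
    have r: "r > 0" by (simp add: r_def)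
    have "of_int n \<le> ln (norm x) / lm" "ln (norm x) / lm < of_int n + 1" by (auto simp: n_def)
    then have "lm * of_int n \<le> ln (norm x)" "ln (norm x) \<le> lm * (of_int n + 1)"
      using lam by (auto simp: field_simps)
    then have "0 \<le> ln (norm x * r)" "ln (norm x * r) \<le> lm"
      using x(1) by (auto simp: ln_mult r_def algebra_simps)
    then have "exp 0 \<le> exp (ln (norm x * r))" "exp (ln (norm x * r)) \<le> exp lm"
      by (simp_all only: exp_le_cancel_iff)
    then have "1 \<le> norm x * r" "norm x * r \<le> exp lm"
      using x(1) r by simp_all
    moreover have "Re (x * of_real r) \<ge> - c * norm (x * of_real r)"
      using x(2) r mult_right_mono[OF x(2), of r] by (simp add: norm_mult mult_ac)
    ultimately have "x * of_real r \<in> K" using r by (simp add: K_def norm_mult)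
    from b(2)[OF this] have "b \<le> \<Phi> x" unfolding r_def using invi[OF x(1), of "- n"] by simp
    then show "norm (qTheta q k x) \<ge> b * theta_weight q k (norm x)"
      by (simp add: \<Phi>_def theta_weight_def field_simps)
  qed
qed

section \<open>Rotation of rays of integration\<close>

text \<open>A majorant that decays like \<open>exp (- |ln y| / 2)\<close> at both ends. This form has the
  elementary primitive \<open>2 arctan (\<surd>y)\<close> with respect to \<open>dy / y\<close>.\<close>

definition decay :: "real \<Rightarrow> real" where
  "decay y = sqrt y / (1 + y)"

lemma decay_nonneg: "0 \<le> y \<Longrightarrow> 0 \<le> decay y"
  by (simp add: decay_def)

lemma decay_integral:
  assumes T: "T > 0"
  shows "set_integrable lborel {0<..} (\<lambda>r. decay (r / T) / r)"
    and "(LINT r:{0<..}|lborel. decay (r / T) / r) = pi"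
proof -
  let ?F = "\<lambda>r. 2 * arctan (sqrt (r / T))"
  have ei: "einterval 0 \<infinity> = {0<..}" by (auto simp: einterval_def zero_ereal_def)
  have D: "(?F has_real_derivative decay (r / T) / r) (at r)" if "0 < r" for r
  proof -
    define s where "s = sqrt (r / T)"
    have s: "s > 0" "r = T * s\<^sup>2" using that T by (auto simp: s_def)
    have "(?F has_real_derivative 2 * (inverse (1 + s\<^sup>2) * (inverse s / 2 * (1 / T)))) (at r)"
      unfolding s_def using that T
      by (auto intro!: derivative_eq_intros simp: divide_less_0_iff simp del: real_sqrt_pow2 power_divide)
    also have "2 * (inverse (1 + s\<^sup>2) * (inverse s / 2 * (1 / T))) = decay (r / T) / r"
    proof -
      have "r / T = s\<^sup>2" using s T by simp
      then have "decay (r / T) = s / (1 + s\<^sup>2)" using s(1) by (simp only: decay_def) simp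
      then have "decay (r / T) / r = s / (1 + s\<^sup>2) / (T * s\<^sup>2)" by (simp only: s(2)[symmetric])
      also have "\<dots> = 1 / ((1 + s\<^sup>2) * s * T)" using s(1) by (simp add: power2_eq_square)
      also have "\<dots> = 2 * (inverse (1 + s\<^sup>2) * (inverse s / 2 * (1 / T)))"
        by (simp add: inverse_eq_divide)
      finally show ?thesis by (rule sym)
    qed
    finally show ?thesis .
  qed
  have l0: "((?F \<circ> real_of_ereal) \<longlongrightarrow> 0) (at_right 0)"
  proof -
    have "(?F \<longlongrightarrow> 2 * arctan (sqrt (0 / T))) (at_right 0)"
      by (intro tendsto_intros) (use T in auto)
    then show ?thesis by (simp add: zero_ereal_def ereal_tendsto_simps1)
  qed
  have l1: "((?F \<circ> real_of_ereal) \<longlongrightarrow> pi) (at_left \<infinity>)"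
  proof -
    have "filterlim (\<lambda>r. sqrt (r / T)) at_top at_top"
      using T by real_asymp
    from filterlim_compose[OF tendsto_arctan_at_top this]
    have "(?F \<longlongrightarrow> 2 * (pi / 2)) at_top" by (intro tendsto_intros)
    then show ?thesis by (simp add: ereal_tendsto_simps1)
  qed
  have c: "isCont (\<lambda>r. decay (r / T) / r) r" if "0 < r" for r
    unfolding decay_def using that T by (intro continuous_intros) (auto simp: add_pos_pos less_imp_neq[symmetric])
  have nn: "0 \<le> decay (r / T) / r" if "0 < r" for r using that T by (auto intro!: divide_nonneg_pos decay_nonneg)
  have A: "(0::ereal) < \<infinity>" by simp
  note I = interval_integral_FTC_nonneg[OF A, of ?F "\<lambda>r. decay (r / T) / r" 0 pi]
  show "set_integrable lborel {0<..} (\<lambda>r. decay (r / T) / r)"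
    using I(1) D c nn l0 l1 unfolding ei by (simp add: zero_ereal_def)
  have "(LBINT r=0..\<infinity>. decay (r / T) / r) = pi - 0"
    using D c nn l0 l1 by (intro I(2)) (auto simp: zero_ereal_def)
  then show "(LINT r:{0<..}|lborel. decay (r / T) / r) = pi"
    unfolding interval_lebesgue_integral_def ei by simp
qed

text \<open>With such a majorant a ray integral converges absolutely, and arcs of radius tending to \<open>0\<close> or \<open>\<infinity>\<close>
  can be dropped.\<close>

definition ray_bound :: "(real \<Rightarrow> real) \<Rightarrow> bool" where
  "ray_bound h \<longleftrightarrow> set_integrable lborel {0<..} (\<lambda>r. h r / r) \<and> (h \<longlongrightarrow> 0) (at_right 0) \<and> (h \<longlongrightarrow> 0) at_top"

lemma ray_bound_decay:
  assumes "T > 0" shows "ray_bound (\<lambda>r. C * decay (r / T))"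
proof -
  have "((\<lambda>r. C * (sqrt (r / T) / (1 + r / T))) \<longlongrightarrow> C * (sqrt (0 / T) / (1 + 0 / T))) (at_right 0)"
    by (intro tendsto_intros) (use assms in auto)
  moreover have "((\<lambda>r. C * (sqrt (r / T) / (1 + r / T))) \<longlongrightarrow> 0) at_top"
    using assms by real_asymp
  moreover have "set_integrable lborel {0<..} (\<lambda>r. C * (decay (r / T) / r))"
    by (rule set_integrable_mult_right) (use decay_integral(1)[OF assms] in auto)
  ultimately show ?thesis by (simp add: ray_bound_def decay_def)
qed

lemma ray_bound_add: "ray_bound h \<Longrightarrow> ray_bound g \<Longrightarrow> ray_bound (\<lambda>r. h r + g r)"
  unfolding ray_bound_def by (auto simp: add_divide_distrib intro: tendsto_add_zero)

lemma ray_integrable: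
  fixes F :: "complex \<Rightarrow> complex"
  assumes h: "ray_bound h" and cont: "continuous_on A (\<lambda>r. F (of_real r * cis \<phi>))"
    and A: "A \<in> sets borel" "A \<subseteq> {0<..}"
    and bd: "\<And>r. r \<in> A \<Longrightarrow> norm (F (of_real r * cis \<phi>)) \<le> h r"
  shows "set_integrable lborel A (\<lambda>r. F (of_real r * cis \<phi>) / of_real r)"
proof (rule set_integrable_bound)
  show "set_integrable lborel A (\<lambda>r. h r / r)"
    by (rule set_integrable_subset[of _ "{0<..}"]) (use h A in \<open>auto simp: ray_bound_def\<close>)
  show "set_borel_measurable lborel A (\<lambda>r. F (of_real r * cis \<phi>) / of_real r)"
  proof -
    have "continuous_on A (\<lambda>r. F (of_real r * cis \<phi>) / of_real r)"
      by (intro continuous_intros cont) (use A in auto)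
    from borel_measurable_continuous_on_indicator[OF A(1) this]
    show ?thesis by (simp add: set_borel_measurable_def)
  qed
  show "AE r in lborel. r \<in> A \<longrightarrow> norm (F (of_real r * cis \<phi>) / of_real r) \<le> norm (h r / r)"
  proof (intro AE_I2 impI)
    fix r assume r: "r \<in> A"
    then have "r > 0" using A by auto
    with bd[OF r] norm_ge_zero[of "F (of_real r * cis \<phi>)"]
    show "norm (F (of_real r * cis \<phi>) / of_real r) \<le> norm (h r / r)"
      by (simp add: norm_divide divide_right_mono)
  qed
qed

lemma exp_ln_cis: "r > 0 \<Longrightarrow> exp (Complex (ln r) \<phi>) = of_real r * cis \<phi>"
  by (simp add: exp_eq_polar exp_of_real[symmetric])

text \<open>Cauchy's theorem for an annular sector. In the coordinate \<open>w = ln u\<close> the measure \<open>du / u\<close> becomes \<open>dw\<close> and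
  the sector becomes a rectangle in a convex strip, on which \<open>F (exp w)\<close> has a primitive. The radii give
  differences of values of this primitive, the arcs are estimated by its derivative.\<close>

lemma annular_sector_contour:
  fixes F :: "complex \<Rightarrow> complex"
  assumes hol: "F holomorphic_on D"
    and strip: "\<And>w. lo < Im w \<Longrightarrow> Im w < hi \<Longrightarrow> Re w < c \<Longrightarrow> exp w \<in> D"
    and ab: "closed_segment a b \<subseteq> {lo<..<hi}"
    and r: "0 < r0" "r0 \<le> r1" "ln r1 < c"
    and e: "\<And>\<phi>. \<phi> \<in> closed_segment a b \<Longrightarrow> norm (F (of_real r0 * cis \<phi>)) \<le> e0"
      "\<And>\<phi>. \<phi> \<in> closed_segment a b \<Longrightarrow> norm (F (of_real r1 * cis \<phi>)) \<le> e1"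
  shows "norm (integral {r0..r1} (\<lambda>r. F (of_real r * cis a) / of_real r)
      - integral {r0..r1} (\<lambda>r. F (of_real r * cis b) / of_real r)) \<le> (e0 + e1) * \<bar>b - a\<bar>"
proof -
  define V where "V = {w. lo < Im w} \<inter> {w. Im w < hi} \<inter> {w. Re w < c}"
  have V: "open V" "convex V" unfolding V_def
    by (intro open_Int open_halfspace_Im_gt open_halfspace_Im_lt open_halfspace_Re_lt convex_Int
        convex_halfspace_Im_gt convex_halfspace_Im_lt convex_halfspace_Re_lt)+
  have "(F \<circ> exp) holomorphic_on V"
    by (rule holomorphic_on_compose_gen[OF holomorphic_on_exp hol]) (use strip in \<open>auto simp: V_def\<close>)
  from holomorphic_convex_primitive'[OF V(2,1) this] obtain G
    where G: "\<And>w. w \<in> V \<Longrightarrow> (G has_field_derivative F (exp w)) (at w)"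
    using V(1) by (auto simp: at_within_open[of _ V])
  have VI: "Complex (ln r) \<phi> \<in> V" if "0 < r" "r \<le> r1" "\<phi> \<in> closed_segment a b" for r \<phi>
  proof -
    have "ln r \<le> ln r1" using that by simp
    then have "ln r < c" using r(3) by linarith
    with that ab show ?thesis by (auto simp: V_def)
  qed
  have int: "integral {r0..r1} (\<lambda>r. F (of_real r * cis \<phi>) / of_real r)
      = G (Complex (ln r1) \<phi>) - G (Complex (ln r0) \<phi>)" if \<phi>: "\<phi> \<in> closed_segment a b" for \<phi>
  proof (rule integral_unique, rule fundamental_theorem_of_calculus[OF r(2)])
    fix x assume x: "x \<in> {r0..r1}"
    then have x0: "x > 0" using r by auto
    have "((\<lambda>x. of_real (ln x) + \<i> * of_real \<phi>) has_vector_derivative of_real (1 / x) + 0) (at x)"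
      by (intro has_vector_derivative_add has_vector_derivative_of_real has_vector_derivative_const
          DERIV_ln_divide x0)
    then have "((\<lambda>x. Complex (ln x) \<phi>) has_vector_derivative of_real (1 / x)) (at x)"
      by (simp add: Complex_eq)
    from field_vector_diff_chain_at[OF this G[OF VI[OF x0 _ \<phi>]]] x x0
    have "(G \<circ> (\<lambda>x. Complex (ln x) \<phi>) has_vector_derivative of_real (1 / x) * F (of_real x * cis \<phi>)) (at x)"
      by (simp add: exp_ln_cis)
    then show "((\<lambda>r. G (Complex (ln r) \<phi>)) has_vector_derivative F (of_real x * cis \<phi>) / of_real x) (at x within {r0..r1})"
      by (simp add: o_def has_vector_derivative_at_within)
  qed
  have arc: "norm (G (Complex (ln r) a) - G (Complex (ln r) b)) \<le> e * \<bar>b - a\<bar>"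
    if "0 < r" "r \<le> r1" and e: "\<And>\<phi>. \<phi> \<in> closed_segment a b \<Longrightarrow> norm (F (of_real r * cis \<phi>)) \<le> e" for r e
  proof -
    have seg: "closed_segment (Complex (ln r) a) (Complex (ln r) b) = Complex (ln r) ` closed_segment a b"
      unfolding closed_segment_def by (force simp: complex_eq_iff algebra_simps)
    have "norm (G (Complex (ln r) a) - G (Complex (ln r) b)) \<le> e * norm (Complex (ln r) a - Complex (ln r) b)"
    proof (rule field_differentiable_bound[OF convex_closed_segment])
      fix z assume "z \<in> closed_segment (Complex (ln r) a) (Complex (ln r) b)"
      then obtain \<phi> where \<phi>: "\<phi> \<in> closed_segment a b" "z = Complex (ln r) \<phi>" unfolding seg by auto
      show "(G has_field_derivative F (exp z)) (at z within closed_segment (Complex (ln r) a) (Complex (ln r) b))"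
        using G[OF VI[OF that(1,2) \<phi>(1)]] by (simp add: \<phi>(2) has_field_derivative_at_within)
      show "norm (F (exp z)) \<le> e" using e[OF \<phi>(1)] that(1) by (simp add: \<phi>(2) exp_ln_cis)
    qed auto
    also have "norm (Complex (ln r) a - Complex (ln r) b) = \<bar>b - a\<bar>"
      by (simp add: cmod_def)
    finally show ?thesis .
  qed
  let ?G = "\<lambda>r \<phi>. G (Complex (ln r) \<phi>)"
  have "norm ((?G r1 a - ?G r0 a) - (?G r1 b - ?G r0 b)) = norm ((?G r1 a - ?G r1 b) - (?G r0 a - ?G r0 b))"
    by (simp add: algebra_simps)
  also have "\<dots> \<le> norm (?G r1 a - ?G r1 b) + norm (?G r0 a - ?G r0 b)" by (rule norm_triangle_ineq4)
  also have "\<dots> \<le> e1 * \<bar>b - a\<bar> + e0 * \<bar>b - a\<bar>" by (intro add_mono arc) (use r e in auto)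
  finally show ?thesis using int[of a] int[of b] by (simp add: distrib_right add.commute)
qed

lemma ray_integral_tendsto_0:
  fixes f :: "real \<Rightarrow> complex"
  assumes "R > 0" "set_integrable lborel {0<..R} f"
  shows "(\<lambda>n. integral {R / (real n + 1)..R} f) \<longlonglongrightarrow> (LINT r:{0<..R}|lborel. f r)"
proof -
  have U: "(\<Union>n. {R / (real n + 1)..R}) = {0<..R}"
  proof (intro equalityI subsetI)
    fix r assume r: "r \<in> {0<..R}"
    obtain n :: nat where "R / r < real n" using reals_Archimedean2 by blast
    then have "R / (real n + 1) \<le> r" using r assms(1) by (simp add: field_simps)
    then show "r \<in> (\<Union>n. {R / (real n + 1)..R})" using r by auto
  next
    fix r assume "r \<in> (\<Union>n. {R / (real n + 1)..R})"
    then obtain n where "R / (real n + 1) \<le> r" "r \<le> R" by auto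
    moreover have "0 < R / (real n + 1)" using assms(1) by simp
    ultimately show "r \<in> {0<..R}" by auto
  qed
  have "(\<lambda>n. LINT r:{R / (real n + 1)..R}|lborel. f r) \<longlonglongrightarrow> (LINT r:(\<Union>n. {R / (real n + 1)..R})|lborel. f r)"
  proof (rule set_integral_cont_up)
    show "incseq (\<lambda>n. {R / (real n + 1)..R})"
    proof (rule incseq_SucI)
      fix n
      have "R / (real (Suc n) + 1) \<le> R / (real n + 1)" using assms(1) by (intro divide_left_mono) auto
      then show "{R / (real n + 1)..R} \<subseteq> {R / (real (Suc n) + 1)..R}" by auto
    qed
  qed (use assms U in auto)
  moreover have "(LINT r:{R / (real n + 1)..R}|lborel. f r) = integral {R / (real n + 1)..R} f" for n
    by (rule set_borel_integral_eq_integral, rule set_integrable_subset[OF assms(2)])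
      (use U in auto)
  ultimately show ?thesis by (simp add: U)
qed

lemma ray_integral_tendsto_top:
  fixes f :: "real \<Rightarrow> complex"
  assumes "set_integrable lborel {0<..} f"
  shows "(\<lambda>n. LINT r:{0<..real (Suc n)}|lborel. f r) \<longlonglongrightarrow> (LINT r:{0<..}|lborel. f r)"
proof -
  have U: "(\<Union>n. {0<..real (Suc n)}) = {0<..}"
  proof (intro equalityI subsetI)
    fix r :: real assume r: "r \<in> {0<..}"
    obtain n :: nat where "r < real n" using reals_Archimedean2 by blast
    then have "r \<in> {0<..real (Suc n)}" using r by simp
    then show "r \<in> (\<Union>n. {0<..real (Suc n)})" by blast
  qed auto
  have "(\<lambda>n. LINT r:{0<..real (Suc n)}|lborel. f r) \<longlonglongrightarrow> (LINT r:(\<Union>n. {0<..real (Suc n)})|lborel. f r)"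
  proof (rule set_integral_cont_up)
    show "incseq (\<lambda>n. {0<..real (Suc n)})" by (rule incseq_SucI) auto
    show "set_integrable lborel (\<Union>n. {0<..real (Suc n)}) f" unfolding U by (rule assms)
  qed simp
  then show ?thesis unfolding U .
qed

text \<open>The arc near the origin disappears in the limit, so a rotation of the truncated rays costs only the
  arc at the outer radius.\<close>

lemma truncated_ray_rotation:
  fixes F :: "complex \<Rightarrow> complex"
  assumes hol: "F holomorphic_on D"
    and strip: "\<And>w. lo < Im w \<Longrightarrow> Im w < hi \<Longrightarrow> Re w < c \<Longrightarrow> exp w \<in> D"
    and ab: "closed_segment a b \<subseteq> {lo<..<hi}"
    and R: "0 < R" "ln R < c"
    and h: "ray_bound h"
    and bd: "\<And>r \<phi>. 0 < r \<Longrightarrow> r \<le> R \<Longrightarrow> \<phi> \<in> closed_segment a b \<Longrightarrow> norm (F (of_real r * cis \<phi>)) \<le> h r"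
    and e: "\<And>\<phi>. \<phi> \<in> closed_segment a b \<Longrightarrow> norm (F (of_real R * cis \<phi>)) \<le> e"
  shows "norm ((LINT r:{0<..R}|lborel. F (of_real r * cis a) / of_real r)
      - (LINT r:{0<..R}|lborel. F (of_real r * cis b) / of_real r)) \<le> e * \<bar>b - a\<bar>"
proof -
  have cont: "continuous_on {0<..R} (\<lambda>r. F (of_real r * cis \<phi>))" if "\<phi> \<in> closed_segment a b" for \<phi>
  proof (rule continuous_on_compose2[OF holomorphic_on_imp_continuous_on[OF hol]])
    show "continuous_on {0<..R} (\<lambda>r. complex_of_real r * cis \<phi>)" by (intro continuous_intros)
    show "(\<lambda>r. complex_of_real r * cis \<phi>) ` {0<..R} \<subseteq> D"
    proof (rule image_subsetI)
      fix r assume r: "r \<in> {0<..R}"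
      then have "ln r \<le> ln R" by simp
      then have "exp (Complex (ln r) \<phi>) \<in> D" using that ab R by (intro strip) auto
      then show "complex_of_real r * cis \<phi> \<in> D" using r by (simp add: exp_ln_cis)
    qed
  qed
  have int: "set_integrable lborel {0<..R} (\<lambda>r. F (of_real r * cis \<phi>) / of_real r)" if "\<phi> \<in> closed_segment a b" for \<phi>
    by (rule ray_integrable[OF h cont[OF that]]) (use bd that in auto)
  let ?d = "\<lambda>n. norm (integral {R / (real n + 1)..R} (\<lambda>r. F (of_real r * cis a) / of_real r)
      - integral {R / (real n + 1)..R} (\<lambda>r. F (of_real r * cis b) / of_real r))"
  have le: "?d n \<le> (h (R / (real n + 1)) + e) * \<bar>b - a\<bar>" for n
  proof (rule annular_sector_contour[OF hol strip ab _ _ R(2) _ e])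
    have "R / (real n + 1) > 0" and le: "R / (real n + 1) \<le> R" using R by (auto simp: field_simps)
    then show "norm (F (complex_of_real (R / (real n + 1)) * cis \<phi>)) \<le> h (R / (real n + 1))"
      if "\<phi> \<in> closed_segment a b" for \<phi> using bd that by blast
  qed (use R in \<open>auto simp: field_simps\<close>)
  have "(\<lambda>n. R / (real n + 1)) \<longlonglongrightarrow> 0" by real_asymp
  then have "filterlim (\<lambda>n. R / (real n + 1)) (at_right 0) sequentially"
    using R by (auto simp: filterlim_at intro!: always_eventually)
  then have "(\<lambda>n. h (R / (real n + 1))) \<longlonglongrightarrow> 0"
    using h by (auto simp: ray_bound_def intro: filterlim_compose)
  then have "(\<lambda>n. (h (R / (real n + 1)) + e) * \<bar>b - a\<bar>) \<longlonglongrightarrow> (0 + e) * \<bar>b - a\<bar>"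
    by (intro tendsto_intros)
  moreover have "?d \<longlonglongrightarrow> norm ((LINT r:{0<..R}|lborel. F (of_real r * cis a) / of_real r)
      - (LINT r:{0<..R}|lborel. F (of_real r * cis b) / of_real r))"
    by (intro tendsto_intros ray_integral_tendsto_0 int R) auto
  ultimately show ?thesis using le by (auto intro: LIMSEQ_le)
qed

lemma ray_rotation:
  fixes F :: "complex \<Rightarrow> complex"
  assumes hol: "F holomorphic_on D"
    and strip: "\<And>w. lo < Im w \<Longrightarrow> Im w < hi \<Longrightarrow> exp w \<in> D"
    and ab: "closed_segment a b \<subseteq> {lo<..<hi}"
    and h: "ray_bound h"
    and bd: "\<And>r \<phi>. 0 < r \<Longrightarrow> \<phi> \<in> closed_segment a b \<Longrightarrow> norm (F (of_real r * cis \<phi>)) \<le> h r"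
  shows "(LINT r:{0<..}|lborel. F (of_real r * cis a) / of_real r)
      = (LINT r:{0<..}|lborel. F (of_real r * cis b) / of_real r)"
proof -
  have cont: "continuous_on {0<..} (\<lambda>r. F (of_real r * cis \<phi>))" if "\<phi> \<in> closed_segment a b" for \<phi>
  proof (rule continuous_on_compose2[OF holomorphic_on_imp_continuous_on[OF hol]])
    show "continuous_on {0<..} (\<lambda>r. complex_of_real r * cis \<phi>)" by (intro continuous_intros)
    show "(\<lambda>r. complex_of_real r * cis \<phi>) ` {0<..} \<subseteq> D"
    proof (rule image_subsetI)
      fix r :: real assume r: "r \<in> {0<..}"
      have "exp (Complex (ln r) \<phi>) \<in> D" using that ab by (intro strip) auto
      then show "complex_of_real r * cis \<phi> \<in> D" using r by (simp add: exp_ln_cis)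
    qed
  qed
  have int: "set_integrable lborel {0<..} (\<lambda>r. F (of_real r * cis \<phi>) / of_real r)" if "\<phi> \<in> closed_segment a b" for \<phi>
    by (rule ray_integrable[OF h cont[OF that]]) (use bd that in auto)
  let ?d = "\<lambda>n. norm ((LINT r:{0<..real (Suc n)}|lborel. F (of_real r * cis a) / of_real r)
      - (LINT r:{0<..real (Suc n)}|lborel. F (of_real r * cis b) / of_real r))"
  have le: "?d n \<le> h (real (Suc n)) * \<bar>b - a\<bar>" for n
  proof (rule truncated_ray_rotation[OF hol _ ab, of "ln (real (Suc n)) + 1"])
    show "norm (F (complex_of_real (real (Suc n)) * cis \<phi>)) \<le> h (real (Suc n))"
      if "\<phi> \<in> closed_segment a b" for \<phi> by (rule bd[OF _ that]) simp
  qed (use h bd strip in \<open>auto simp del: of_nat_Suc\<close>)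
  have "filterlim (\<lambda>n. real (Suc n)) at_top sequentially" by real_asymp
  then have "(\<lambda>n. h (real (Suc n))) \<longlonglongrightarrow> 0"
    using h by (auto simp: ray_bound_def simp del: of_nat_Suc intro: filterlim_compose)
  then have l1: "(\<lambda>n. h (real (Suc n)) * \<bar>b - a\<bar>) \<longlonglongrightarrow> 0 * \<bar>b - a\<bar>"
    by (intro tendsto_intros)
  have l2: "?d \<longlonglongrightarrow> norm ((LINT r:{0<..}|lborel. F (of_real r * cis a) / of_real r)
      - (LINT r:{0<..}|lborel. F (of_real r * cis b) / of_real r))"
    by (intro tendsto_intros ray_integral_tendsto_top int) auto
  have "norm ((LINT r:{0<..}|lborel. F (of_real r * cis a) / of_real r)
      - (LINT r:{0<..}|lborel. F (of_real r * cis b) / of_real r)) \<le> 0 * \<bar>b - a\<bar>"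
    by (rule LIMSEQ_le[OF l2 l1]) (use le in blast)
  then show ?thesis by simp
qed

section \<open>Sectors and directions\<close>

text \<open>As the image of a strip under the exponential function, a sector is open.\<close>

lemma sector_eq_exp: "sector d \<eta> = exp ` {w. d - \<eta> < Im w \<and> Im w < d + \<eta>}"
proof (intro equalityI subsetI)
  fix u assume "u \<in> sector d \<eta>"
  then obtain r \<theta> where u: "u = of_real r * cis \<theta>" "r > 0" "\<bar>\<theta> - d\<bar> < \<eta>" by (auto simp: sector_def)
  then show "u \<in> exp ` {w. d - \<eta> < Im w \<and> Im w < d + \<eta>}"
    by (intro image_eqI[of _ _ "Complex (ln r) \<theta>"]) (auto simp: exp_ln_cis)
next
  fix u assume "u \<in> exp ` {w. d - \<eta> < Im w \<and> Im w < d + \<eta>}"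
  then obtain w where w: "u = exp w" "d - \<eta> < Im w" "Im w < d + \<eta>" by blast
  have "u = of_real (exp (Re w)) * cis (Im w)" unfolding w by (rule exp_eq_polar)
  moreover have "\<bar>Im w - d\<bar> < \<eta>" using w by (auto simp: abs_less_iff)
  ultimately show "u \<in> sector d \<eta>" unfolding sector_def by force
qed

lemma open_sector: "open (sector d \<eta>)"
proof -
  have eq: "{w. d - \<eta> < Im w \<and> Im w < d + \<eta>} = {w. d - \<eta> < Im w} \<inter> {w. Im w < d + \<eta>}" by auto
  have "\<not> (exp :: complex \<Rightarrow> complex) constant_on UNIV"
  proof
    assume "(exp :: complex \<Rightarrow> complex) constant_on UNIV"
    then have "exp (0::complex) = exp (of_real 1)" unfolding constant_on_def by (metis UNIV_I)
    then have "norm (exp (0::complex)) = norm (exp (of_real 1 :: complex))" by (rule arg_cong)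
    then have "exp (1::real) = 1" by (simp add: norm_exp_eq_Re)
    moreover have "1 < exp (1::real)" by (rule exp_gt_one) simp
    ultimately show False by linarith
  qed
  then show ?thesis
    unfolding sector_eq_exp eq
    by (intro open_mapping_thm[of exp UNIV] open_Int open_halfspace_Im_gt open_halfspace_Im_lt holomorphic_on_exp) auto
qed

lemma sector_cone: "u \<in> sector d \<eta> \<Longrightarrow> r > 0 \<Longrightarrow> of_real r * u \<in> sector d \<eta>"
proof -
  assume "u \<in> sector d \<eta>" and r: "r > 0"
  then obtain s \<theta> where u: "u = of_real s * cis \<theta>" "s > 0" "\<bar>\<theta> - d\<bar> < \<eta>" by (auto simp: sector_def)
  have "of_real r * u = of_real (r * s) * cis \<theta>" "r * s > 0" using u r by auto
  with u(3) show "of_real r * u \<in> sector d \<eta>" unfolding sector_def by blast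
qed

lemma unbounded_sector_props:
  assumes "unbounded_sector d V"
  shows "open V" "\<And>u r. u \<in> V \<Longrightarrow> r > 0 \<Longrightarrow> of_real r * u \<in> V" "cis d \<in> V" "0 \<notin> V"
proof -
  obtain \<eta> where eta: "0 < \<eta>" and V: "V = sector d \<eta>" using assms by (auto simp: unbounded_sector_def)
  show "open V" unfolding V by (rule open_sector)
  show "of_real r * u \<in> V" if "u \<in> V" "r > 0" for u r using that sector_cone unfolding V by blast
  have "cis d = of_real 1 * cis d" by simp
  then show "cis d \<in> V" unfolding V sector_def using eta by (metis (mono_tags, lifting) CollectI abs_zero cancel_comm_monoid_add_class.diff_cancel zero_less_one)
  show "0 \<notin> V" unfolding V sector_def by auto
qed

text \<open>The squared distance from \<open>-1\<close> to a point of the ray through \<open>z\<close> is a quadratic polynomial in the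
  parameter of the ray with minimum \<open>1 - (Re z / |z|)\<^sup>2\<close>, taken at a positive parameter
  iff \<open>Re z < 0\<close>. So the condition of distance that defines \<open>R_set\<close> is a condition on the angle.\<close>

lemma ray_distance_iff:
  fixes z :: complex
  assumes z: "z \<noteq> 0" and d: "0 < d" "d < 1" and c: "0 \<le> c" "c\<^sup>2 = 1 - d\<^sup>2"
  shows "(\<forall>r\<ge>0. norm (1 + of_real r * z) > d) \<longleftrightarrow> Re z > - c * norm z"
proof -
  define x where "x = Re z / norm z"
  have n: "norm z > 0" using z by simp
  have dd: "d\<^sup>2 < 1" using d by (simp add: power_less_one_iff abs_square_less_1)
  have sq: "(norm (1 + of_real r * z))\<^sup>2 = (r * norm z + x)\<^sup>2 + (1 - x\<^sup>2)" for r
  proof -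
    have "(norm (1 + of_real r * z))\<^sup>2 = 1 + 2 * r * Re z + r\<^sup>2 * (norm z)\<^sup>2"
      unfolding cmod_power2 by (simp add: power2_eq_square algebra_simps)
    moreover have "norm z * x = Re z" using n by (simp add: x_def)
    then have "(r * norm z + x)\<^sup>2 = r\<^sup>2 * (norm z)\<^sup>2 + 2 * r * Re z + x\<^sup>2"
      by (simp add: power2_sum power_mult_distrib mult.assoc)
    ultimately show ?thesis by simp
  qed
  have "Re z > - c * norm z \<longleftrightarrow> x > - c" unfolding x_def using pos_less_divide_eq[OF n] by metis
  moreover have "(\<forall>r\<ge>0. norm (1 + of_real r * z) > d) \<longleftrightarrow> x > - c"
  proof
    assume *: "\<forall>r\<ge>0. norm (1 + of_real r * z) > d"
    show "x > - c"
    proof (rule ccontr)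
      assume "\<not> x > - c"
      then have a: "c \<le> - x" by linarith
      have r: "- x / norm z \<ge> 0" using a c n by (intro divide_nonneg_nonneg) linarith+
      have "c\<^sup>2 \<le> x\<^sup>2" using power_mono[OF a c(1), of 2] by simp
      moreover have "- x / norm z * norm z + x = 0" using n by simp
      ultimately have "(norm (1 + of_real (- x / norm z) * z))\<^sup>2 \<le> d\<^sup>2" unfolding sq using c(2) by simp
      then have "norm (1 + of_real (- x / norm z) * z) \<le> d" by (rule power2_le_imp_le) (use d in simp)
      moreover have "norm (1 + of_real (- x / norm z) * z) > d" using * r by blast
      ultimately show False by linarith
    qed
  next
    assume a: "x > - c"
    show "\<forall>r\<ge>0. norm (1 + of_real r * z) > d"
    proof (intro allI impI)
      fix r :: real assume r: "r \<ge> 0"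
      have "d\<^sup>2 < (norm (1 + of_real r * z))\<^sup>2"
      proof (cases "x \<ge> 0")
        case True
        then have "x\<^sup>2 \<le> (r * norm z + x)\<^sup>2" using r by (intro power_mono) auto
        then show ?thesis unfolding sq using dd by linarith
      next
        case False
        then have "\<bar>x\<bar>\<^sup>2 < c\<^sup>2" using a by (intro power_strict_mono) auto
        then show ?thesis unfolding sq using c(2) zero_le_power2[of "r * norm z + x"] by (simp only: power2_abs)
      qed
      then show "norm (1 + of_real r * z) > d" by (rule power_less_imp_less_base) simp
    qed
  qed
  ultimately show ?thesis by simp
qed

lemma R_set_eq:
  assumes "0 < \<delta>'" "\<delta>' < 1" "0 \<le> c" "c\<^sup>2 = 1 - \<delta>'\<^sup>2"
  shows "R_set d \<delta>' = {T. T \<noteq> 0 \<and> Re (cis d / T) > - c * norm (cis d / T)}"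
proof -
  have "(\<forall>r\<ge>0. norm (1 + cis d * of_real r / T) > \<delta>') \<longleftrightarrow> Re (cis d / T) > - c * norm (cis d / T)" if "T \<noteq> 0" for T
    using ray_distance_iff[of "cis d / T", OF _ assms] that by (simp add: mult.commute)
  then show ?thesis unfolding R_set_def by auto
qed

lemma R_set_angle:
  assumes "0 < \<delta>'" "\<delta>' < 1"
  obtains c where "0 \<le> c" "c < 1" "\<And>d. R_set d \<delta>' = {T. T \<noteq> 0 \<and> Re (cis d / T) > - c * norm (cis d / T)}"
proof (rule that[of "sqrt (1 - \<delta>'\<^sup>2)"])
  have dd: "\<delta>'\<^sup>2 < 1" using assms by (simp add: power_less_one_iff abs_square_less_1)
  then show "0 \<le> sqrt (1 - \<delta>'\<^sup>2)" by simp
  show "sqrt (1 - \<delta>'\<^sup>2) < 1" using assms by simp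
  show "R_set d \<delta>' = {T. T \<noteq> 0 \<and> Re (cis d / T) > - sqrt (1 - \<delta>'\<^sup>2) * norm (cis d / T)}" for d
    by (rule R_set_eq) (use assms dd in auto)
qed

lemma open_R_set:
  assumes "0 < \<delta>'" "\<delta>' < 1" shows "open (R_set d \<delta>')"
proof -
  obtain c where c: "R_set d \<delta>' = {T. T \<noteq> 0 \<and> Re (cis d / T) > - c * norm (cis d / T)}"
    using R_set_angle[OF assms] by metis
  have "continuous_on (- {0}) (\<lambda>T. Re (cis d / T) + c * norm (cis d / T))"
    by (intro continuous_intros) auto
  from continuous_on_open_vimage[THEN iffD1, OF _ this, THEN spec, of "{0<..}"]
  have "open ((\<lambda>T. Re (cis d / T) + c * norm (cis d / T)) -` {0<..} \<inter> - {0})" by auto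
  also have "(\<lambda>T. Re (cis d / T) + c * norm (cis d / T)) -` {0<..} \<inter> - {0} = R_set d \<delta>'"
    unfolding c by (auto simp: algebra_simps)
  finally show ?thesis .
qed

lemma R_set_cone:
  assumes "T \<in> R_set d \<delta>'" "s > 0" shows "of_real s * T \<in> R_set d \<delta>'"
proof -
  have "norm (1 + cis d * of_real r / (of_real s * T)) > \<delta>'" if "r \<ge> 0" for r
    using assms that unfolding R_set_def
    by (auto dest!: spec[of _ "r / s"] simp: mult.commute)
  then show ?thesis using assms by (auto simp: R_set_def)
qed

text \<open>Directions are measured by their angle in \<open>(-\<pi>, \<pi>]\<close> from the direction of \<open>x\<close>, so that the zeros of
  \<open>u \<mapsto> \<Theta>(u/x)\<close> have angle \<open>\<pi>\<close> and a segment of angles in \<open>(-\<pi>, \<pi>)\<close> never crosses them.\<close>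

lemma cis_relative_angle:
  assumes "x \<noteq> 0" shows "cis d = cis (Arg x + Arg (cis d / x))"
proof -
  have "cis (Arg x + Arg (cis d / x)) = sgn x * sgn (cis d / x)"
    using assms by (simp add: cis_mult[symmetric] cis_Arg)
  also have "\<dots> = cis d"
    using assms by (simp add: sgn_divide) (simp add: sgn_eq)
  finally show ?thesis by simp
qed

lemma polar_div:
  assumes "x \<noteq> 0"
  shows "of_real r * cis (Arg x + \<phi>) / x = of_real (r / norm x) * cis \<phi>"
proof -
  have "x = of_real (norm x) * cis (Arg x)" using assms by (simp add: cis_Arg sgn_eq)
  then have "of_real r * cis (Arg x + \<phi>) / x = of_real r * (cis (Arg x) * cis \<phi>) / (of_real (norm x) * cis (Arg x))"
    by (simp only: cis_mult)
  also have "\<dots> = of_real (r / norm x) * cis \<phi>" using assms by simp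
  finally show ?thesis .
qed

lemma cos_antimono_abs:
  assumes "\<bar>\<phi>\<bar> \<le> \<bar>a\<bar>" "\<bar>a\<bar> \<le> pi" shows "cos a \<le> cos \<phi>"
  using cos_monotone_0_pi_le[of "\<bar>\<phi>\<bar>" "\<bar>a\<bar>"] assms by simp

lemma closed_segment_abs_le:
  fixes a b :: real
  assumes "\<phi> \<in> closed_segment a b" shows "\<bar>\<phi>\<bar> \<le> max \<bar>a\<bar> \<bar>b\<bar>"
  using assms by (auto simp: closed_segment_eq_real_ivl split: if_splits)

text \<open>A direction between that of \<open>x\<close> and that of angle \<open>a\<close> is at least as close to each of them as they
  are to each other. So it keeps the distance from the zeros of \<open>\<Theta>\<close> and stays in the cone \<open>R_set\<close>.\<close>

lemma closed_segment_0_abs: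
  fixes a :: real
  assumes "\<phi> \<in> closed_segment 0 a" shows "\<bar>\<phi>\<bar> \<le> \<bar>a\<bar>" "\<bar>a - \<phi>\<bar> \<le> \<bar>a\<bar>"
  using assms by (auto simp: closed_segment_eq_real_ivl split: if_splits)

lemma in_arc_sectorI:
  assumes x: "x \<noteq> 0" and r: "r > 0" and \<phi>: "\<phi> \<in> closed_segment (Arg (cis d / x)) (Arg (cis d' / x))"
  shows "of_real r * cis (Arg x + \<phi>) \<in> arc_sector x d d'"
proof -
  have "- pi < Arg z \<and> Arg z \<le> pi" for z using Arg_bounded by blast
  then have "- pi < \<phi> \<and> \<phi> \<le> pi"
    using \<phi> by (auto simp: closed_segment_eq_real_ivl split: if_splits) (meson less_le_trans order_trans)+
  then have "Arg (of_real r * cis (Arg x + \<phi>) / x) = \<phi>"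
    unfolding polar_div[OF x] using r x by (subst Arg_times_of_real) (auto intro!: Arg_cis)
  then show ?thesis using \<phi> r by (simp add: arc_sector_def)
qed

lemma segment_open_nbhd:
  fixes a b :: real
  assumes "open W" "closed_segment a b \<subseteq> W"
  obtains lo hi where "closed_segment a b \<subseteq> {lo<..<hi}" "{lo<..<hi} \<subseteq> W"
proof -
  obtain e where e: "e > 0" "(\<Union>x\<in>closed_segment a b. ball x e) \<subseteq> W"
    using compact_subset_open_imp_ball_epsilon_subset[OF compact_segment(1) assms] by blast
  show ?thesis
  proof
    show "closed_segment a b \<subseteq> {min a b - e<..<max a b + e}"
      using e(1) by (auto simp: closed_segment_eq_real_ivl split: if_splits)
    show "{min a b - e<..<max a b + e} \<subseteq> W"
    proof
      fix y assume y: "y \<in> {min a b - e<..<max a b + e}"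
      have seg: "closed_segment a b = {min a b..max a b}"
        by (auto simp: closed_segment_eq_real_ivl)
      then have "min a b \<in> closed_segment a b" "max a b \<in> closed_segment a b" by auto
      then have W: "ball (min a b) e \<subseteq> W" "ball (max a b) e \<subseteq> W" using e(2) by blast+
      show "y \<in> W"
      proof (cases "y \<in> closed_segment a b")
        case True
        then show ?thesis using assms(2) by blast
      next
        case False
        then consider "y < min a b" | "max a b < y" unfolding seg by fastforce
        then show ?thesis
        proof cases
          case 1
          then have "y \<in> ball (min a b) e" using y by (simp add: dist_real_def)
          then show ?thesis using W by blast
        next
          case 2
          then have "y \<in> ball (max a b) e" using y by (simp add: dist_real_def)
          then show ?thesis using W by blast
        qed
      qed
    qed
  qed
qed

section \<open>Growth weights against the Theta kernel\<close>

lemma exp_half_abs_le_decay: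
  assumes "y > 0" shows "exp (- \<bar>ln y\<bar> / 2) \<le> 2 * decay y"
proof -
  have s: "sqrt y = exp (ln y / 2)" using assms by (simp add: powr_half_sqrt[symmetric] powr_def)
  define s where "s = sqrt y"
  have s0: "s > 0" and y: "y = s * s" using assms by (auto simp: s_def)
  show ?thesis
  proof (cases "y \<ge> 1")
    case True
    then have "exp (- \<bar>ln y\<bar> / 2) = inverse s" by (simp add: s_def s exp_minus)
    moreover have "inverse s \<le> 2 * decay y"
    proof -
      have "1 + s * s \<le> 2 * (s * s)" using True unfolding y by simp
      then have "1 \<le> 2 * (s * s) / (1 + s * s)" by (subst pos_le_divide_eq) (simp_all add: add_pos_nonneg)
      from mult_left_mono[OF this, of "inverse s"] have "inverse s \<le> inverse s * (2 * (s * s) / (1 + s * s))"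
        using s0 by simp
      also have "\<dots> = 2 * decay y" using s0 unfolding decay_def s_def[symmetric] by (simp add: y)
      finally show ?thesis .
    qed
    ultimately show ?thesis by simp
  next
    case False
    then have "exp (- \<bar>ln y\<bar> / 2) = s" using assms by (simp add: s_def s)
    moreover have "s \<le> 2 * decay y"
    proof -
      have "s * (1 + y) \<le> s * 2" using False s0 by (intro mult_left_mono) auto
      then have "s \<le> (s * 2) / (1 + y)" using assms by (subst pos_le_divide_eq) simp_all
      also have "(s * 2) / (1 + y) = 2 * decay y" unfolding decay_def s_def[symmetric] by simp
      finally show ?thesis .
    qed
    ultimately show ?thesis by simp
  qed
qed

lemma theta_weight_pos: "theta_weight q k r > 0"
  by (simp add: theta_weight_def)

text \<open>Completing the square: \<open>- (s v\<^sup>2 + v)/2 \<le> 1/(2 s) - |v|/2\<close> for \<open>s = k / ln q\<close> and \<open>v = ln y\<close>.\<close>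

lemma inverse_theta_weight_le_decay:
  assumes "q > 1" "k > 0" "y > 0"
  shows "1 / theta_weight q k y \<le> 2 * exp (ln q / (2 * k)) * decay y"
proof -
  define v where "v = ln y"
  have L: "ln q > 0" using assms by simp
  have "- (k * v\<^sup>2 / (2 * ln q) + v / 2) \<le> ln q / (2 * k) - \<bar>v\<bar> / 2"
  proof (cases "v \<ge> 0")
    case True
    have "0 \<le> k * v\<^sup>2 / (2 * ln q)" "0 \<le> ln q / (2 * k)" using assms L by auto
    then show ?thesis using True by simp
  next
    case False
    define c where "c = k / ln q"
    have c0: "c > 0" using assms L by (simp add: c_def)
    have "0 \<le> (c * v + 1)\<^sup>2 / (2 * c)" using c0 by simp
    also have "\<dots> = c / 2 * v\<^sup>2 + v + 1 / (2 * c)"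
    proof -
      have "(c * v + 1)\<^sup>2 = (c * v\<^sup>2 + 2 * v) * c + 1" by (simp add: power2_eq_square algebra_simps)
      then have "(c * v + 1)\<^sup>2 / (2 * c) = (c * v\<^sup>2 + 2 * v) * c / (2 * c) + 1 / (2 * c)"
        by (simp only: add_divide_distrib)
      also have "(c * v\<^sup>2 + 2 * v) * c / (2 * c) = c / 2 * v\<^sup>2 + v" using c0 by simp
      finally show ?thesis .
    qed
    also have "1 / (2 * c) = ln q / (2 * k)" by (simp add: c_def)
    also have "c / 2 * v\<^sup>2 = k * v\<^sup>2 / (2 * ln q)" by (simp add: c_def)
    finally show ?thesis using False by simp
  qed
  then have "exp (- (k * v\<^sup>2 / (2 * ln q) + v / 2)) \<le> exp (ln q / (2 * k) + - \<bar>v\<bar> / 2)"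
    by (subst exp_le_cancel_iff) linarith
  also have "\<dots> \<le> exp (ln q / (2 * k)) * (2 * decay y)"
    unfolding exp_add v_def by (intro mult_left_mono exp_half_abs_le_decay assms) auto
  finally have "exp (- (k * v\<^sup>2 / (2 * ln q) + v / 2)) \<le> 2 * exp (ln q / (2 * k)) * decay y"
    by (simp only: mult_ac)
  then show ?thesis unfolding theta_weight_def v_def[symmetric] by (simp only: exp_minus inverse_eq_divide)
qed

text \<open>The growth \<open>exp (k ln\<^sup>2 r / (2 ln q)) r\<^sup>\<alpha>\<close> for \<open>r \<ge> 1\<close>, replaced by \<open>1\<close> for \<open>r \<le> 1\<close>. In contrast to the
  weight in \<open>ln |\<tau> + \<delta>|\<close> it depends on \<open>|\<tau>|\<close> only.\<close>

definition growth :: "real \<Rightarrow> real \<Rightarrow> real \<Rightarrow> real \<Rightarrow> real" where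
  "growth q k \<alpha> r = exp (k * (max 0 (ln r))\<^sup>2 / (2 * ln q) + \<alpha> * max 0 (ln r))"

lemma growth_ge_1: "q > 1 \<Longrightarrow> k > 0 \<Longrightarrow> \<alpha> > 0 \<Longrightarrow> growth q k \<alpha> r \<ge> 1"
  by (simp add: growth_def)

text \<open>The square of \<open>ln r\<close> cancels, and the remaining linear term \<open>(\<alpha> + k ln T / ln q) ln r\<close> is not positive
  for \<open>r \<ge> 1\<close>. Since \<open>T\<close> enters only through \<open>r / T\<close>, the integral of this bound is independent of \<open>T\<close>.\<close>

lemma growth_over_theta_le_decay:
  assumes q: "q > 1" "k > 0" and T: "0 < T" "T \<le> T0" "T0 \<le> 1"
    and \<alpha>: "\<alpha> + k / ln q * ln T0 \<le> 0" and r: "r > 0"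
  shows "growth q k \<alpha> r / theta_weight q k (r / T) \<le> 2 * exp (ln q / (2 * k)) * decay (r / T)"
proof (cases "ln r \<ge> 0")
  case False
  then show ?thesis using inverse_theta_weight_le_decay[OF q, of "r / T"] T r by (simp add: growth_def)
next
  case True
  define s t where "s = ln r" and "t = ln T"
  have L: "ln q > 0" using q by simp
  have tt: "t \<le> ln T0" "ln T0 \<le> 0" using T by (auto simp: t_def)
  have st: "ln (r / T) = s - t" using T r by (simp add: s_def t_def ln_div)
  have "k / ln q * t \<le> k / ln q * ln T0" using tt q L by (intro mult_left_mono) auto
  then have "s * (\<alpha> + k / ln q * t) \<le> 0" using True \<alpha> by (intro mult_nonneg_nonpos) (auto simp: s_def)
  moreover have "0 \<le> k * t\<^sup>2 / (2 * ln q)" using q L by auto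
  moreover have "k * s\<^sup>2 / (2 * ln q) + \<alpha> * s - (k * (s - t)\<^sup>2 / (2 * ln q) + (s - t) / 2)
     = s * (\<alpha> + k / ln q * t) - k * t\<^sup>2 / (2 * ln q) - (s - t) / 2"
  proof -
    define c where "c = k / ln q"
    have c: "k * z / (2 * ln q) = c * z / 2" for z by (simp add: c_def)
    show ?thesis
      unfolding c c_def[symmetric] by (simp add: algebra_simps power2_diff diff_divide_distrib add_divide_distrib)
  qed
  ultimately have calc: "s * (\<alpha> + k / ln q * t) \<le> 0" "0 \<le> k * t\<^sup>2 / (2 * ln q)"
    "k * s\<^sup>2 / (2 * ln q) + \<alpha> * s - (k * (s - t)\<^sup>2 / (2 * ln q) + (s - t) / 2)
     = s * (\<alpha> + k / ln q * t) - k * t\<^sup>2 / (2 * ln q) - (s - t) / 2" by blast+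
  have "k * s\<^sup>2 / (2 * ln q) + \<alpha> * s - (k * (s - t)\<^sup>2 / (2 * ln q) + (s - t) / 2) \<le> - \<bar>s - t\<bar> / 2"
  proof -
    have "\<bar>s - t\<bar> = s - t" using True tt by (simp add: s_def)
    then show ?thesis using calc by linarith
  qed
  then have "growth q k \<alpha> r / theta_weight q k (r / T) \<le> exp (- \<bar>s - t\<bar> / 2)"
    unfolding growth_def theta_weight_def st exp_diff[symmetric] using True by (simp add: s_def)
  also have "\<dots> \<le> 1 * (2 * decay (r / T))" using exp_half_abs_le_decay[of "r / T"] T r st by simp
  also have "\<dots> \<le> exp (ln q / (2 * k)) * (2 * decay (r / T))"
    using q L T r by (intro mult_right_mono mult_nonneg_nonneg decay_nonneg) auto
  finally show ?thesis by (simp add: mult_ac)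
qed

text \<open>For large \<open>|u|\<close> the shift changes \<open>ln |u|\<close> by at most \<open>\<delta> / |u|\<close>, and therefore its square by a bounded
  amount. For bounded \<open>|u|\<close> the weight is bounded, because \<open>u + \<delta>\<close> stays away from \<open>0\<close>.\<close>

lemma shifted_weight_le_growth:
  fixes A :: "complex set"
  assumes q: "q > 1" "k > 0" and \<alpha>: "\<alpha> > 0" and \<delta>: "\<delta> > 0"
    and A: "infdist (- of_real \<delta>) A > 0"
  obtains B where "B > 0"
    "\<And>u. u \<in> A \<Longrightarrow> exp (k * (ln (norm (u + of_real \<delta>)))\<^sup>2 / (2 * ln q) + \<alpha> * ln (norm (u + of_real \<delta>)))
      \<le> B * growth q k \<alpha> (norm u)"
proof -
  define \<eta> where "\<eta> = infdist (- of_real \<delta>) A"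
  \<comment> \<open>Beyond this radius \<open>|u + \<delta>| \<ge> 1\<close>, so its logarithm is not negative.\<close>
  define M where "M = max 2 (2 * \<delta>)"
  define Y where "Y = \<bar>ln \<eta>\<bar> + \<bar>ln (M + \<delta>)\<bar>"
  define B where "B = exp (k * Y\<^sup>2 / (2 * ln q) + \<alpha> * Y) + exp (k * (2 * \<delta> + 1) / (2 * ln q) + \<alpha>)"
  have L: "ln q > 0" using q by simp
  have M: "M \<ge> 2" "M \<ge> 2 * \<delta>" by (auto simp: M_def)
  show ?thesis
  proof
    show "B > 0" unfolding B_def by (intro add_pos_pos exp_gt_zero)
    fix u assume u: "u \<in> A"
    define y where "y = ln (norm (u + of_real \<delta>))"
    have eta: "\<eta> > 0" "\<eta> \<le> norm (u + of_real \<delta>)"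
    proof -
      have "dist (- complex_of_real \<delta>) u = norm (u + of_real \<delta>)"
        unfolding dist_commute[of "- complex_of_real \<delta>"] by (simp add: dist_norm)
      then show "\<eta> > 0" "\<eta> \<le> norm (u + of_real \<delta>)"
        using A infdist_le[OF u, of "- of_real \<delta>"] by (simp_all add: \<eta>_def)
    qed
    have npos: "norm (u + of_real \<delta>) > 0" using eta by linarith
    have le: "norm (u + of_real \<delta>) \<le> norm u + \<delta>" using norm_triangle_ineq[of u "of_real \<delta>"] \<delta> by simp
    show "exp (k * (ln (norm (u + of_real \<delta>)))\<^sup>2 / (2 * ln q) + \<alpha> * ln (norm (u + of_real \<delta>)))
      \<le> B * growth q k \<alpha> (norm u)"
    proof (cases "norm u \<le> M")
      case True
      have "ln \<eta> \<le> y" unfolding y_def using eta npos by (subst ln_le_cancel_iff)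
      moreover have "y \<le> ln (M + \<delta>)"
        unfolding y_def using le True npos by (subst ln_le_cancel_iff) linarith+
      ultimately have "\<bar>y\<bar> \<le> Y" by (auto simp: Y_def)
      then have "y\<^sup>2 \<le> Y\<^sup>2" "y \<le> Y" by (auto intro: abs_le_square_iff[THEN iffD1])
      then have "exp (k * y\<^sup>2 / (2 * ln q) + \<alpha> * y) \<le> exp (k * Y\<^sup>2 / (2 * ln q) + \<alpha> * Y)"
        using q L \<alpha> by (intro exp_le_cancel_iff[THEN iffD2] add_mono divide_right_mono mult_left_mono) auto
      also have "\<dots> \<le> B * 1" by (simp add: B_def)
      also have "\<dots> \<le> B * growth q k \<alpha> (norm u)"
        using growth_ge_1[OF q \<alpha>] \<open>B > 0\<close> by (intro mult_left_mono) auto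
      finally show ?thesis by (simp add: y_def)
    next
      case False
      define s where "s = ln (norm u)"
      have n: "norm u \<ge> M" "norm u > 0" using False M by auto
      have s0: "s \<ge> 0" "s \<le> norm u" using n M ln_le_minus_one[of "norm u"] by (auto simp: s_def)
      have "norm u \<le> norm (u + of_real \<delta>) + \<delta>"
        using norm_triangle_ineq4[of "u + of_real \<delta>" "of_real \<delta>"] \<delta> by simp
      then have "1 \<le> norm (u + of_real \<delta>)" using n M by linarith
      then have y0: "y \<ge> 0" by (simp add: y_def)
      have "norm u * (1 + \<delta> / norm u) = norm u + \<delta>" using n by (simp add: distrib_left)
      then have "y \<le> ln (norm u * (1 + \<delta> / norm u))"
        unfolding y_def using le npos by (subst ln_le_cancel_iff) linarith+
      also have "\<dots> = s + ln (1 + \<delta> / norm u)" using n(2) \<delta> ln_mult_pos[of "norm u" "1 + \<delta> / norm u"]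
        by (simp add: s_def add_pos_nonneg)
      also have "\<dots> \<le> s + \<delta> / norm u" using n \<delta> ln_add_one_self_le_self[of "\<delta> / norm u"] by simp
      finally have ys: "y \<le> s + \<delta> / norm u" .
      have d1: "\<delta> / norm u \<le> 1" using n M \<delta> by (simp add: field_simps)
      have d0: "0 \<le> \<delta> / norm u" using n \<delta> by simp
      have "y\<^sup>2 \<le> (s + \<delta> / norm u)\<^sup>2" using y0 ys by (intro power_mono) auto
      also have "\<dots> = s\<^sup>2 + 2 * (s * (\<delta> / norm u)) + (\<delta> / norm u)\<^sup>2" by (simp add: power2_sum)
      also have "\<dots> \<le> s\<^sup>2 + 2 * \<delta> + 1"
      proof -
        have "s * (\<delta> / norm u) \<le> norm u * (\<delta> / norm u)" using s0 d0 by (intro mult_right_mono) auto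
        then have "s * (\<delta> / norm u) \<le> \<delta>" using n by simp
        moreover have "(\<delta> / norm u)\<^sup>2 \<le> 1" using d0 d1 by (simp add: power_le_one)
        ultimately show ?thesis by simp
      qed
      finally have y2: "y\<^sup>2 \<le> s\<^sup>2 + (2 * \<delta> + 1)" by simp
      have y1: "y \<le> s + 1" using ys d1 by simp
      have "k * y\<^sup>2 / (2 * ln q) + \<alpha> * y \<le> k * (s\<^sup>2 + (2 * \<delta> + 1)) / (2 * ln q) + \<alpha> * (s + 1)"
        using q L \<alpha> y1 y2 by (intro add_mono divide_right_mono mult_left_mono) auto
      also have "\<dots> = (k * (2 * \<delta> + 1) / (2 * ln q) + \<alpha>) + (k * s\<^sup>2 / (2 * ln q) + \<alpha> * s)"
        by (simp add: distrib_left add_divide_distrib)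
      finally have "exp (k * y\<^sup>2 / (2 * ln q) + \<alpha> * y) \<le> exp (k * (2 * \<delta> + 1) / (2 * ln q) + \<alpha>) * growth q k \<alpha> (norm u)"
        unfolding growth_def s_def[symmetric] using s0 by (simp add: exp_add[symmetric])
      also have "\<dots> \<le> B * growth q k \<alpha> (norm u)"
        using growth_ge_1[OF q \<alpha>, of "norm u"] by (intro mult_right_mono) (auto simp: B_def)
      finally show ?thesis by (simp add: y_def)
    qed
  qed
qed

text \<open>The size, up to a constant, of the integrals over \<open>|u| \<ge> R\<close> at \<open>|x| = T\<close>.\<close>

definition tail_bound :: "real \<Rightarrow> real \<Rightarrow> real \<Rightarrow> real \<Rightarrow> real \<Rightarrow> real" where
  "tail_bound q k \<nu> R T = exp (ln R * (\<nu> - 1 / 2 + k * ln T / ln q) - k * (ln T)\<^sup>2 / (2 * ln q) + ln T / 2)"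

text \<open>After cancellation of the squares of \<open>ln r\<close>, the exponent is linear in \<open>ln r\<close>. Its value at \<open>r = R\<close> is the
  exponent of \<open>tail_bound\<close>, and its slope is at most \<open>-1/2\<close>.\<close>

lemma outer_weight_over_theta_le:
  assumes q: "q > 1" "k > 0" and T: "0 < T" and R: "0 < R" "R \<le> r"
    and \<nu>: "\<nu> + k / ln q * ln T \<le> 0"
  shows "exp (k * (ln r)\<^sup>2 / (2 * ln q) + \<nu> * ln r) / theta_weight q k (r / T)
    \<le> tail_bound q k \<nu> R T * (2 * decay (r / R))"
proof -
  define s t l where "s = ln r" and "t = ln T" and "l = ln R"
  have L: "ln q > 0" using q by simp
  have st: "ln (r / T) = s - t" "ln (r / R) = s - l" using T R by (simp_all add: s_def t_def l_def ln_div)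
  have sl: "s \<ge> l" using R by (simp add: s_def l_def)
  define c where "c = k / ln q"
  have c: "k * z / ln q = c * z" "k * z / (2 * ln q) = c * z / 2" "k / (2 * ln q) = c / 2" for z
    by (simp_all add: c_def)
  have "k * s\<^sup>2 / (2 * ln q) + \<nu> * s - (k * (s - t)\<^sup>2 / (2 * ln q) + (s - t) / 2)
     = (l * (\<nu> - 1 / 2 + k * t / ln q) - k * t\<^sup>2 / (2 * ln q) + t / 2) + ((s - l) * (\<nu> + k / ln q * t) - (s - l) / 2)"
    unfolding c c_def[symmetric] by (simp add: algebra_simps power2_diff diff_divide_distrib add_divide_distrib)
  also have "\<dots> \<le> (l * (\<nu> - 1 / 2 + k * t / ln q) - k * t\<^sup>2 / (2 * ln q) + t / 2) + (- \<bar>s - l\<bar> / 2)"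
  proof -
    have "(s - l) * (\<nu> + k / ln q * t) \<le> 0" using sl \<nu> by (intro mult_nonneg_nonpos) (auto simp: t_def)
    moreover have "\<bar>s - l\<bar> = s - l" using sl by simp
    ultimately show ?thesis by linarith
  qed
  finally have "exp (k * s\<^sup>2 / (2 * ln q) + \<nu> * s) / theta_weight q k (r / T)
     \<le> tail_bound q k \<nu> R T * exp (- \<bar>s - l\<bar> / 2)"
    unfolding theta_weight_def tail_bound_def st exp_diff[symmetric] exp_add[symmetric] t_def l_def by simp
  also have "\<dots> \<le> tail_bound q k \<nu> R T * (2 * decay (r / R))"
    using exp_half_abs_le_decay[of "r / R"] R st by (intro mult_left_mono) (auto simp: tail_bound_def)
  finally show ?thesis by (simp add: s_def)
qed

text \<open>With \<open>x = ln a \<le> 0\<close> and \<open>y = ln b \<le> 0\<close>, the mixed term \<open>- k x y / ln q\<close> of the square of \<open>x + y\<close> can be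
  dropped, and the terms in \<open>y\<close> alone are bounded above.\<close>

lemma tail_bound_product:
  fixes R :: real
  assumes q: "q > 1" "k > 0" and a: "0 < a" "a \<le> 1" and b: "0 < b" "b \<le> 1"
  defines "K \<equiv> k * ln R / ln q + 1 / 2"
  shows "tail_bound q k \<nu> R (a * b)
    \<le> exp (ln R * (\<nu> - 1 / 2) + K\<^sup>2 * ln q / (2 * k)) * (exp (- (k / (2 * ln q)) * (ln a)\<^sup>2) * a powr K)"
proof -
  define x y where "x = ln a" and "y = ln b"
  have L: "ln q > 0" using q by simp
  have xy: "x \<le> 0" "y \<le> 0" "ln (a * b) = x + y" using a b by (simp_all add: x_def y_def ln_mult)
  define c where "c = k / ln q"
  have c: "k * z / ln q = c * z" "k * z / (2 * ln q) = c * z / 2" "k / (2 * ln q) = c / 2" for z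
    by (simp_all add: c_def)
  have "ln R * (\<nu> - 1 / 2 + k * (x + y) / ln q) - k * (x + y)\<^sup>2 / (2 * ln q) + (x + y) / 2
    = ln R * (\<nu> - 1 / 2) + (- (k / (2 * ln q)) * x\<^sup>2) + K * x + (K * y - k / (2 * ln q) * y\<^sup>2) - k / ln q * (x * y)"
    unfolding K_def c c_def[symmetric] by (simp add: algebra_simps power2_sum add_divide_distrib)
  moreover have "K * y - k / (2 * ln q) * y\<^sup>2 \<le> K\<^sup>2 * ln q / (2 * k)"
  proof -
    have c0: "c > 0" using q L by (simp add: c_def)
    define y0 where "y0 = K / c"
    have K: "K = c * y0" using c0 by (simp add: y0_def)
    have "0 \<le> c * (y0 - y)\<^sup>2" using c0 by simp
    also have "\<dots> = c * y0\<^sup>2 - (2 * (K * y) - c * y\<^sup>2)"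
      unfolding K by (simp add: power2_eq_square algebra_simps)
    also have "c * y0\<^sup>2 = 2 * (K\<^sup>2 * ln q / (2 * k))"
      using c0 q L by (simp add: y0_def power_divide power2_eq_square) (simp add: c_def)
    finally show ?thesis unfolding c by simp
  qed
  moreover have "0 \<le> k / ln q * (x * y)" using xy q L by (intro mult_nonneg_nonneg mult_nonpos_nonpos) auto
  ultimately have "ln R * (\<nu> - 1 / 2 + k * (x + y) / ln q) - k * (x + y)\<^sup>2 / (2 * ln q) + (x + y) / 2
    \<le> (ln R * (\<nu> - 1 / 2) + K\<^sup>2 * ln q / (2 * k)) + (- (k / (2 * ln q)) * x\<^sup>2 + K * x)" by linarith
  then show ?thesis unfolding tail_bound_def xy(3) using a
    by (simp add: exp_add[symmetric] powr_def x_def[symmetric] add.assoc)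
qed

section \<open>Uniqueness for the convolution equation\<close>

lemma integrable_exp_neg_abs:
  assumes "a > 0" shows "integrable lborel (\<lambda>x::real. exp (- a * \<bar>x\<bar>))"
proof -
  have ei: "einterval 0 \<infinity> = {0<..}" by (auto simp: einterval_def zero_ereal_def)
  have D: "((\<lambda>x. - exp (- a * x) / a) has_real_derivative exp (- a * x)) (at x)" for x
    using assms by (auto intro!: derivative_eq_intros)
  have "set_integrable lborel (einterval 0 \<infinity>) (\<lambda>x. exp (- a * x))"
  proof (rule interval_integral_FTC_nonneg(1))
    show "(((\<lambda>x. - exp (- a * x) / a) \<circ> real_of_ereal) \<longlongrightarrow> - exp (- a * 0) / a) (at_right 0)"
      unfolding zero_ereal_def ereal_tendsto_simps1 by (intro tendsto_intros) (use assms in auto)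
    show "(((\<lambda>x. - exp (- a * x) / a) \<circ> real_of_ereal) \<longlongrightarrow> 0) (at_left \<infinity>)"
      unfolding ereal_tendsto_simps1 using assms by real_asymp
    show "isCont (\<lambda>x. exp (- a * x)) x" for x by (intro continuous_intros)
  qed (use D in auto)
  then have 1: "integrable lborel (\<lambda>x. indicator {0<..} x * exp (- a * x))"
    unfolding ei set_integrable_def by simp
  from lborel_integrable_real_affine[OF 1, of "-1" 0]
  have 2: "integrable lborel (\<lambda>x. indicator {0<..} (- x) * exp (a * x))" by simp
  show ?thesis
  proof (rule Bochner_Integration.integrable_bound[OF Bochner_Integration.integrable_add[OF 1 2]])
    have "AE x in lborel. x \<noteq> (0::real)" by (rule AE_lborel_singleton)
    then show "AE x in lborel. norm (exp (- a * \<bar>x\<bar>))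
      \<le> norm (indicator {0<..} x * exp (- a * x) + indicator {0<..} (- x) * exp (a * x))"
      by eventually_elim (auto simp: abs_if)
  qed simp
qed

lemma poly_imag_bound:
  fixes p :: "complex poly"
  shows "\<exists>K>0. \<forall>m::real. norm (poly p (\<i> * of_real m)) \<le> K * (1 + \<bar>m\<bar>) ^ degree p"
proof (induction p)
  case 0
  then show ?case by (auto intro: exI[of _ 1])
next
  case (pCons a p)
  show ?case
  proof (cases "p = 0")
    case True
    then show ?thesis by (auto intro!: exI[of _ "norm a + 1"] add_nonneg_pos)
  next
    case False
    from pCons.IH obtain K where K: "K > 0" "\<And>m. norm (poly p (\<i> * of_real m)) \<le> K * (1 + \<bar>m\<bar>) ^ degree p" by blast
    have "norm (poly (pCons a p) (\<i> * of_real m)) \<le> (norm a + K) * (1 + \<bar>m\<bar>) ^ degree (pCons a p)" for m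
    proof -
      have "norm (poly (pCons a p) (\<i> * of_real m)) \<le> norm a + \<bar>m\<bar> * norm (poly p (\<i> * of_real m))"
        using norm_triangle_ineq[of a "\<i> * of_real m * poly p (\<i> * of_real m)"] by (simp add: norm_mult)
      also have "\<dots> \<le> norm a * (1 + \<bar>m\<bar>) ^ Suc (degree p) + (1 + \<bar>m\<bar>) * (K * (1 + \<bar>m\<bar>) ^ degree p)"
      proof (intro add_mono mult_mono K(2))
        have "norm a * 1 \<le> norm a * (1 + \<bar>m\<bar>) ^ Suc (degree p)" by (intro mult_left_mono one_le_power) auto
        then show "norm a \<le> norm a * (1 + \<bar>m\<bar>) ^ Suc (degree p)" by simp
      qed auto
      also have "\<dots> = (norm a + K) * (1 + \<bar>m\<bar>) ^ degree (pCons a p)"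
        using False by (simp add: algebra_simps)
      finally show ?thesis .
    qed
    moreover have "norm a + K > 0" using K(1) by (simp add: add_nonneg_pos)
    ultimately show ?thesis by blast
  qed
qed

text \<open>The leading term of \<open>r\<close> controls \<open>p\<close> for large \<open>m\<close>; on the remaining compact interval the quotient is
  continuous.\<close>

lemma poly_ratio_bounded:
  fixes p r :: "complex poly"
  assumes deg: "degree p \<le> degree r" and r: "\<And>m::real. poly r (\<i> * of_real m) \<noteq> 0"
  shows "\<exists>K>0. \<forall>m::real. norm (poly p (\<i> * of_real m)) \<le> K * norm (poly r (\<i> * of_real m))"
proof -
  have r0: "r \<noteq> 0" using r[of 0] by auto
  let ?n = "degree r"
  have "((\<lambda>z. norm (poly r z / z ^ ?n)) \<longlongrightarrow> norm (lead_coeff r)) at_infinity"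
    by (intro tendsto_norm poly_divide_tendsto_aux)
  then have "\<forall>\<^sub>F z in at_infinity. norm (poly r z / z ^ ?n) > norm (lead_coeff r) / 2"
    using r0 by (intro order_tendstoD(1)) auto
  then obtain b where b: "\<And>z. norm z \<ge> b \<Longrightarrow> norm (poly r z / z ^ ?n) > norm (lead_coeff r) / 2"
    unfolding eventually_at_infinity by blast
  obtain K where K: "K > 0" "\<And>m. norm (poly p (\<i> * of_real m)) \<le> K * (1 + \<bar>m\<bar>) ^ degree p"
    using poly_imag_bound[of p] by blast
  define M where "M = max b 1"
  define c where "c = norm (lead_coeff r) / 2"
  have c: "c > 0" using r0 by (simp add: c_def)
  have cont: "continuous_on {-M..M} (\<lambda>m. norm (poly p (\<i> * of_real m)) / norm (poly r (\<i> * of_real m)))"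
    by (intro continuous_intros) (use r in auto)
  from compact_continuous_image[OF cont compact_Icc, THEN compact_imp_bounded]
  obtain B where "\<forall>y\<in>(\<lambda>m. norm (poly p (\<i> * of_real m)) / norm (poly r (\<i> * of_real m))) ` {-M..M}. norm y \<le> B"
    unfolding bounded_iff by blast
  then have B: "norm (poly p (\<i> * of_real m)) / norm (poly r (\<i> * of_real m)) \<le> B" if "m \<in> {-M..M}" for m
    using that by (auto simp: abs_le_iff)
  have "norm (poly p (\<i> * of_real m)) \<le> (\<bar>B\<bar> + K * 2 ^ ?n / c + 1) * norm (poly r (\<i> * of_real m))" (is "_ \<le> ?K * ?r") for m
  proof (cases "m \<in> {-M..M}")
    case True
    have "norm (poly p (\<i> * of_real m)) \<le> B * ?r" using B[OF True] r[of m] by (simp add: pos_divide_le_eq)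
    also have "\<dots> \<le> ?K * ?r"
    proof (rule mult_right_mono)
      have "0 \<le> K * 2 ^ ?n / c" using K c by simp
      then show "B \<le> ?K" by linarith
    qed simp
    finally show ?thesis .
  next
    case False
    then have m: "\<bar>m\<bar> \<ge> b" "\<bar>m\<bar> \<ge> 1" by (auto simp: M_def)
    then have "c < norm (poly r (\<i> * of_real m)) / \<bar>m\<bar> ^ ?n"
      using b[of "\<i> * of_real m"] by (simp add: c_def norm_divide norm_mult norm_power)
    then have rl: "c * \<bar>m\<bar> ^ ?n \<le> ?r" using m by (simp add: pos_less_divide_eq)
    have "norm (poly p (\<i> * of_real m)) \<le> K * (1 + \<bar>m\<bar>) ^ degree p" by (rule K)
    also have "\<dots> \<le> K * (2 * \<bar>m\<bar>) ^ ?n"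
      using K m deg by (intro mult_left_mono order_trans[OF power_increasing[OF deg] power_mono]) auto
    also have "\<dots> = K * 2 ^ ?n / c * (c * \<bar>m\<bar> ^ ?n)" using c by (simp add: power_mult_distrib)
    also have "\<dots> \<le> K * 2 ^ ?n / c * ?r" using rl K c by (intro mult_left_mono) auto
    also have "\<dots> \<le> ?K * ?r" by (intro mult_right_mono) auto
    finally show ?thesis .
  qed
  moreover have "\<bar>B\<bar> + K * 2 ^ ?n / c + 1 > 0" using K c by (intro add_nonneg_pos add_nonneg_nonneg) auto
  ultimately show ?thesis by blast
qed

lemma conv_diff_bound:
  assumes \<beta>: "\<beta> > 0" and cont: "continuous_on UNIV h1" "continuous_on UNIV h2" "continuous_on UNIV h3"
    and b1: "\<And>m. norm (h1 m) \<le> c * exp (- \<beta> * \<bar>m\<bar>)"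
    and b2: "\<And>m. norm (poly R (\<i> * of_real m) * h2 m) \<le> A" and b3: "\<And>m. norm (poly R (\<i> * of_real m) * h3 m) \<le> A"
    and M: "\<And>m. norm (poly R (\<i> * of_real m) * (h2 m - h3 m)) \<le> M"
  shows "norm (conv R h1 h2 m - conv R h1 h3 m) \<le> c * M * (LINT x|lborel. exp (- \<beta> * \<bar>x\<bar>))"
proof -
  have I0: "integrable lborel (\<lambda>x. exp (- \<beta> * \<bar>m - x\<bar>))"
    using lborel_integrable_real_affine[OF integrable_exp_neg_abs[OF \<beta>], of "-1" m] by simp
  have shift: "(LINT x|lborel. exp (- \<beta> * \<bar>m - x\<bar>)) = (LINT x|lborel. exp (- \<beta> * \<bar>x\<bar>))"
    using lborel_integral_real_affine[of "-1" "\<lambda>x. exp (- \<beta> * \<bar>x\<bar>)" m] by simp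
  have pt: "norm (h1 (m - x) * poly R (\<i> * of_real x) * y) \<le> c * B * exp (- \<beta> * \<bar>m - x\<bar>)"
    if "norm (poly R (\<i> * of_real x) * y) \<le> B" for x y B
  proof -
    have "norm (h1 (m - x)) * norm (poly R (\<i> * of_real x) * y) \<le> (c * exp (- \<beta> * \<bar>m - x\<bar>)) * B"
      by (intro mult_mono b1 that order_trans[OF norm_ge_zero b1] norm_ge_zero)
    then show ?thesis by (simp only: norm_mult mult_ac)
  qed
  have int: "integrable lborel (\<lambda>x. h1 (m - x) * poly R (\<i> * of_real x) * h x)"
    if h: "continuous_on UNIV h" and b: "\<And>m. norm (poly R (\<i> * of_real m) * h m) \<le> B" for h B
  proof (rule Bochner_Integration.integrable_bound)
    show "integrable lborel (\<lambda>x. c * B * exp (- \<beta> * \<bar>m - x\<bar>))" using I0 by simp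
    have "continuous_on UNIV (\<lambda>x. h1 (m - x))"
      by (rule continuous_on_compose2[OF cont(1)]) (auto intro!: continuous_intros)
    then have "continuous_on UNIV (\<lambda>x. h1 (m - x) * poly R (\<i> * of_real x) * h x)"
      by (intro continuous_intros h)
    then show "(\<lambda>x. h1 (m - x) * poly R (\<i> * of_real x) * h x) \<in> borel_measurable lborel"
      by (simp add: borel_measurable_continuous_onI)
    have "norm (h1 (m - x) * poly R (\<i> * of_real x) * h x) \<le> norm (c * B * exp (- \<beta> * \<bar>m - x\<bar>))" for x
      using pt[OF b, of x] unfolding real_norm_def by linarith
    then show "AE x in lborel. norm (h1 (m - x) * poly R (\<i> * of_real x) * h x) \<le> norm (c * B * exp (- \<beta> * \<bar>m - x\<bar>))"
      by (rule AE_I2)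
  qed
  have "conv R h1 h2 m - conv R h1 h3 m = (LINT x|lborel. h1 (m - x) * poly R (\<i> * of_real x) * (h2 x - h3 x))"
    unfolding conv_def right_diff_distrib
    by (rule Bochner_Integration.integral_diff[symmetric, OF int[OF cont(2) b2] int[OF cont(3) b3]])
  also have "norm \<dots> \<le> (LINT x|lborel. c * M * exp (- \<beta> * \<bar>m - x\<bar>))"
  proof (rule Bochner_Integration.integral_norm_bound_integral)
    show "integrable lborel (\<lambda>x. h1 (m - x) * poly R (\<i> * of_real x) * (h2 x - h3 x))"
      by (rule int[OF _ M]) (intro continuous_intros cont)
  qed (use I0 pt[OF M] in auto)
  also have "\<dots> = c * M * (LINT x|lborel. exp (- \<beta> * \<bar>m - x\<bar>))" by (rule integral_mult_right_zero)
  finally show ?thesis unfolding shift .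
qed

text \<open>Dividing the equation by \<open>\<tau>\<^sup>k\<close> leaves a positive power of \<open>\<tau>\<close> in front of every term with the
  unknown on the right, and no dilation increases \<open>|\<tau>|\<close>. The bound \<open>M\<close> of the difference of two
  solutions on \<open>|\<tau>| \<le> r\<close>, weighted by \<open>|R\<^sub>D(im)|\<close>, can therefore be replaced by \<open>r L M\<close> with a constant \<open>L\<close>,
  hence by \<open>M/2\<close> for small \<open>r\<close>. With this weight the convolution is controlled by the decay of \<open>C\<close> and
  by the boundedness of \<open>R\<^sub>l / R\<^sub>D\<close> and \<open>R\<^sub>D / Q\<close> on the imaginary axis.\<close>

lemma aux_equation_unique_near_0:
  fixes w w' \<psi> \<psi>' :: "complex \<Rightarrow> real \<Rightarrow> complex"
  assumes eq: "aux_equation A q k e Q R D dD I dl d \<Delta> C \<epsilon> \<psi> w" "aux_equation A' q k e Q R D dD I dl d \<Delta> C \<epsilon> \<psi>' w'"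
    and sub: "ball 0 \<rho> \<subseteq> A" "ball 0 \<rho> \<subseteq> A'"
    and \<psi>: "\<And>\<tau> m. \<tau> \<in> ball 0 \<rho> \<Longrightarrow> \<psi> \<tau> m = \<psi>' \<tau> m"
    and q: "q > 1" and e: "e \<le> 0" and dD: "dD \<ge> 1" and rho: "\<rho> > 0" and eps: "norm \<epsilon> \<le> 1"
    and fin: "\<And>l. l \<in> {1..D-1} \<Longrightarrow> finite (I l)"
    and d: "\<And>l j. l \<in> {1..D-1} \<Longrightarrow> j \<in> I l \<Longrightarrow> d j l \<ge> 1"
      "\<And>l j. l \<in> {1..D-1} \<Longrightarrow> j \<in> I l \<Longrightarrow> real (dl l) - real (d j l) / real k - 1 \<le> 0"
    and \<beta>: "\<beta> > 0"
    and C: "\<And>l j. l \<in> {1..D-1} \<Longrightarrow> j \<in> I l \<Longrightarrow> continuous_on UNIV (\<lambda>m. C j l m \<epsilon>)"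
      "\<And>l j m. l \<in> {1..D-1} \<Longrightarrow> j \<in> I l \<Longrightarrow> norm (C j l m \<epsilon>) \<le> Ct j l * exp (- \<beta> * \<bar>m\<bar>)"
    and RD: "\<And>m. poly (R D) (\<i> * of_real m) \<noteq> 0"
    and R: "\<And>l m. l \<in> {1..D-1} \<Longrightarrow> norm (poly (R l) (\<i> * of_real m)) \<le> K l * norm (poly (R D) (\<i> * of_real m))"
    and Q: "rQ > 0" "\<And>m. norm (poly Q (\<i> * of_real m)) \<ge> rQ * norm (poly (R D) (\<i> * of_real m))"
    and cw: "\<And>\<tau>. \<tau> \<in> ball 0 \<rho> \<Longrightarrow> continuous_on UNIV (w \<tau>)" "\<And>\<tau>. \<tau> \<in> ball 0 \<rho> \<Longrightarrow> continuous_on UNIV (w' \<tau>)"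
    and bw: "\<And>\<tau> m. \<tau> \<in> ball 0 \<rho> \<Longrightarrow> norm (poly (R D) (\<i> * of_real m)) * norm (w \<tau> m) \<le> B"
      "\<And>\<tau> m. \<tau> \<in> ball 0 \<rho> \<Longrightarrow> norm (poly (R D) (\<i> * of_real m)) * norm (w' \<tau> m) \<le> B"
  shows "\<exists>r>0. \<forall>\<tau> m. \<tau> \<noteq> 0 \<longrightarrow> norm \<tau> \<le> r \<longrightarrow> w \<tau> m = w' \<tau> m"
proof -
  let ?RD = "\<lambda>m. norm (poly (R D) (\<i> * of_real m))" and ?Q = "\<lambda>m. norm (poly Q (\<i> * of_real m))"
  let ?c = "\<lambda>n. qc q (real k) n"
  define J where "J = (LINT x|lborel. exp (- \<beta> * \<bar>x\<bar>))"
  define G where "G j l = 1 / ?c (d j l + k) * (Ct j l * K l * J)" for j l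
  define S where "S = 1 / ?c (dD + k) + (\<Sum>l\<in>{1..D-1}. \<Sum>j\<in>I l. G j l)"
  have c: "?c n > 0" for n using q by (simp add: qc_def)
  have J: "J \<ge> 0" unfolding J_def by (rule integral_nonneg_AE) simp
  have Ct: "Ct j l \<ge> 0" if "l \<in> {1..D-1}" "j \<in> I l" for l j
    using order_trans[OF norm_ge_zero C(2)[OF that, of 0]] by simp
  have K: "K l \<ge> 0" if "l \<in> {1..D-1}" for l
  proof -
    have "0 \<le> K l * ?RD 0" using order_trans[OF norm_ge_zero R[OF that, of 0]] .
    then show ?thesis using RD[of 0] by (simp add: zero_le_mult_iff)
  qed
  have G: "G j l \<ge> 0" if "l \<in> {1..D-1}" "j \<in> I l" for l j
    unfolding G_def using Ct[OF that] K[OF that(1)] J c[of "d j l + k"] by (intro mult_nonneg_nonneg) auto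
  have S: "S \<ge> 0" unfolding S_def
    using c[of "dD + k"] by (intro add_nonneg_nonneg sum_nonneg G) auto
  define L where "L = ?c k * S / rQ"
  have L: "L \<ge> 0" unfolding L_def using S Q(1) c[of k] by (simp add: zero_le_mult_iff)
  \<comment> \<open>The radius is chosen such that \<open>r * L \<le> 1 / 2\<close>.\<close>
  define X where "X = 1 + L"
  have X: "X > 0" "L \<le> X" using L by (auto simp: X_def)
  define r where "r = min (\<rho> / 2) (min 1 (1 / (2 * X)))"
  have r: "0 < r" "r < \<rho>" "r \<le> 1" "r * L \<le> 1 / 2"
  proof -
    show "0 < r" "r < \<rho>" using rho X by (auto simp: r_def)
    show "r \<le> 1" by (simp add: r_def min_le_iff_disj)
    have "r \<le> 1 / (2 * X)" by (simp add: r_def min_le_iff_disj)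
    then have "r * L \<le> 1 / (2 * X) * X" using L X by (intro mult_mono) auto
    also have "\<dots> = 1 / 2" using X by simp
    finally show "r * L \<le> 1 / 2" .
  qed
  have inr: "\<tau> \<in> ball 0 \<rho>" if "norm \<tau> \<le> r" for \<tau> :: complex using that r by simp
  have step: "?RD m * norm (w \<tau> m - w' \<tau> m) \<le> M / 2"
    if hyp: "\<And>\<tau> m. \<tau> \<noteq> 0 \<Longrightarrow> norm \<tau> \<le> r \<Longrightarrow> ?RD m * norm (w \<tau> m - w' \<tau> m) \<le> M"
      and M: "M \<ge> 0" and t: "\<tau> \<noteq> 0" "norm \<tau> \<le> r" for M \<tau> m
  proof -
    have dil: "of_real (q powr a) * \<tau> \<noteq> 0" "norm (of_real (q powr a) * \<tau>) \<le> r" if "a \<le> 0" for a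
    proof -
      show "of_real (q powr a) * \<tau> \<noteq> 0" using q t by simp
      have "q powr a \<le> 1" using q that powr_mono[of a 0 q] by simp
      then have "q powr a * norm \<tau> \<le> 1 * norm \<tau>" by (intro mult_right_mono) auto
      moreover have "norm (of_real (q powr a) * \<tau>) = q powr a * norm \<tau>" by (simp add: norm_mult)
      ultimately show "norm (of_real (q powr a) * \<tau>) \<le> r" using t by linarith
    qed
    define \<tau>1 where "\<tau>1 = of_real (q powr e) * \<tau>"
    define \<tau>2 where "\<tau>2 j l = of_real (q powr (real (dl l) - real (d j l) / real k - 1)) * \<tau>" for j l
    define T where "T j l h = \<epsilon> ^ (\<Delta> j l - d j l) * \<tau> ^ (d j l + k) / of_real (?c (d j l + k)) *
          (1 / of_real (sqrt (2 * pi))) * conv (R l) (\<lambda>m'. C j l m' \<epsilon>) h m" for j l h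
    have tA: "\<tau> \<in> A" "\<tau> \<in> A'" using inr[OF t(2)] sub by auto
    have E: "poly Q (\<i> * of_real m) * \<tau> ^ k / of_real (?c k) * w \<tau> m =
        \<tau> ^ (dD + k) / of_real (?c (dD + k)) * poly (R D) (\<i> * of_real m) * w \<tau>1 m
      + (\<Sum>l\<in>{1..D-1}. \<Sum>j\<in>I l. T j l (w (\<tau>2 j l))) + \<tau> ^ k / of_real (?c k) * \<psi> \<tau> m"
      "poly Q (\<i> * of_real m) * \<tau> ^ k / of_real (?c k) * w' \<tau> m =
        \<tau> ^ (dD + k) / of_real (?c (dD + k)) * poly (R D) (\<i> * of_real m) * w' \<tau>1 m
      + (\<Sum>l\<in>{1..D-1}. \<Sum>j\<in>I l. T j l (w' (\<tau>2 j l))) + \<tau> ^ k / of_real (?c k) * \<psi>' \<tau> m"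
      using eq(1)[unfolded aux_equation_def, rule_format, OF tA(1), of m]
        eq(2)[unfolded aux_equation_def, rule_format, OF tA(2), of m]
      unfolding T_def \<tau>1_def \<tau>2_def by blast+
    have diff: "poly Q (\<i> * of_real m) * \<tau> ^ k / of_real (?c k) * (w \<tau> m - w' \<tau> m) =
        \<tau> ^ (dD + k) / of_real (?c (dD + k)) * poly (R D) (\<i> * of_real m) * (w \<tau>1 m - w' \<tau>1 m)
      + (\<Sum>l\<in>{1..D-1}. \<Sum>j\<in>I l. T j l (w (\<tau>2 j l)) - T j l (w' (\<tau>2 j l)))"
      unfolding right_diff_distrib E sum_subtractf \<psi>[OF inr[OF t(2)]] by simp
    have tp: "norm \<tau> ^ (n + k) \<le> r * norm \<tau> ^ k" if "n \<ge> 1" for n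
    proof -
      have "norm \<tau> ^ n \<le> norm \<tau> ^ 1" using that t r by (intro power_decreasing) auto
      then have "norm \<tau> ^ n \<le> r" using t by simp
      then show ?thesis unfolding power_add by (intro mult_right_mono) auto
    qed
    have term1: "norm (\<tau> ^ (dD + k) / of_real (?c (dD + k)) * poly (R D) (\<i> * of_real m) * (w \<tau>1 m - w' \<tau>1 m))
      \<le> (r * norm \<tau> ^ k) * (1 / ?c (dD + k)) * M"
    proof -
      have "?RD m * norm (w \<tau>1 m - w' \<tau>1 m) \<le> M" unfolding \<tau>1_def by (rule hyp[OF dil[OF e]])
      then have "(norm \<tau> ^ (dD + k) * (1 / ?c (dD + k))) * (?RD m * norm (w \<tau>1 m - w' \<tau>1 m))
        \<le> ((r * norm \<tau> ^ k) * (1 / ?c (dD + k))) * M"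
        using c[of "dD + k"] r tp[OF dD] M by (intro mult_mono) auto
      then show ?thesis using c[of "dD + k"] by (simp add: norm_mult norm_divide norm_power)
    qed
    have term2: "norm (T j l (w (\<tau>2 j l)) - T j l (w' (\<tau>2 j l))) \<le> (r * norm \<tau> ^ k) * G j l * M"
      if l: "l \<in> {1..D-1}" and j: "j \<in> I l" for l j
    proof -
      note dd = dil[OF d(2)[OF l j], folded \<tau>2_def]
      have in2: "\<tau>2 j l \<in> ball 0 \<rho>" using inr[OF dd(2)] .
      have Rb: "norm (poly (R l) (\<i> * of_real m) * y) \<le> K l * X" if "?RD m * norm y \<le> X" for m y X
      proof -
        have "norm (poly (R l) (\<i> * of_real m)) * norm y \<le> K l * ?RD m * norm y"
          by (intro mult_right_mono R[OF l]) auto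
        also have "\<dots> = K l * (?RD m * norm y)" by simp
        also have "\<dots> \<le> K l * X" by (intro mult_left_mono that K[OF l])
        finally show ?thesis by (simp add: norm_mult)
      qed
      have cv: "norm (conv (R l) (\<lambda>m'. C j l m' \<epsilon>) (w (\<tau>2 j l)) m - conv (R l) (\<lambda>m'. C j l m' \<epsilon>) (w' (\<tau>2 j l)) m)
        \<le> Ct j l * (K l * M) * J"
        unfolding J_def
        by (rule conv_diff_bound[OF \<beta> C(1)[OF l j] cw(1)[OF in2] cw(2)[OF in2] C(2)[OF l j]
              Rb[OF bw(1)[OF in2]] Rb[OF bw(2)[OF in2]] Rb[OF hyp[OF dd]]])
      define Z where "Z = conv (R l) (\<lambda>m'. C j l m' \<epsilon>) (w (\<tau>2 j l)) m - conv (R l) (\<lambda>m'. C j l m' \<epsilon>) (w' (\<tau>2 j l)) m"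
      define cc where "cc = ?c (d j l + k)"
      have cc: "cc > 0" unfolding cc_def by (rule c)
      have Z: "norm Z \<le> Ct j l * (K l * M) * J" unfolding Z_def by (rule cv)
      have "T j l (w (\<tau>2 j l)) - T j l (w' (\<tau>2 j l)) = \<epsilon> ^ (\<Delta> j l - d j l) * \<tau> ^ (d j l + k) / of_real cc *
          (1 / of_real (sqrt (2 * pi))) * Z"
        unfolding T_def Z_def cc_def by (rule right_diff_distrib[symmetric])
      also have "norm \<dots> = norm \<epsilon> ^ (\<Delta> j l - d j l) * (norm \<tau> ^ (d j l + k) * (1 / cc)) * (1 / sqrt (2 * pi)) * norm Z"
        using cc by (simp add: norm_mult norm_divide norm_power)
      also have "\<dots> \<le> 1 * ((r * norm \<tau> ^ k) * (1 / cc)) * 1 * (Ct j l * (K l * M) * J)"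
      proof (rule mult_mono)
        have "2 * pi \<ge> 1" using pi_ge_two by simp
        then have p: "1 / sqrt (2 * pi) \<le> 1" by simp
        have e1: "norm \<epsilon> ^ (\<Delta> j l - d j l) \<le> 1" using eps by (intro power_le_one) auto
        have t1: "norm \<tau> ^ (d j l + k) * (1 / cc) \<le> (r * norm \<tau> ^ k) * (1 / cc)"
          using cc by (intro mult_right_mono tp[OF d(1)[OF l j]]) auto
        have t0: "0 \<le> (r * norm \<tau> ^ k) * (1 / cc)" using r cc by simp
        show "norm \<epsilon> ^ (\<Delta> j l - d j l) * (norm \<tau> ^ (d j l + k) * (1 / cc)) * (1 / sqrt (2 * pi))
          \<le> 1 * ((r * norm \<tau> ^ k) * (1 / cc)) * 1"
        proof (rule mult_mono[OF _ p])
          show "norm \<epsilon> ^ (\<Delta> j l - d j l) * (norm \<tau> ^ (d j l + k) * (1 / cc)) \<le> 1 * ((r * norm \<tau> ^ k) * (1 / cc))"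
            by (rule mult_mono[OF e1 t1]) (use cc in auto)
        qed (use t0 in auto)
        show "0 \<le> 1 * ((r * norm \<tau> ^ k) * (1 / cc)) * 1" using t0 by simp
      qed (use Z in auto)
      also have "\<dots> = (r * norm \<tau> ^ k) * G j l * M" by (simp add: G_def cc_def)
      finally show ?thesis .
    qed
    have "?Q m * norm \<tau> ^ k / ?c k * norm (w \<tau> m - w' \<tau> m) = norm (poly Q (\<i> * of_real m) * \<tau> ^ k / of_real (?c k) * (w \<tau> m - w' \<tau> m))"
      using c[of k] by (simp add: norm_mult norm_divide norm_power)
    also have "\<dots> \<le> (r * norm \<tau> ^ k) * (1 / ?c (dD + k)) * M
      + (\<Sum>l\<in>{1..D-1}. \<Sum>j\<in>I l. (r * norm \<tau> ^ k) * G j l * M)"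
      unfolding diff by (intro order_trans[OF norm_triangle_ineq] add_mono term1 sum_norm_le term2)
    also have "\<dots> = norm \<tau> ^ k * (r * S * M)"
      unfolding S_def by (simp add: sum_distrib_left sum_distrib_right algebra_simps)
    finally have "norm \<tau> ^ k * (?Q m / ?c k * norm (w \<tau> m - w' \<tau> m)) \<le> norm \<tau> ^ k * (r * S * M)"
      by (simp add: mult_ac)
    then have "?Q m / ?c k * norm (w \<tau> m - w' \<tau> m) \<le> r * S * M"
      using t by (subst (asm) mult_le_cancel_left_pos) auto
    then have "?Q m * norm (w \<tau> m - w' \<tau> m) \<le> r * S * M * ?c k"
      using c[of k] by (simp add: pos_divide_le_eq)
    moreover have "rQ * ?RD m * norm (w \<tau> m - w' \<tau> m) \<le> ?Q m * norm (w \<tau> m - w' \<tau> m)"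
      by (intro mult_right_mono Q) auto
    ultimately have "rQ * (?RD m * norm (w \<tau> m - w' \<tau> m)) \<le> rQ * (r * L * M)"
      unfolding L_def using Q(1) by (simp add: mult_ac)
    then have "?RD m * norm (w \<tau> m - w' \<tau> m) \<le> r * L * M" using Q(1) by (simp only: mult_le_cancel_left_pos)
    also have "\<dots> \<le> 1 / 2 * M" using r M by (intro mult_right_mono) auto
    finally show ?thesis by simp
  qed
  have B: "B \<ge> 0" using order_trans[OF _ bw(1)[of 0 0]] rho by simp
  have iter: "?RD m * norm (w \<tau> m - w' \<tau> m) \<le> 2 * B / 2 ^ n" if "\<tau> \<noteq> 0" "norm \<tau> \<le> r" for n \<tau> m
    using that
  proof (induction n arbitrary: \<tau> m)
    case 0
    have "?RD m * norm (w \<tau> m - w' \<tau> m) \<le> ?RD m * (norm (w \<tau> m) + norm (w' \<tau> m))"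
      by (intro mult_left_mono norm_triangle_ineq4) auto
    also have "\<dots> \<le> B + B" unfolding distrib_left by (intro add_mono bw inr 0)
    finally show ?case by simp
  next
    case (Suc n)
    have "2 * B / 2 ^ Suc n = (2 * B / 2 ^ n) / 2" by simp
    then show ?case using step[of "2 * B / 2 ^ n" \<tau> m] Suc B by simp
  qed
  show ?thesis
  proof (intro exI[of _ r] conjI allI impI r(1))
    fix \<tau> :: complex and m assume t: "\<tau> \<noteq> 0" "norm \<tau> \<le> r"
    have "(\<lambda>n. 2 * B / 2 ^ n) \<longlonglongrightarrow> 0" by real_asymp
    then have "?RD m * norm (w \<tau> m - w' \<tau> m) \<le> 0"
      by (rule LIMSEQ_le_const) (use iter[OF t] in blast)
    then show "w \<tau> m = w' \<tau> m" using RD[of m] by (simp add: mult_le_0_iff)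
  qed
qed

text \<open>The union of a disc and a cone is star-shaped about the origin, so the identity theorem applies.\<close>

lemma holomorphic_eq_disc_cone:
  assumes f: "f holomorphic_on V \<union> ball 0 \<rho>" and g: "g holomorphic_on V' \<union> ball 0 \<rho>"
    and V: "open V" "\<And>u r. u \<in> V \<Longrightarrow> r > 0 \<Longrightarrow> of_real r * u \<in> V"
      "open V'" "\<And>u r. u \<in> V' \<Longrightarrow> r > 0 \<Longrightarrow> of_real r * u \<in> V'"
    and r: "0 < r" "r \<le> \<rho>" and eq: "\<And>\<tau>. \<tau> \<noteq> 0 \<Longrightarrow> norm \<tau> < r \<Longrightarrow> f \<tau> = g \<tau>"
    and u: "u \<in> (V \<inter> V') \<union> ball 0 \<rho>"
  shows "f u = g u"
proof (rule analytic_continuation_open[of "ball 0 r - {0}" "(V \<inter> V') \<union> ball 0 \<rho>" f g])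
  show "connected ((V \<inter> V') \<union> ball 0 \<rho>)"
  proof (rule starlike_imp_connected, unfold starlike_def, intro bexI[of _ 0] ballI)
    fix x assume x: "x \<in> (V \<inter> V') \<union> ball 0 \<rho>"
    show "closed_segment 0 x \<subseteq> (V \<inter> V') \<union> ball 0 \<rho>"
    proof
      fix y assume "y \<in> closed_segment 0 x"
      then obtain s where s: "0 \<le> s" "s \<le> 1" "y = of_real s * x"
        by (auto simp: closed_segment_def scaleR_conv_of_real)
      show "y \<in> (V \<inter> V') \<union> ball 0 \<rho>"
      proof (cases "s = 0")
        case True
        then show ?thesis using s r by simp
      next
        case False
        have "s * norm x \<le> norm x" using s by (simp add: mult_left_le_one_le)
        then show ?thesis using x False s V(2)[of x s] V(4)[of x s] by (auto simp: norm_mult)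
      qed
    qed
  qed (use r in auto)
  have "of_real (r / 2) \<in> ball 0 r - {0 :: complex}" using r by simp
  then show "ball 0 r - {0 :: complex} \<noteq> {}" by blast
  show "f holomorphic_on (V \<inter> V') \<union> ball 0 \<rho>" by (rule holomorphic_on_subset[OF f]) auto
  show "g holomorphic_on (V \<inter> V') \<union> ball 0 \<rho>" by (rule holomorphic_on_subset[OF g]) auto
qed (use V(1,3) r eq u in auto)

lemma Exp_gen_bound:
  assumes h: "h \<in> Exp_gen_space A B q k \<beta> \<mu> a \<delta>" and N: "Exp_gen_norm A q k \<beta> \<mu> a \<delta> h \<le> N"
    and t: "\<tau> \<in> A"
  shows "norm (h \<tau> m) \<le> N * (1 + \<bar>m\<bar>) powr - \<mu> * exp (- \<beta> * \<bar>m\<bar>)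
    * exp (k * (ln (norm (\<tau> + of_real \<delta>)))\<^sup>2 / (2 * ln q) + a * ln (norm (\<tau> + of_real \<delta>)))"
proof -
  have "Exp_weighted q k \<beta> \<mu> a \<delta> h (\<tau>, m) \<le> Exp_gen_norm A q k \<beta> \<mu> a \<delta> h"
    unfolding Exp_gen_norm_def using h t by (intro cSUP_upper) (auto simp: Exp_gen_space_def)
  then have le: "Exp_weighted q k \<beta> \<mu> a \<delta> h (\<tau>, m) \<le> N" using N by simp
  define Y where "Y = k * (ln (norm (\<tau> + of_real \<delta>)))\<^sup>2 / (2 * ln q) + a * ln (norm (\<tau> + of_real \<delta>))"
  define W where "W = (1 + \<bar>m\<bar>) powr - \<mu> * exp (- \<beta> * \<bar>m\<bar>) * exp Y"
  have W: "W \<ge> 0" by (simp add: W_def)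
  have "Exp_weighted q k \<beta> \<mu> a \<delta> h (\<tau>, m) = (1 + \<bar>m\<bar>) powr \<mu> * exp (\<beta> * \<bar>m\<bar>) * exp (- Y) * norm (h \<tau> m)"
    by (simp add: Exp_weighted_def Y_def)
  moreover have "W * ((1 + \<bar>m\<bar>) powr \<mu> * exp (\<beta> * \<bar>m\<bar>) * exp (- Y)) = 1"
  proof -
    have "(1 + \<bar>m\<bar>) powr - \<mu> * (1 + \<bar>m\<bar>) powr \<mu> = 1" by (simp add: powr_add[symmetric])
    moreover have "exp (- \<beta> * \<bar>m\<bar>) * exp (\<beta> * \<bar>m\<bar>) = 1" "exp Y * exp (- Y) = 1" by (simp_all add: exp_add[symmetric])
    moreover have "W * ((1 + \<bar>m\<bar>) powr \<mu> * exp (\<beta> * \<bar>m\<bar>) * exp (- Y))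
      = ((1 + \<bar>m\<bar>) powr - \<mu> * (1 + \<bar>m\<bar>) powr \<mu>) * (exp (- \<beta> * \<bar>m\<bar>) * exp (\<beta> * \<bar>m\<bar>)) * (exp Y * exp (- Y))"
      unfolding W_def by (simp only: mult_ac)
    ultimately show ?thesis by simp
  qed
  ultimately have "norm (h \<tau> m) = W * Exp_weighted q k \<beta> \<mu> a \<delta> h (\<tau>, m)" by (simp add: mult.assoc[symmetric])
  also have "\<dots> \<le> W * N" by (intro mult_left_mono le W)
  finally show ?thesis by (simp add: W_def Y_def mult_ac)
qed

lemma E_space_bound:
  assumes h: "h \<in> E_space \<beta> \<mu>" and N: "E_norm \<beta> \<mu> h \<le> N" and \<mu>: "\<mu> \<ge> 0"
  shows "norm (h m) \<le> N * exp (- \<beta> * \<bar>m\<bar>)"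
proof -
  have "(1 + \<bar>m\<bar>) powr \<mu> * exp (\<beta> * \<bar>m\<bar>) * norm (h m) \<le> E_norm \<beta> \<mu> h"
    unfolding E_norm_def using h by (intro cSUP_upper) (auto simp: E_space_def)
  moreover have "1 * (exp (\<beta> * \<bar>m\<bar>) * norm (h m)) \<le> (1 + \<bar>m\<bar>) powr \<mu> * (exp (\<beta> * \<bar>m\<bar>) * norm (h m))"
    using \<mu> by (intro mult_right_mono ge_one_powr_ge_zero) auto
  ultimately have "exp (\<beta> * \<bar>m\<bar>) * norm (h m) \<le> N" using N unfolding mult.assoc mult_1 by linarith
  then have "exp (- \<beta> * \<bar>m\<bar>) * (exp (\<beta> * \<bar>m\<bar>) * norm (h m)) \<le> exp (- \<beta> * \<bar>m\<bar>) * N"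
    by (intro mult_left_mono) auto
  also have "exp (- \<beta> * \<bar>m\<bar>) * (exp (\<beta> * \<bar>m\<bar>) * norm (h m)) = norm (h m)"
    unfolding mult.assoc[symmetric] exp_add[symmetric] by simp
  finally show ?thesis by (simp only: mult.commute)
qed

section \<open>Integrals against the Theta kernel\<close>

text \<open>The lower bound for \<open>\<Theta>\<close> with its constant \<open>b\<close> named, because uniformity in \<open>x\<close> means that all estimates
  share one \<open>b\<close>.\<close>

definition theta_lower :: "real \<Rightarrow> real \<Rightarrow> real \<Rightarrow> real \<Rightarrow> bool" where
  "theta_lower q k c b \<longleftrightarrow> b > 0 \<and>
     (\<forall>x. x \<noteq> 0 \<longrightarrow> Re x \<ge> - c * norm x \<longrightarrow> norm (qTheta q k x) \<ge> b * theta_weight q k (norm x))"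

lemma theta_lower_exists:
  assumes "q > 1" "k > 0" "c < 1" obtains b where "theta_lower q k c b"
  using qTheta_lower_bound[OF assms] unfolding theta_lower_def by metis

lemma kernel_bound:
  assumes lb: "theta_lower q k c b" and x: "x \<noteq> 0" and s: "s > 0" and r: "r > 0" and \<phi>: "cos \<phi> \<ge> - c"
  shows "norm (y / qTheta q k (of_real r * cis (Arg x + \<phi>) / (of_real s * x)))
    \<le> norm y * (1 / theta_weight q k (r / (s * norm x))) / b"
proof -
  define v where "v = of_real r * cis (Arg x + \<phi>) / (of_real s * x)"
  define R where "R = r / (s * norm x)"
  have R: "R > 0" using r s x by (simp add: R_def)
  have "v = of_real (r / s) * cis (Arg x + \<phi>) / x" by (simp add: v_def)
  also have "\<dots> = of_real R * cis \<phi>" unfolding polar_div[OF x] R_def by simp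
  finally have v: "v = of_real R * cis \<phi>" .
  have n: "norm v = R" using R by (simp add: v norm_mult)
  have "R * cos \<phi> \<ge> R * (- c)" using \<phi> R by (intro mult_left_mono) auto
  then have "Re v \<ge> - c * norm v" unfolding n by (simp add: v mult.commute)
  moreover have "v \<noteq> 0" using n R by auto
  ultimately have "norm (qTheta q k v) \<ge> b * theta_weight q k R" and b: "b > 0"
    using lb n unfolding theta_lower_def by auto
  then have "norm y / norm (qTheta q k v) \<le> norm y / (b * theta_weight q k R)"
  proof (intro divide_left_mono)
    have p: "0 < b * theta_weight q k R" by (rule mult_pos_pos[OF b theta_weight_pos])
    with \<open>norm (qTheta q k v) \<ge> b * theta_weight q k R\<close> have "0 < norm (qTheta q k v)" by linarith
    then show "0 < norm (qTheta q k v) * (b * theta_weight q k R)" using p by (rule mult_pos_pos)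
  qed auto
  then show ?thesis unfolding v_def[symmetric] R_def[symmetric] by (simp add: norm_divide mult.commute)
qed

lemma kernel_holomorphic:
  assumes q: "q > 1" "k > 0" and f: "f holomorphic_on V" and T: "T \<noteq> 0"
  shows "(\<lambda>u. f u / qTheta q k (u / T)) holomorphic_on {u \<in> V. u \<noteq> 0 \<and> u / T \<notin> \<real>\<^sub>\<le>\<^sub>0}"
proof (rule holomorphic_on_divide)
  show "(\<lambda>u. qTheta q k (u / T)) holomorphic_on {u \<in> V. u \<noteq> 0 \<and> u / T \<notin> \<real>\<^sub>\<le>\<^sub>0}"
    by (rule holomorphic_on_compose_gen[OF _ qTheta_holomorphic[OF q], unfolded o_def])
      (use T in \<open>auto intro!: holomorphic_intros\<close>)
qed (use qTheta_nonzero[OF q] in \<open>auto intro: holomorphic_on_subset[OF f]\<close>)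

lemma off_negative_axis:
  assumes "\<bar>\<phi>\<bar> < pi" "R > 0" shows "of_real R * cis \<phi> \<notin> \<real>\<^sub>\<le>\<^sub>0"
proof
  assume a: "of_real R * cis \<phi> \<in> \<real>\<^sub>\<le>\<^sub>0"
  have "Arg (of_real R * cis \<phi>) = Arg (cis \<phi>)" using assms(2) by (simp add: Arg_times_of_real)
  also have "\<dots> = \<phi>" using assms(1) by (intro Arg_cis) auto
  finally have "Arg (of_real R * cis \<phi>) = \<phi>" .
  moreover have "of_real R * cis \<phi> \<noteq> 0" using assms(2) by simp
  ultimately have "\<phi> = pi" using a by (metis Arg_eq_pi complex_nonpos_Reals_iff Re_complex_of_real complex_eq_iff nonpos_Reals_zero_I order_le_less Im_complex_of_real zero_complex.sel)
  then show False using assms(1) by simp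
qed

text \<open>The angles \<open>\<phi>\<close> with \<open>|\<phi>| < \<pi>\<close> and direction in \<open>V\<close> form an open set, so the segment between \<open>a\<close> and
  \<open>b\<close> has an open interval as neighbourhood in it. On the corresponding strip the integrand is holomorphic.\<close>

lemma kernel_strip:
  assumes x: "x \<noteq> 0" and s: "s > 0" and V: "open V" "\<And>u r. u \<in> V \<Longrightarrow> r > 0 \<Longrightarrow> of_real r * u \<in> V"
    and ab: "\<bar>a\<bar> < pi" "\<bar>b\<bar> < pi" and seg: "\<And>\<phi>. \<phi> \<in> closed_segment a b \<Longrightarrow> cis (Arg x + \<phi>) \<in> V"
  obtains lo hi where "closed_segment (Arg x + a) (Arg x + b) \<subseteq> {lo<..<hi}"
    "\<And>w. lo < Im w \<Longrightarrow> Im w < hi \<Longrightarrow> exp w \<in> {u \<in> V. u \<noteq> 0 \<and> u / (of_real s * x) \<notin> \<real>\<^sub>\<le>\<^sub>0}"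
proof -
  define W where "W = {\<phi>. cis \<phi> \<in> V} \<inter> {Arg x - pi<..<Arg x + pi}"
  have "open ((\<lambda>\<phi>. cis \<phi>) -` V)" by (rule open_vimage[OF V(1)]) (intro continuous_intros)
  then have W: "open W" unfolding W_def by (auto simp: vimage_def)
  have "closed_segment (Arg x + a) (Arg x + b) \<subseteq> W"
  proof
    fix \<theta> assume "\<theta> \<in> closed_segment (Arg x + a) (Arg x + b)"
    then have p: "\<theta> - Arg x \<in> closed_segment a b" by (auto simp: closed_segment_eq_real_ivl split: if_splits)
    then have "\<bar>\<theta> - Arg x\<bar> < pi" using closed_segment_abs_le[OF p] ab by linarith
    then show "\<theta> \<in> W" using seg[OF p] by (auto simp: W_def)
  qed
  then obtain lo hi where lh: "closed_segment (Arg x + a) (Arg x + b) \<subseteq> {lo<..<hi}" "{lo<..<hi} \<subseteq> W"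
    using segment_open_nbhd[OF W] by blast
  show ?thesis
  proof (rule that[OF lh(1)])
    fix w assume w: "lo < Im w" "Im w < hi"
    then have "Im w \<in> W" using lh(2) by auto
    then have v: "cis (Im w) \<in> V" and p: "\<bar>Im w - Arg x\<bar> < pi" by (auto simp: W_def)
    have e: "exp w = of_real (exp (Re w)) * cis (Im w)" by (rule exp_eq_polar)
    have "of_real (exp (Re w)) * cis (Im w) \<in> V" by (rule V(2)[OF v]) simp
    then have 1: "exp w \<in> V" unfolding e .
    have "exp w / (of_real s * x) = of_real (exp (Re w) / s) * cis (Arg x + (Im w - Arg x)) / x"
      unfolding e by simp
    also have "\<dots> = of_real (exp (Re w) / s / norm x) * cis (Im w - Arg x)" by (rule polar_div[OF x])
    finally have "exp w / (of_real s * x) \<notin> \<real>\<^sub>\<le>\<^sub>0"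
      using off_negative_axis[OF p, of "exp (Re w) / s / norm x"] s x by simp
    with 1 show "exp w \<in> {u \<in> V. u \<noteq> 0 \<and> u / (of_real s * x) \<notin> \<real>\<^sub>\<le>\<^sub>0}" by simp
  qed
qed

lemma closed_segment_translate:
  fixes c a b :: real
  assumes "\<theta> \<in> closed_segment (c + a) (c + b)" shows "\<theta> - c \<in> closed_segment a b"
  using assms by (auto simp: closed_segment_eq_real_ivl split: if_splits)

lemma q_laplace_rotate:
  assumes q: "q > 1" "k > 0" and x: "x \<noteq> 0" and s: "s > 0"
    and V: "open V" "\<And>u r. u \<in> V \<Longrightarrow> r > 0 \<Longrightarrow> of_real r * u \<in> V" and f: "f holomorphic_on V"
    and ab: "\<bar>a\<bar> < pi" "\<bar>b\<bar> < pi" and seg: "\<And>\<phi>. \<phi> \<in> closed_segment a b \<Longrightarrow> cis (Arg x + \<phi>) \<in> V"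
    and h: "ray_bound h"
    and bd: "\<And>r \<phi>. r > 0 \<Longrightarrow> \<phi> \<in> closed_segment a b \<Longrightarrow>
      norm (f (of_real r * cis (Arg x + \<phi>)) / qTheta q k (of_real r * cis (Arg x + \<phi>) / (of_real s * x))) \<le> h r"
  shows "q_laplace q k (Arg x + a) f (of_real s * x) = q_laplace q k (Arg x + b) f (of_real s * x)"
proof -
  obtain lo hi where lh: "closed_segment (Arg x + a) (Arg x + b) \<subseteq> {lo<..<hi}"
    "\<And>w. lo < Im w \<Longrightarrow> Im w < hi \<Longrightarrow> exp w \<in> {u \<in> V. u \<noteq> 0 \<and> u / (of_real s * x) \<notin> \<real>\<^sub>\<le>\<^sub>0}"
    using kernel_strip[OF x s V ab seg] by blast
  have T: "of_real s * x \<noteq> 0" using s x by simp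
  have "(LINT r:{0<..}|lborel. f (of_real r * cis (Arg x + a)) / qTheta q k (of_real r * cis (Arg x + a) / (of_real s * x)) / of_real r)
      = (LINT r:{0<..}|lborel. f (of_real r * cis (Arg x + b)) / qTheta q k (of_real r * cis (Arg x + b) / (of_real s * x)) / of_real r)"
  proof (rule ray_rotation[OF kernel_holomorphic[OF q f T] lh(2) lh(1) h])
    show "norm (f (of_real r * cis \<theta>) / qTheta q k (of_real r * cis \<theta> / (of_real s * x))) \<le> h r"
      if "0 < r" "\<theta> \<in> closed_segment (Arg x + a) (Arg x + b)" for r \<theta>
      using bd[OF that(1) closed_segment_translate[OF that(2)]] by simp
  qed
  then show ?thesis unfolding q_laplace_def by simp
qed

lemma q_laplace_rotate_truncated:
  assumes q: "q > 1" "k > 0" and x: "x \<noteq> 0"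
    and V: "open V" "\<And>u r. u \<in> V \<Longrightarrow> r > 0 \<Longrightarrow> of_real r * u \<in> V" and f: "f holomorphic_on V \<inter> ball 0 \<rho>"
    and R: "0 < R" "R < \<rho>"
    and ab: "\<bar>a\<bar> < pi" "\<bar>b\<bar> < pi" and seg: "\<And>\<phi>. \<phi> \<in> closed_segment a b \<Longrightarrow> cis (Arg x + \<phi>) \<in> V"
    and h: "ray_bound h"
    and bd: "\<And>r \<phi>. r > 0 \<Longrightarrow> r \<le> R \<Longrightarrow> \<phi> \<in> closed_segment a b \<Longrightarrow>
      norm (f (of_real r * cis (Arg x + \<phi>)) / qTheta q k (of_real r * cis (Arg x + \<phi>) / x)) \<le> h r"
    and e: "\<And>\<phi>. \<phi> \<in> closed_segment a b \<Longrightarrow>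
      norm (f (of_real R * cis (Arg x + \<phi>)) / qTheta q k (of_real R * cis (Arg x + \<phi>) / x)) \<le> e"
  shows "norm ((LINT r:{0<..R}|lborel. f (of_real r * cis (Arg x + a)) / qTheta q k (of_real r * cis (Arg x + a) / x) / of_real r)
      - (LINT r:{0<..R}|lborel. f (of_real r * cis (Arg x + b)) / qTheta q k (of_real r * cis (Arg x + b) / x) / of_real r))
      \<le> e * \<bar>b - a\<bar>"
proof -
  obtain lo hi where lh: "closed_segment (Arg x + a) (Arg x + b) \<subseteq> {lo<..<hi}"
    "\<And>w. lo < Im w \<Longrightarrow> Im w < hi \<Longrightarrow> exp w \<in> {u \<in> V. u \<noteq> 0 \<and> u / (of_real 1 * x) \<notin> \<real>\<^sub>\<le>\<^sub>0}"
    using kernel_strip[OF x zero_less_one V ab seg] by blast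
  have "norm ((LINT r:{0<..R}|lborel. f (of_real r * cis (Arg x + a)) / qTheta q k (of_real r * cis (Arg x + a) / x) / of_real r)
      - (LINT r:{0<..R}|lborel. f (of_real r * cis (Arg x + b)) / qTheta q k (of_real r * cis (Arg x + b) / x) / of_real r))
      \<le> e * \<bar>(Arg x + b) - (Arg x + a)\<bar>"
  proof (rule truncated_ray_rotation[OF kernel_holomorphic[OF q f x] _ lh(1) R(1) _ h])
    show "exp w \<in> {u \<in> V \<inter> ball 0 \<rho>. u \<noteq> 0 \<and> u / x \<notin> \<real>\<^sub>\<le>\<^sub>0}"
      if "lo < Im w" "Im w < hi" "Re w < ln \<rho>" for w
    proof -
      have "exp (Re w) < exp (ln \<rho>)" using that(3) by simp
      then have "exp (Re w) < \<rho>" using R by simp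
      then show ?thesis using lh(2)[OF that(1,2)] by (simp add: norm_exp_eq_Re)
    qed
    show "ln R < ln \<rho>" using R by simp
    show "norm (f (of_real r * cis \<theta>) / qTheta q k (of_real r * cis \<theta> / x)) \<le> h r"
      if "0 < r" "r \<le> R" "\<theta> \<in> closed_segment (Arg x + a) (Arg x + b)" for r \<theta>
      using bd[OF that(1,2) closed_segment_translate[OF that(3)]] by simp
    show "norm (f (of_real R * cis \<theta>) / qTheta q k (of_real R * cis \<theta> / x)) \<le> e"
      if "\<theta> \<in> closed_segment (Arg x + a) (Arg x + b)" for \<theta>
      using e[OF closed_segment_translate[OF that]] by simp
  qed
  then show ?thesis by simp
qed

lemma set_integral_norm_bound_le:
  fixes f :: "real \<Rightarrow> complex"
  assumes h: "set_integrable lborel A h" and b: "\<And>r. r \<in> A \<Longrightarrow> norm (f r) \<le> h r"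
  shows "norm (LINT r:A|lborel. f r) \<le> (LINT r:A|lborel. h r)"
proof -
  have le: "norm (indicator A r *\<^sub>R f r) \<le> indicator A r *\<^sub>R h r" for r
    using b[of r] by (cases "r \<in> A") auto
  show ?thesis
  proof (cases "integrable lborel (\<lambda>r. indicator A r *\<^sub>R f r)")
    case True
    then show ?thesis unfolding set_lebesgue_integral_def
      using h le unfolding set_integrable_def by (intro Bochner_Integration.integral_norm_bound_integral) auto
  next
    case False
    have "0 \<le> (LINT r|lborel. indicator A r *\<^sub>R h r)"
      by (intro Bochner_Integration.integral_nonneg order_trans[OF norm_ge_zero le])
    then show ?thesis unfolding set_lebesgue_integral_def using not_integrable_integral_eq[OF False] by simp
  qed
qed

text \<open>The value of the integral of \<open>decay (r / T)\<close> over \<open>dr / r\<close> is \<open>\<pi>\<close> for every \<open>T\<close>; this makes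
  all bounds below uniform in \<open>x\<close>.\<close>

lemma ray_integral_bound:
  fixes f :: "real \<Rightarrow> complex"
  assumes T: "T > 0" and A: "A \<in> sets borel" "A \<subseteq> {0<..}" and C: "C \<ge> 0"
    and b: "\<And>r. r \<in> A \<Longrightarrow> norm (f r) \<le> C * decay (r / T)"
  shows "norm (LINT r:A|lborel. f r / of_real r) \<le> C * pi"
proof -
  have I: "set_integrable lborel {0<..} (\<lambda>r. C * (decay (r / T) / r))"
    by (rule set_integrable_mult_right) (use decay_integral(1)[OF T] in auto)
  then have IA: "set_integrable lborel A (\<lambda>r. C * (decay (r / T) / r))"
    by (rule set_integrable_subset) (use A in auto)
  have nn: "0 \<le> C * (decay (r / T) / r)" if "r > 0" for r
    using C T that by (intro mult_nonneg_nonneg divide_nonneg_pos decay_nonneg) auto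
  have "norm (LINT r:A|lborel. f r / of_real r) \<le> (LINT r:A|lborel. C * (decay (r / T) / r))"
  proof (rule set_integral_norm_bound_le[OF IA])
    fix r assume r: "r \<in> A"
    then have "r > 0" using A by auto
    then show "norm (f r / of_real r) \<le> C * (decay (r / T) / r)"
      using divide_right_mono[OF b[OF r], of r] by (simp add: norm_divide)
  qed
  also have "\<dots> \<le> (LINT r:{0<..}|lborel. C * (decay (r / T) / r))"
    unfolding set_lebesgue_integral_def
    by (rule integral_mono) (use IA I nn A in \<open>auto simp: set_integrable_def indicator_def\<close>)
  also have "\<dots> = C * (LINT r:{0<..}|lborel. decay (r / T) / r)" by (rule set_integral_mult_right)
  also have "\<dots> = C * pi" by (simp only: decay_integral(2)[OF T])
  finally show ?thesis .
qed

lemma q_laplace_cong_dir: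
  assumes "cis \<gamma> = cis \<gamma>'" shows "q_laplace q k \<gamma> f T = q_laplace q k \<gamma>' f T"
  unfolding q_laplace_def assms ..

text \<open>For \<open>c < 1\<close> the cone omits the negative axis, so the angle is different from \<open>\<pi>\<close>.\<close>

lemma relative_angle_cos:
  assumes T: "T \<noteq> 0" and c: "c < 1" and Re: "Re (cis d / T) > - c * norm (cis d / T)"
  shows "cos (Arg (cis d / T)) > - c" "\<bar>Arg (cis d / T)\<bar> < pi"
proof -
  define z where "z = cis d / T"
  have z: "norm z > 0" using T by (simp add: z_def)
  have "z = of_real (norm z) * cis (Arg z)" using rcis_cmod_Arg[of z] by (simp add: rcis_def)
  then have "Re z = norm z * cos (Arg z)" by (metis Re_complex_of_real cis.sel(1) mult_minus_right Re_rcis rcis_def)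
  then have "norm z * cos (Arg z) > norm z * (- c)" using Re by (simp add: z_def mult.commute)
  then have cos: "cos (Arg z) > - c" using z by (simp only: mult_less_cancel_left_pos)
  then show "cos (Arg (cis d / T)) > - c" by (simp add: z_def)
  have "Arg z \<noteq> pi"
  proof
    assume "Arg z = pi"
    then show False using cos c by simp
  qed
  then have "- pi < Arg z" "Arg z < pi" using Arg_bounded[of z] by auto
  then show "\<bar>Arg (cis d / T)\<bar> < pi" unfolding z_def by linarith
qed

section \<open>The Laplace transform of level one\<close>

lemma level1_kernel_bound:
  assumes q: "q > 1" "k > 0" and lb: "theta_lower q k c b" and x: "x \<noteq> 0" and s: "s > 0"
    and T: "s * norm x \<le> T0" "T0 \<le> 1" and \<alpha>: "\<alpha> + k / ln q * ln T0 \<le> 0"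
    and r: "r > 0" and \<phi>: "cos \<phi> \<ge> - c" and y: "norm y \<le> N * growth q k \<alpha> r"
  shows "norm (y / qTheta q k (of_real r * cis (Arg x + \<phi>) / (of_real s * x)))
    \<le> N * (2 * exp (ln q / (2 * k)) / b) * decay (r / (s * norm x))"
proof -
  have b: "b > 0" using lb by (simp add: theta_lower_def)
  have T0: "0 < s * norm x" using s x by simp
  have N: "N \<ge> 0"
  proof -
    have "0 \<le> N * growth q k \<alpha> r" using y norm_ge_zero order_trans by blast
    then show ?thesis by (simp add: growth_def zero_le_mult_iff)
  qed
  have "norm (y / qTheta q k (of_real r * cis (Arg x + \<phi>) / (of_real s * x)))
    \<le> norm y * (1 / theta_weight q k (r / (s * norm x))) / b"
    by (rule kernel_bound[OF lb x s r \<phi>])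
  also have "\<dots> \<le> (N * growth q k \<alpha> r) * (1 / theta_weight q k (r / (s * norm x))) / b"
    using b theta_weight_pos[of q k "r / (s * norm x)"] y by (intro divide_right_mono mult_right_mono) auto
  also have "\<dots> = N * (growth q k \<alpha> r / theta_weight q k (r / (s * norm x))) / b" by simp
  also have "\<dots> \<le> N * (2 * exp (ln q / (2 * k)) * decay (r / (s * norm x))) / b"
    using b N by (intro divide_right_mono mult_left_mono growth_over_theta_le_decay[OF q T0 T \<alpha> r]) auto
  finally show ?thesis by simp
qed

text \<open>Near the origin the functions of level two are even bounded, although their weight allows growth
  there. This makes the integrals of level two converge at the origin.\<close>

lemma level1_bounded:
  assumes q: "q > 1" "k > 0" and lb: "theta_lower q k c b" and c: "c < 1"
    and T: "T \<noteq> 0" "norm T \<le> T0" "T0 \<le> 1" and \<alpha>: "\<alpha> + k / ln q * ln T0 \<le> 0"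
    and d: "Re (cis d / T) > - c * norm (cis d / T)"
    and g: "\<And>r. r > 0 \<Longrightarrow> norm (g (of_real r * cis d)) \<le> N * growth q k \<alpha> r" and N: "N \<ge> 0"
  shows "norm (q_laplace q k d g T) \<le> N * (2 * exp (ln q / (2 * k)) / b * pi / \<bar>qPi q k\<bar>)"
proof -
  define a where "a = Arg (cis d / T)"
  have ca: "cos a \<ge> - c" using relative_angle_cos(1)[OF T(1) c d] by (simp add: a_def)
  have da: "cis d = cis (Arg T + a)" unfolding a_def by (rule cis_relative_angle[OF T(1)])
  have b: "b > 0" using lb by (simp add: theta_lower_def)
  have "norm (LINT r:{0<..}|lborel. g (of_real r * cis d) / qTheta q k (of_real r * cis d / T) / of_real r)
    \<le> N * (2 * exp (ln q / (2 * k)) / b) * pi"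
  proof (rule ray_integral_bound[of "norm T"])
    fix r :: real assume "r \<in> {0<..}"
    then have r: "r > 0" by simp
    show "norm (g (of_real r * cis d) / qTheta q k (of_real r * cis d / T)) \<le> N * (2 * exp (ln q / (2 * k)) / b) * decay (r / norm T)"
      using level1_kernel_bound[OF q lb T(1) zero_less_one _ T(3) \<alpha> r ca g[OF r]] T(2)
      unfolding da by simp
  qed (use T b N in auto)
  then have "norm (LINT r:{0<..}|lborel. g (of_real r * cis d) / qTheta q k (of_real r * cis d / T) / of_real r) / \<bar>qPi q k\<bar>
    \<le> N * (2 * exp (ln q / (2 * k)) / b) * pi / \<bar>qPi q k\<bar>"
    by (rule divide_right_mono) simp
  then show ?thesis unfolding q_laplace_def by (simp add: norm_mult norm_divide)
qed

lemma cos_segment_ge: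
  assumes "\<phi> \<in> closed_segment a b" "cos a \<ge> C" "cos b \<ge> C" "\<bar>a\<bar> \<le> pi" "\<bar>b\<bar> \<le> pi"
  shows "cos \<phi> \<ge> C"
proof (cases "\<bar>a\<bar> \<le> \<bar>b\<bar>")
  case True
  then show ?thesis using closed_segment_abs_le[OF assms(1)] cos_antimono_abs[of \<phi> b] assms by auto
next
  case False
  then show ?thesis using closed_segment_abs_le[OF assms(1)] cos_antimono_abs[of \<phi> a] assms by auto
qed

text \<open>Between the two directions the cosine of the angle to \<open>x\<close> is at least its smaller value at the ends, so one lower bound
  for \<open>\<Theta>\<close> holds on the whole sector and the ray can be rotated through it.\<close>

lemma level1_agree:
  assumes q: "q > 1" "k > 0" and lb: "theta_lower q k c b" and c: "c < 1"
    and x: "x \<noteq> 0" and s: "s > 0" and T: "s * norm x \<le> T0" "T0 \<le> 1" and \<alpha>: "\<alpha> + k / ln q * ln T0 \<le> 0"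
    and d: "Re (cis d / x) > - c * norm (cis d / x)" "Re (cis d' / x) > - c * norm (cis d' / x)"
    and V: "open V" "\<And>u r. u \<in> V \<Longrightarrow> r > 0 \<Longrightarrow> of_real r * u \<in> V" and g: "g holomorphic_on V"
    and arc: "arc_sector x d d' \<subseteq> V"
    and bd: "\<And>u. u \<in> V \<Longrightarrow> norm (g u) \<le> N * growth q k \<alpha> (norm u)"
  shows "q_laplace q k d g (of_real s * x) = q_laplace q k d' g (of_real s * x)"
proof -
  define a a' where "a = Arg (cis d / x)" and "a' = Arg (cis d' / x)"
  have ca: "cos a > - c" "\<bar>a\<bar> < pi" "cos a' > - c" "\<bar>a'\<bar> < pi"
    using relative_angle_cos[OF x c d(1)] relative_angle_cos[OF x c d(2)] by (simp_all add: a_def a'_def)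
  have mem: "of_real r * cis (Arg x + \<phi>) \<in> V" if "r > 0" "\<phi> \<in> closed_segment a a'" for r \<phi>
    using in_arc_sectorI[OF x that(1), of \<phi> d d'] that(2) arc unfolding a_def a'_def by blast
  have "q_laplace q k (Arg x + a) g (of_real s * x) = q_laplace q k (Arg x + a') g (of_real s * x)"
  proof (rule q_laplace_rotate[OF q x s V g ca(2) ca(4)])
    show "cis (Arg x + \<phi>) \<in> V" if "\<phi> \<in> closed_segment a a'" for \<phi>
      using mem[OF zero_less_one that] by simp
    show "ray_bound (\<lambda>r. N * (2 * exp (ln q / (2 * k)) / b) * decay (r / (s * norm x)))"
      by (rule ray_bound_decay) (use s x in simp)
    show "norm (g (of_real r * cis (Arg x + \<phi>)) / qTheta q k (of_real r * cis (Arg x + \<phi>) / (of_real s * x)))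
      \<le> N * (2 * exp (ln q / (2 * k)) / b) * decay (r / (s * norm x))"
      if r: "r > 0" and \<phi>: "\<phi> \<in> closed_segment a a'" for r \<phi>
    proof (rule level1_kernel_bound[OF q lb x s T \<alpha> r])
      show "cos \<phi> \<ge> - c" using cos_segment_ge[OF \<phi>] ca by simp
      show "norm (g (of_real r * cis (Arg x + \<phi>))) \<le> N * growth q k \<alpha> r"
        using bd[OF mem[OF r \<phi>]] r by (simp add: norm_mult)
    qed
  qed
  then show ?thesis
    using q_laplace_cong_dir[OF cis_relative_angle[OF x, of d]] q_laplace_cong_dir[OF cis_relative_angle[OF x, of d']]
    by (simp add: a_def a'_def)
qed

section \<open>The Laplace transform of level two\<close>

text \<open>The integrand of level two is estimated by boundedness of \<open>y\<close> below the radius \<open>R\<close> and by its growth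
  beyond \<open>R\<close>; the two bounds decay away from \<open>|x|\<close> and from \<open>R\<close>, respectively.\<close>

lemma level2_kernel_bound:
  assumes q: "q > 1" "k > 0" and lb: "theta_lower q k c b" and x: "x \<noteq> 0"
    and \<nu>: "\<nu> + k / ln q * ln (norm x) \<le> 0" and R: "R > 0" and KN: "K \<ge> 0" "N \<ge> 0"
    and r: "r > 0" and \<phi>: "cos \<phi> \<ge> - c"
    and y: "r \<le> R \<Longrightarrow> norm y \<le> K" "r \<ge> R \<Longrightarrow> norm y \<le> N * exp (k * (ln r)\<^sup>2 / (2 * ln q) + \<nu> * ln r)"
  shows "r \<le> R \<Longrightarrow> norm (y / qTheta q k (of_real r * cis (Arg x + \<phi>) / x))
      \<le> K * (2 * exp (ln q / (2 * k)) / b) * decay (r / norm x)"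
    and "r \<ge> R \<Longrightarrow> norm (y / qTheta q k (of_real r * cis (Arg x + \<phi>) / x))
      \<le> N * (2 / b) * tail_bound q k \<nu> R (norm x) * decay (r / R)"
    and "norm (y / qTheta q k (of_real r * cis (Arg x + \<phi>) / x))
      \<le> K * (2 * exp (ln q / (2 * k)) / b) * decay (r / norm x) + N * (2 / b) * tail_bound q k \<nu> R (norm x) * decay (r / R)"
proof -
  let ?n = "norm (y / qTheta q k (of_real r * cis (Arg x + \<phi>) / x))"
  have b: "b > 0" using lb by (simp add: theta_lower_def)
  have nx: "norm x > 0" using x by simp
  define tw where "tw = theta_weight q k (r / norm x)"
  have tw: "tw > 0" unfolding tw_def by (rule theta_weight_pos)
  have base: "?n \<le> norm y * (1 / tw) / b"
    using kernel_bound[OF lb x zero_less_one r \<phi>, of y] by (simp add: tw_def)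
  show 1: "?n \<le> K * (2 * exp (ln q / (2 * k)) / b) * decay (r / norm x)" if "r \<le> R"
  proof -
    have "norm y * (1 / tw) / b \<le> K * (2 * exp (ln q / (2 * k)) * decay (r / norm x)) / b"
      unfolding tw_def using b tw r nx
      by (intro divide_right_mono mult_mono y(1)[OF that] inverse_theta_weight_le_decay[OF q] KN) (auto simp: tw_def)
    with base show ?thesis by simp
  qed
  show 2: "?n \<le> N * (2 / b) * tail_bound q k \<nu> R (norm x) * decay (r / R)" if "r \<ge> R"
  proof -
    have "norm y * (1 / tw) / b \<le> (N * exp (k * (ln r)\<^sup>2 / (2 * ln q) + \<nu> * ln r)) * (1 / tw) / b"
      using b tw by (intro divide_right_mono mult_right_mono y(2)[OF that]) auto
    also have "\<dots> = N * (exp (k * (ln r)\<^sup>2 / (2 * ln q) + \<nu> * ln r) / tw) / b" by simp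
    also have "\<dots> \<le> N * (tail_bound q k \<nu> R (norm x) * (2 * decay (r / R))) / b"
      unfolding tw_def using b
      by (intro divide_right_mono mult_left_mono outer_weight_over_theta_le[OF q nx R that \<nu>] KN) auto
    also have "\<dots> = N * (2 / b) * tail_bound q k \<nu> R (norm x) * decay (r / R)" by simp
    finally show ?thesis using base by simp
  qed
  have "0 \<le> K * (2 * exp (ln q / (2 * k)) / b) * decay (r / norm x)"
    using KN b r nx by (intro mult_nonneg_nonneg decay_nonneg) auto
  moreover have "0 \<le> N * (2 / b) * tail_bound q k \<nu> R (norm x) * decay (r / R)"
    using KN b r R by (intro mult_nonneg_nonneg decay_nonneg) (auto simp: tail_bound_def)
  ultimately show "?n \<le> K * (2 * exp (ln q / (2 * k)) / b) * decay (r / norm x)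
    + N * (2 / b) * tail_bound q k \<nu> R (norm x) * decay (r / R)"
    using 1 2 by (cases "r \<le> R") force+
qed

lemma level2_ray_bound: "R > 0 \<Longrightarrow> x \<noteq> 0 \<Longrightarrow> ray_bound (\<lambda>r. A * decay (r / norm x) + B * decay (r / R))"
  by (intro ray_bound_add ray_bound_decay) auto

text \<open>Here the constant of the lower bound for \<open>\<Theta>\<close> may depend on \<open>\<gamma>\<close> and \<open>x\<close>, because the
  conclusion is an equality.\<close>

lemma level2_rotate:
  assumes q: "q > 1" "k > 0" and x: "x \<noteq> 0" and \<nu>: "\<nu> + k / ln q * ln (norm x) \<le> 0"
    and R: "R > 0" and KN: "K \<ge> 0" "N \<ge> 0"
    and V: "open V" "\<And>u r. u \<in> V \<Longrightarrow> r > 0 \<Longrightarrow> of_real r * u \<in> V" and g: "g holomorphic_on V"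
    and arc: "arc_sector x d \<gamma> \<subseteq> V" and off: "\<bar>Arg (cis d / x)\<bar> < pi" "cis \<gamma> \<noteq> - sgn x"
    and bd: "\<And>u. u \<in> V \<Longrightarrow> norm u \<le> R \<Longrightarrow> norm (g u) \<le> K"
      "\<And>u. u \<in> V \<Longrightarrow> norm u \<ge> R \<Longrightarrow> norm (g u) \<le> N * exp (k * (ln (norm u))\<^sup>2 / (2 * ln q) + \<nu> * ln (norm u))"
  shows "q_laplace q k \<gamma> g x = q_laplace q k d g x"
proof -
  define a a' where "a = Arg (cis d / x)" and "a' = Arg (cis \<gamma> / x)"
  have da: "cis d = cis (Arg x + a)" "cis \<gamma> = cis (Arg x + a')"
    unfolding a_def a'_def by (rule cis_relative_angle[OF x])+
  have "a' \<noteq> pi"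
  proof
    assume "a' = pi"
    then have "cis \<gamma> = cis (Arg x) * cis pi" unfolding da(2) cis_mult by simp
    then show False using off(2) x by (simp add: cis_Arg)
  qed
  then have ab: "\<bar>a\<bar> < pi" "\<bar>a'\<bar> < pi"
    using off(1) Arg_bounded[of "cis \<gamma> / x"] by (auto simp: a_def a'_def abs_less_iff)
  \<comment> \<open>The smallest cone around the direction of \<open>x\<close> that contains both directions.\<close>
  define c where "c = max (- cos a) (- cos a')"
  have "cos t > -1" if "\<bar>t\<bar> < pi" for t
  proof -
    have "cos pi < cos \<bar>t\<bar>" using that by (intro cos_monotone_0_pi) auto
    then show ?thesis by simp
  qed
  from this[OF ab(1)] this[OF ab(2)] have c: "c < 1" by (auto simp: c_def)
  obtain b where lb: "theta_lower q k c b" using theta_lower_exists[OF q c] by blast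
  have mem: "of_real r * cis (Arg x + \<phi>) \<in> V" if "r > 0" "\<phi> \<in> closed_segment a a'" for r \<phi>
    using in_arc_sectorI[OF x that(1), of \<phi> d \<gamma>] that(2) arc unfolding a_def a'_def by blast
  have "q_laplace q k (Arg x + a) g (of_real 1 * x) = q_laplace q k (Arg x + a') g (of_real 1 * x)"
  proof (rule q_laplace_rotate[OF q x zero_less_one V g ab])
    show "cis (Arg x + \<phi>) \<in> V" if "\<phi> \<in> closed_segment a a'" for \<phi>
      using mem[OF zero_less_one that] by simp
    show "ray_bound (\<lambda>r. K * (2 * exp (ln q / (2 * k)) / b) * decay (r / norm x)
      + N * (2 / b) * tail_bound q k \<nu> R (norm x) * decay (r / R))"
      by (rule level2_ray_bound[OF R x])
    show "norm (g (of_real r * cis (Arg x + \<phi>)) / qTheta q k (of_real r * cis (Arg x + \<phi>) / (of_real 1 * x)))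
      \<le> K * (2 * exp (ln q / (2 * k)) / b) * decay (r / norm x) + N * (2 / b) * tail_bound q k \<nu> R (norm x) * decay (r / R)"
      if r: "r > 0" and \<phi>: "\<phi> \<in> closed_segment a a'" for r \<phi>
    proof -
      have n: "norm (of_real r * cis (Arg x + \<phi>)) = r" using r by (simp add: norm_mult)
      have "cos \<phi> \<ge> - c" using cos_segment_ge[OF \<phi>, of "- c"] ab by (auto simp: c_def)
      from level2_kernel_bound(3)[OF q lb x \<nu> R KN r this, of "g (of_real r * cis (Arg x + \<phi>))"]
        bd[OF mem[OF r \<phi>]] show ?thesis unfolding n by simp
    qed
  qed
  then show ?thesis unfolding q_laplace_cong_dir[OF da(1)] q_laplace_cong_dir[OF da(2)] by simp
qed

text \<open>Up to the radius \<open>R\<close> the transform is compared with an integral along the direction of \<open>x\<close>, at the cost of an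
  arc of radius \<open>R\<close>. This arc and the part of the ray beyond \<open>R\<close> are bounded by \<open>tail_bound\<close>.\<close>

lemma level2_to_middle:
  assumes q: "q > 1" "k > 0" and lb: "theta_lower q k c b" and c: "0 \<le> c" "c < 1" and x: "x \<noteq> 0"
    and \<nu>: "\<nu> + k / ln q * ln (norm x) \<le> 0" and R: "0 < R" "R < \<rho>" and KN: "K \<ge> 0" "N \<ge> 0"
    and V: "V = {T. T \<noteq> 0 \<and> Re (cis d / T) > - c * norm (cis d / T)}" "open V" and xV: "x \<in> V"
    and g: "g holomorphic_on V \<inter> ball 0 \<rho>" and cont: "continuous_on {0<..} (\<lambda>r. g (of_real r * cis d))"
    and bd: "\<And>u. u \<in> V \<Longrightarrow> norm u < \<rho> \<Longrightarrow> norm (g u) \<le> K"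
      "\<And>r. r \<ge> R \<Longrightarrow> norm (g (of_real r * cis d)) \<le> N * exp (k * (ln r)\<^sup>2 / (2 * ln q) + \<nu> * ln r)"
  defines "M \<equiv> K * (2 * exp (ln q / (2 * k)) / b)" and "tb \<equiv> tail_bound q k \<nu> R (norm x)"
  shows "qPi q k \<noteq> 0 \<Longrightarrow> norm (of_real (qPi q k) * q_laplace q k d g x
      - (LINT r:{0<..R}|lborel. g (of_real r * cis (Arg x)) / qTheta q k (of_real r * cis (Arg x) / x) / of_real r))
    \<le> (N * (2 / b) * pi + K / b * exp (- (k * (ln R)\<^sup>2 / (2 * ln q) + \<nu> * ln R)) * pi) * tb"
    and "norm (q_laplace q k d g x) \<le> (K * (2 * exp (ln q / (2 * k)) / b) * pi + N * (2 / b) * tb * pi) / \<bar>qPi q k\<bar>"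
proof -
  define a where "a = Arg (cis d / x)"
  have da: "cis d = cis (Arg x + a)" unfolding a_def by (rule cis_relative_angle[OF x])
  have a: "cos a > - c" "\<bar>a\<bar> < pi"
    using relative_angle_cos[OF x c(2), of d] xV unfolding V(1) a_def by auto
  have b: "b > 0" using lb by (simp add: theta_lower_def)
  have tb: "tb \<ge> 0" by (simp add: tb_def tail_bound_def)
  have cone: "of_real r * u \<in> V" if "u \<in> V" "r > 0" for u r
  proof -
    have u: "u \<noteq> 0" "Re (cis d / u) > - c * norm (cis d / u)" using that V(1) by auto
    have e: "cis d / (of_real r * u) = (cis d / u) / of_real r" by simp
    have "Re (cis d / (of_real r * u)) = Re (cis d / u) / r" unfolding e by (rule Re_divide_of_real)
    moreover have "norm (cis d / (of_real r * u)) = norm (cis d / u) / r" using that(2) by (simp add: norm_divide norm_mult)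
    ultimately show ?thesis using u that(2) divide_strict_right_mono[OF u(2) that(2)] unfolding V(1) by simp
  qed
  have seg: "cis (Arg x + \<phi>) \<in> V" "cos \<phi> \<ge> - c" if "\<phi> \<in> closed_segment a 0" for \<phi>
  proof -
    have p: "\<bar>\<phi>\<bar> \<le> \<bar>a\<bar>" "\<bar>a - \<phi>\<bar> \<le> \<bar>a\<bar>" using closed_segment_0_abs[of \<phi> a] that by (auto simp: closed_segment_commute)
    show "cos \<phi> \<ge> - c" using cos_antimono_abs[OF p(1)] a by simp
    have "cis d / cis (Arg x + \<phi>) = cis (a - \<phi>)" unfolding da by (simp add: cis_divide)
    moreover have "cos (a - \<phi>) > - c" using cos_antimono_abs[OF p(2)] a by simp
    ultimately show "cis (Arg x + \<phi>) \<in> V" unfolding V(1) by simp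
  qed
  have mem: "of_real r * cis (Arg x + \<phi>) \<in> V" if "r > 0" "\<phi> \<in> closed_segment a 0" for r \<phi>
    by (rule cone[OF seg(1)[OF that(2)] that(1)])
  have nn: "norm (of_real r * cis t) = r" if "r > 0" for r t using that by (simp add: norm_mult)
  have bK: "norm (g (of_real r * cis (Arg x + \<phi>))) \<le> K" if "r > 0" "r \<le> R" "\<phi> \<in> closed_segment a 0" for r \<phi>
    using bd(1)[OF mem[OF that(1,3)]] that R by (simp add: norm_mult)
  have inner: "norm (g (of_real r * cis (Arg x + \<phi>)) / qTheta q k (of_real r * cis (Arg x + \<phi>) / x)) \<le> M * decay (r / norm x)"
    if "r > 0" "r \<le> R" "\<phi> \<in> closed_segment a 0" for r \<phi>
  proof -
    have "norm (g (of_real r * cis (Arg x + \<phi>)) / qTheta q k (of_real r * cis (Arg x + \<phi>) / (of_real 1 * x)))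
      \<le> norm (g (of_real r * cis (Arg x + \<phi>))) * (1 / theta_weight q k (r / (1 * norm x))) / b"
      by (rule kernel_bound[OF lb x zero_less_one that(1) seg(2)[OF that(3)]])
    also have "\<dots> \<le> K * (2 * exp (ln q / (2 * k)) * decay (r / (1 * norm x))) / b"
      using b that x theta_weight_pos[of q k "r / (1 * norm x)"]
      by (intro divide_right_mono mult_mono bK inverse_theta_weight_le_decay[OF q] KN) auto
    finally show ?thesis by (simp add: M_def)
  qed
  have arcR: "norm (g (of_real R * cis (Arg x + \<phi>)) / qTheta q k (of_real R * cis (Arg x + \<phi>) / x))
    \<le> K / b * exp (- (k * (ln R)\<^sup>2 / (2 * ln q) + \<nu> * ln R)) * tb" if "\<phi> \<in> closed_segment a 0" for \<phi>
  proof -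
    define Y where "Y = k * (ln R)\<^sup>2 / (2 * ln q) + \<nu> * ln R"
    have "norm (g (of_real R * cis (Arg x + \<phi>)) / qTheta q k (of_real R * cis (Arg x + \<phi>) / (of_real 1 * x)))
      \<le> norm (g (of_real R * cis (Arg x + \<phi>))) * (1 / theta_weight q k (R / (1 * norm x))) / b"
      by (rule kernel_bound[OF lb x zero_less_one R(1) seg(2)[OF that]])
    also have "\<dots> \<le> K * (exp (- Y) * tb) / b"
    proof (intro divide_right_mono mult_mono bK that order_refl R(1) KN)
      have "exp Y / theta_weight q k (R / norm x) \<le> tb * (2 * decay (R / R))"
        unfolding Y_def tb_def by (rule outer_weight_over_theta_le[OF q _ R(1) order_refl \<nu>]) (use x in simp)
      then have "exp Y / theta_weight q k (R / norm x) \<le> tb" using R by (simp add: decay_def)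
      then have "exp (- Y) * (exp Y / theta_weight q k (R / norm x)) \<le> exp (- Y) * tb" by (intro mult_left_mono) auto
      then show "1 / theta_weight q k (R / (1 * norm x)) \<le> exp (- Y) * tb"
        by (simp add: exp_minus)
    qed (use b theta_weight_pos[of q k "R / (1 * norm x)"] in auto)
    finally show ?thesis by (simp add: Y_def)
  qed
  have outer: "norm (g (of_real r * cis d) / qTheta q k (of_real r * cis d / x)) \<le> N * (2 / b) * tb * decay (r / R)"
    if "r \<ge> R" for r
    unfolding tb_def da using that R bd(2)[OF that] a bK[of r a] da
    by (intro level2_kernel_bound(2)[OF q lb x \<nu> R(1) KN]) auto
  have full: "norm (g (of_real r * cis d) / qTheta q k (of_real r * cis d / x)) \<le> M * decay (r / norm x) + N * (2 / b) * tb * decay (r / R)"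
    if "r > 0" for r
  proof -
    have "0 \<le> M * decay (r / norm x)" unfolding M_def using KN b that x by (intro mult_nonneg_nonneg decay_nonneg) auto
    moreover have "0 \<le> N * (2 / b) * tb * decay (r / R)" using KN b that R tb by (intro mult_nonneg_nonneg decay_nonneg) auto
    ultimately show ?thesis using inner[of r a] outer[of r] that unfolding da[symmetric] by (cases "r \<le> R") force+
  qed
  define H where "H r = g (of_real r * cis d) / qTheta q k (of_real r * cis d / x)" for r
  have cH: "continuous_on {0<..} H"
  proof -
    have ne: "of_real r * cis d / x \<notin> \<real>\<^sub>\<le>\<^sub>0" if "r > 0" for r
      unfolding da polar_div[OF x] by (rule off_negative_axis[OF a(2)]) (use that x in simp)
    have "continuous_on {0<..} (\<lambda>r. qTheta q k (of_real r * cis d / x))"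
      by (rule continuous_on_compose2[OF holomorphic_on_imp_continuous_on[OF qTheta_holomorphic[OF q]]])
        (use x in \<open>auto intro!: continuous_intros\<close>)
    then show ?thesis unfolding H_def
      by (intro continuous_on_divide cont) (use qTheta_nonzero[OF q ne] in auto)
  qed
  have I: "set_integrable lborel {0<..} (\<lambda>r. H r / of_real r)"
    unfolding H_def
    by (rule ray_integrable[where F = "\<lambda>u. g u / qTheta q k (u / x)" and \<phi> = d,
          OF level2_ray_bound[OF R(1) x, of M "N * (2 / b) * tb"]])
      (use cH full in \<open>auto simp: H_def\<close>)
  have split: "(LINT r:{0<..}|lborel. H r / of_real r) = (LINT r:{0<..R}|lborel. H r / of_real r) + (LINT r:{R<..}|lborel. H r / of_real r)"
  proof -
    have U: "{0<..} = {0<..R} \<union> {R<..}" using R by auto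
    show ?thesis unfolding U
      by (rule set_integral_Un) (use R in \<open>auto intro!: set_integrable_subset[OF I]\<close>)
  qed
  have tail: "norm (LINT r:{R<..}|lborel. H r / of_real r) \<le> N * (2 / b) * tb * pi"
    by (rule ray_integral_bound[OF R(1)]) (use R outer KN b tb in \<open>auto simp: H_def\<close>)
  have rot: "norm ((LINT r:{0<..R}|lborel. H r / of_real r)
    - (LINT r:{0<..R}|lborel. g (of_real r * cis (Arg x + 0)) / qTheta q k (of_real r * cis (Arg x + 0) / x) / of_real r))
    \<le> K / b * exp (- (k * (ln R)\<^sup>2 / (2 * ln q) + \<nu> * ln R)) * tb * \<bar>0 - a\<bar>"
    unfolding H_def da
    by (rule q_laplace_rotate_truncated[OF q x V(2) cone g R a(2) _ seg(1) ray_bound_decay inner arcR])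
      (use x in auto)
  also have "\<dots> \<le> K / b * exp (- (k * (ln R)\<^sup>2 / (2 * ln q) + \<nu> * ln R)) * tb * pi"
    using a KN b tb by (intro mult_left_mono) auto
  finally have rot': "norm ((LINT r:{0<..R}|lborel. H r / of_real r)
    - (LINT r:{0<..R}|lborel. g (of_real r * cis (Arg x)) / qTheta q k (of_real r * cis (Arg x) / x) / of_real r))
    \<le> K / b * exp (- (k * (ln R)\<^sup>2 / (2 * ln q) + \<nu> * ln R)) * tb * pi" by simp
  have qL: "q_laplace q k d g x = 1 / of_real (qPi q k) * (LINT r:{0<..}|lborel. H r / of_real r)"
    by (simp add: q_laplace_def H_def)
  show "norm (of_real (qPi q k) * q_laplace q k d g x
      - (LINT r:{0<..R}|lborel. g (of_real r * cis (Arg x)) / qTheta q k (of_real r * cis (Arg x) / x) / of_real r))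
    \<le> (N * (2 / b) * pi + K / b * exp (- (k * (ln R)\<^sup>2 / (2 * ln q) + \<nu> * ln R)) * pi) * tb" if nz: "qPi q k \<noteq> 0"
  proof -
    have e: "of_real (qPi q k) * q_laplace q k d g x
      - (LINT r:{0<..R}|lborel. g (of_real r * cis (Arg x)) / qTheta q k (of_real r * cis (Arg x) / x) / of_real r)
      = ((LINT r:{0<..R}|lborel. H r / of_real r)
      - (LINT r:{0<..R}|lborel. g (of_real r * cis (Arg x)) / qTheta q k (of_real r * cis (Arg x) / x) / of_real r))
      + (LINT r:{R<..}|lborel. H r / of_real r)"
      unfolding qL split using nz by simp
    have "(N * (2 / b) * pi + K / b * E * pi) * tb = K / b * E * tb * pi + N * (2 / b) * tb * pi" for E
      unfolding distrib_right by (simp only: mult_ac add.commute)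
    then show ?thesis unfolding e using norm_triangle_mono[OF rot' tail] by (simp only:)
  qed
  have "norm (LINT r:{0<..R}|lborel. H r / of_real r) \<le> M * pi"
    by (rule ray_integral_bound[of "norm x"]) (use x KN b inner[of _ a] da in \<open>auto simp: H_def M_def\<close>)
  then have "norm (LINT r:{0<..}|lborel. H r / of_real r) \<le> M * pi + N * (2 / b) * tb * pi"
    unfolding split using tail norm_triangle_mono by blast
  then have "norm (LINT r:{0<..}|lborel. H r / of_real r) / \<bar>qPi q k\<bar> \<le> (M * pi + N * (2 / b) * tb * pi) / \<bar>qPi q k\<bar>"
    by (intro divide_right_mono) auto
  then show "norm (q_laplace q k d g x) \<le> (K * (2 * exp (ln q / (2 * k)) / b) * pi + N * (2 / b) * tb * pi) / \<bar>qPi q k\<bar>"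
    unfolding qL by (simp add: norm_mult norm_divide M_def)
qed

section \<open>The inverse Fourier transform\<close>

text \<open>The integrand is jointly continuous in \<open>m\<close> and the parameter of the ray, hence its integral depends
  measurably on \<open>m\<close>.\<close>

lemma q_laplace_measurable:
  fixes g :: "complex \<Rightarrow> real \<Rightarrow> complex"
  assumes q: "q > 1" "k > 0" and T: "T \<noteq> 0" and off: "\<And>r. r > 0 \<Longrightarrow> of_real r * cis d / T \<notin> \<real>\<^sub>\<le>\<^sub>0"
    and g: "continuous_on (UNIV \<times> {0<..}) (\<lambda>(m, r). g (of_real r * cis d) m)"
  shows "(\<lambda>m. q_laplace q k d (\<lambda>\<tau>. g \<tau> m) T) \<in> borel_measurable lborel"
proof -
  let ?F = "\<lambda>(m::real, r). g (of_real r * cis d) m / qTheta q k (of_real r * cis d / T) / of_real r"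
  have "continuous_on (UNIV \<times> {0<..}) (\<lambda>p. qTheta q k (of_real (snd p) * cis d / T))"
    by (rule continuous_on_compose2[OF holomorphic_on_imp_continuous_on[OF qTheta_holomorphic[OF q]]])
      (use T in \<open>auto intro!: continuous_intros\<close>)
  then have "continuous_on (UNIV \<times> {0<..}) ?F"
    using g unfolding case_prod_unfold
    by (intro continuous_on_divide continuous_intros) (use qTheta_nonzero[OF q off] in auto)
  then have "(\<lambda>p. indicator (UNIV \<times> {0<..}) p *\<^sub>R ?F p) \<in> borel_measurable (borel :: (real \<times> real) measure)"
    by (intro borel_measurable_continuous_on_indicator borel_open open_Times) auto
  then have meas: "(\<lambda>p. indicator (UNIV \<times> {0<..}) p *\<^sub>R ?F p) \<in> borel_measurable (lborel \<Otimes>\<^sub>M lborel)"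
    by (simp add: lborel_prod)
  have eq: "(\<lambda>p. indicator (UNIV \<times> {0<..}) p *\<^sub>R ?F p) = (\<lambda>(m, r). indicator {0<..} r *\<^sub>R ?F (m, r))"
    by (auto simp: indicator_def)
  have "(\<lambda>m. LINT r|lborel. indicator {0<..} r *\<^sub>R ?F (m, r)) \<in> borel_measurable lborel"
  proof (rule lborel.borel_measurable_lebesgue_integral)
    show "(\<lambda>(m, r). indicator {0<..} r *\<^sub>R ?F (m, r)) \<in> borel_measurable (lborel \<Otimes>\<^sub>M lborel)"
      using meas unfolding eq .
  qed
  then show ?thesis unfolding q_laplace_def set_lebesgue_integral_def by simp
qed

lemma inv_fourier_diff_bound:
  assumes ab: "0 < \<beta>'" "\<beta>' < \<beta>" and meas: "h \<in> borel_measurable lborel" "h' \<in> borel_measurable lborel"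
    and h: "\<And>m. norm (h m) \<le> A * exp (- \<beta> * \<bar>m\<bar>)" "\<And>m. norm (h' m) \<le> A * exp (- \<beta> * \<bar>m\<bar>)"
    and M: "\<And>m. norm (h m - h' m) \<le> M * exp (- \<beta> * \<bar>m\<bar>)" and z: "\<bar>Im z\<bar> < \<beta>'"
  shows "norm (inv_fourier h z - inv_fourier h' z) \<le> M * (LINT m|lborel. exp (- (\<beta> - \<beta>') * \<bar>m\<bar>))"
proof -
  let ?e = "\<lambda>m. exp (\<i> * z * complex_of_real m)"
  have J: "integrable lborel (\<lambda>m. B * exp (- (\<beta> - \<beta>') * \<bar>m\<bar>))" for B :: real
    using integrable_exp_neg_abs[of "\<beta> - \<beta>'"] ab by simp
  have e: "norm (?e m) \<le> exp (\<beta>' * \<bar>m\<bar>)" for m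
  proof -
    have "- (Im z * m) \<le> \<bar>Im z\<bar> * \<bar>m\<bar>" by (metis abs_ge_minus_self abs_mult)
    also have "\<dots> \<le> \<beta>' * \<bar>m\<bar>" using z by (intro mult_right_mono) auto
    finally show ?thesis by (simp add: norm_exp_eq_Re)
  qed
  have pt: "norm (y * ?e m) \<le> B * exp (- (\<beta> - \<beta>') * \<bar>m\<bar>)" if "norm y \<le> B * exp (- \<beta> * \<bar>m\<bar>)" for y B m
  proof -
    have "norm (y * ?e m) \<le> (B * exp (- \<beta> * \<bar>m\<bar>)) * exp (\<beta>' * \<bar>m\<bar>)"
      unfolding norm_mult by (intro mult_mono that e order_trans[OF norm_ge_zero that]) auto
    also have "\<dots> = B * exp (- (\<beta> - \<beta>') * \<bar>m\<bar>)"
      unfolding mult.assoc exp_add[symmetric] by (simp add: algebra_simps)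
    finally show ?thesis .
  qed
  have int: "integrable lborel (\<lambda>m. g m * ?e m)"
    if "g \<in> borel_measurable lborel" "\<And>m. norm (g m) \<le> B * exp (- \<beta> * \<bar>m\<bar>)" for g B
  proof (rule Bochner_Integration.integrable_bound[OF J[of B]])
    show "(\<lambda>m. g m * ?e m) \<in> borel_measurable lborel"
      using that(1) by (intro borel_measurable_times) (auto intro!: borel_measurable_continuous_onI continuous_intros)
    have "norm (g m * ?e m) \<le> norm (B * exp (- (\<beta> - \<beta>') * \<bar>m\<bar>))" for m
      using pt[OF that(2), of m] unfolding real_norm_def by linarith
    then show "AE m in lborel. norm (g m * ?e m) \<le> norm (B * exp (- (\<beta> - \<beta>') * \<bar>m\<bar>))" by (rule AE_I2)
  qed
  have "(LINT m|lborel. h m * ?e m) - (LINT m|lborel. h' m * ?e m) = (LINT m|lborel. (h m - h' m) * ?e m)"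
    unfolding left_diff_distrib
    by (rule Bochner_Integration.integral_diff[symmetric, OF int[OF meas(1) h(1)] int[OF meas(2) h(2)]])
  also have "norm \<dots> \<le> (LINT m|lborel. M * exp (- (\<beta> - \<beta>') * \<bar>m\<bar>))"
  proof (rule Bochner_Integration.integral_norm_bound_integral[OF _ J])
    show "integrable lborel (\<lambda>m. (h m - h' m) * ?e m)"
      by (rule int[OF _ M]) (intro borel_measurable_diff meas)
  qed (rule pt[OF M])
  also have "\<dots> = M * (LINT m|lborel. exp (- (\<beta> - \<beta>') * \<bar>m\<bar>))" by (rule integral_mult_right_zero)
  finally have le: "norm ((LINT m|lborel. h m * ?e m) - (LINT m|lborel. h' m * ?e m)) \<le> M * (LINT m|lborel. exp (- (\<beta> - \<beta>') * \<bar>m\<bar>))" .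
  have "2 * pi \<ge> 1" using pi_ge_two by simp
  then have p: "1 / sqrt (2 * pi) \<le> 1" by simp
  have "norm (inv_fourier h z - inv_fourier h' z)
    = 1 / sqrt (2 * pi) * norm ((LINT m|lborel. h m * ?e m) - (LINT m|lborel. h' m * ?e m))"
    unfolding inv_fourier_def right_diff_distrib[symmetric] norm_mult by (simp add: norm_divide)
  also have "\<dots> \<le> 1 * norm ((LINT m|lborel. h m * ?e m) - (LINT m|lborel. h' m * ?e m))"
    by (intro mult_right_mono p) auto
  finally show ?thesis using le by simp
qed

section \<open>Pairs of Borel transforms\<close>

text \<open>The constants common to the two neighbouring transforms: \<open>r0\<close> bounds \<open>|x|\<close>, \<open>N1\<close> and \<open>N2\<close> bound the functions of
  level one and two, and \<open>c\<close> describes the sets \<open>R_set\<close> by angles.\<close>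

locale two_levels =
  fixes q \<kappa> k \<alpha> \<nu> \<beta> r0 \<delta>' N1 N2 c :: real
  assumes q: "q > 1" and \<kappa>: "\<kappa> > 0" and k: "k > 0" and r0: "0 < r0" "r0 \<le> 1"
    and \<alpha>: "\<alpha> + \<kappa> / ln q * ln r0 \<le> 0" and \<nu>: "\<nu> + k / ln q * ln r0 \<le> 0"
    and \<delta>': "0 < \<delta>'" "\<delta>' < 1" and N: "N1 \<ge> 0" "N2 \<ge> 0"
    and c: "0 \<le> c" "c < 1" "\<And>d. R_set d \<delta>' = {T. T \<noteq> 0 \<and> Re (cis d / T) > - c * norm (cis d / T)}"
begin

definition Rb :: "real \<Rightarrow> complex set" where
  "Rb d = R_set d \<delta>' \<inter> ball 0 r0"

text \<open>A function \<open>h1\<close> of level one on the sector \<open>U\<close> and the continuation \<open>h2\<close> of its Laplace transform of order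
  \<open>\<kappa>\<close> to the sector \<open>S\<close>. Both the solutions and the forcing terms form such pairs.\<close>

definition borel_pair :: "real \<Rightarrow> complex set \<Rightarrow> complex set \<Rightarrow> (complex \<Rightarrow> real \<Rightarrow> complex) \<Rightarrow>
    (complex \<Rightarrow> real \<Rightarrow> complex) \<Rightarrow> bool" where
  "borel_pair d U S h1 h2 \<longleftrightarrow>
     unbounded_sector d U \<and> unbounded_sector d S \<and> S \<subseteq> R_set d \<delta>' \<and>
     (\<forall>m. (\<lambda>u. h1 u m) holomorphic_on U) \<and>
     (\<forall>u\<in>U. \<forall>m. norm (h1 u m) \<le> N1 * growth q \<kappa> \<alpha> (norm u) * exp (- \<beta> * \<bar>m\<bar>)) \<and>
     continuous_on (S \<times> UNIV) (\<lambda>(u, m). h2 u m) \<and>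
     (\<forall>m. (\<lambda>u. h2 u m) holomorphic_on S \<union> Rb d) \<and>
     (\<forall>u\<in>S. \<forall>m. norm (h2 u m) \<le> N2 * exp (k * (ln (norm u))\<^sup>2 / (2 * ln q) + \<nu> * ln (norm u)) * exp (- \<beta> * \<bar>m\<bar>)) \<and>
     (\<forall>u\<in>Rb d. \<forall>m. h2 u m = q_laplace q \<kappa> d (\<lambda>v. h1 v m) u)"

definition b1 :: real where "b1 = (SOME b. theta_lower q \<kappa> c b)"
definition b2 :: real where "b2 = (SOME b. theta_lower q k c b)"
definition K0 :: real where "K0 = N1 * (2 * exp (ln q / (2 * \<kappa>)) / b1 * pi / \<bar>qPi q \<kappa>\<bar>)"

lemma b1_lower: "theta_lower q \<kappa> c b1"
  unfolding b1_def using theta_lower_exists[OF q \<kappa> c(2)] by (metis someI)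

lemma b2_lower: "theta_lower q k c b2"
  unfolding b2_def using theta_lower_exists[OF q k c(2)] by (metis someI)

lemma K0_nonneg: "K0 \<ge> 0"
proof -
  have "b1 > 0" using b1_lower by (simp add: theta_lower_def)
  then show ?thesis unfolding K0_def using N by (intro mult_nonneg_nonneg divide_nonneg_nonneg) auto
qed

text \<open>The constant is independent of \<open>h1\<close>, \<open>h2\<close> and \<open>d\<close>, which makes it uniform in \<open>\<epsilon>\<close>.\<close>

lemma Rb_bounded:
  assumes P: "borel_pair d U S h1 h2" and u: "u \<in> Rb d"
  shows "norm (h2 u m) \<le> K0 * exp (- \<beta> * \<bar>m\<bar>)"
proof -
  have u': "u \<noteq> 0" "Re (cis d / u) > - c * norm (cis d / u)" "norm u \<le> r0"
    using u by (auto simp: Rb_def c(3))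
  have U: "unbounded_sector d U" using P by (simp add: borel_pair_def)
  have "norm (h2 u m) = norm (q_laplace q \<kappa> d (\<lambda>v. h1 v m) u)" using P u by (simp add: borel_pair_def)
  also have "\<dots> \<le> (N1 * exp (- \<beta> * \<bar>m\<bar>)) * (2 * exp (ln q / (2 * \<kappa>)) / b1 * pi / \<bar>qPi q \<kappa>\<bar>)"
  proof (rule level1_bounded[OF q \<kappa> b1_lower c(2) u'(1,3) r0(2) \<alpha> u'(2)])
    fix r :: real assume r: "r > 0"
    have "of_real r * cis d \<in> U" by (rule unbounded_sector_props(2)[OF U unbounded_sector_props(3)[OF U] r])
    then have "norm (h1 (of_real r * cis d) m) \<le> N1 * growth q \<kappa> \<alpha> (norm (of_real r * cis d)) * exp (- \<beta> * \<bar>m\<bar>)"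
      using P unfolding borel_pair_def by blast
    then show "norm (h1 (of_real r * cis d) m) \<le> N1 * exp (- \<beta> * \<bar>m\<bar>) * growth q \<kappa> \<alpha> r"
      using r by (simp add: norm_mult mult_ac)
  qed (use N in simp)
  finally show ?thesis unfolding K0_def by (simp only: mult_ac)
qed

lemma Rb_scale: "x \<in> Rb d \<Longrightarrow> s > 0 \<Longrightarrow> s * norm x < r0 \<Longrightarrow> of_real s * x \<in> Rb d"
  unfolding Rb_def using R_set_cone by (auto simp: norm_mult)

lemma agree_on_ray:
  assumes P: "borel_pair d U S h1 h2" "borel_pair d' U' S' h1' h2'"
    and eq: "\<And>u m. u \<in> U \<inter> U' \<Longrightarrow> h1 u m = h1' u m"
    and x: "x \<in> Rb d" "x \<in> Rb d'" and arc: "arc_sector x d d' \<subseteq> U \<inter> U'"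
    and s: "s > 0" "s * norm x < r0"
  shows "h2 (of_real s * x) m = h2' (of_real s * x) m"
proof -
  have U: "unbounded_sector d U" "unbounded_sector d' U'" using P by (auto simp: borel_pair_def)
  have x': "x \<noteq> 0" "Re (cis d / x) > - c * norm (cis d / x)" "Re (cis d' / x) > - c * norm (cis d' / x)"
    using x by (auto simp: Rb_def c(3))
  have "h2 (of_real s * x) m = q_laplace q \<kappa> d (\<lambda>v. h1 v m) (of_real s * x)"
    using P(1) Rb_scale[OF x(1) s] unfolding borel_pair_def by blast
  also have "\<dots> = q_laplace q \<kappa> d' (\<lambda>v. h1 v m) (of_real s * x)"
  proof (rule level1_agree[OF q \<kappa> b1_lower c(2) x'(1) s(1) less_imp_le[OF s(2)] r0(2) \<alpha> x'(2,3) _ _ _ arc])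
    show "open (U \<inter> U')" using unbounded_sector_props(1) U by (auto intro: open_Int)
    show "of_real r * u \<in> U \<inter> U'" if "u \<in> U \<inter> U'" "r > 0" for u r
      using that unbounded_sector_props(2)[OF U(1)] unbounded_sector_props(2)[OF U(2)] by blast
    have "(\<lambda>v. h1 v m) holomorphic_on U" using P(1) unfolding borel_pair_def by blast
    then show "(\<lambda>v. h1 v m) holomorphic_on U \<inter> U'" by (rule holomorphic_on_subset) auto
    show "norm (h1 u m) \<le> N1 * exp (- \<beta> * \<bar>m\<bar>) * growth q \<kappa> \<alpha> (norm u)" if "u \<in> U \<inter> U'" for u
    proof -
      have "norm (h1 u m) \<le> N1 * growth q \<kappa> \<alpha> (norm u) * exp (- \<beta> * \<bar>m\<bar>)"
        using P(1) that unfolding borel_pair_def by blast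
      then show ?thesis by (simp only: mult_ac)
    qed
  qed
  also have "\<dots> = q_laplace q \<kappa> d' (\<lambda>v. h1' v m) (of_real s * x)"
  proof -
    have "of_real r * cis d' \<in> U \<inter> U'" if "r > 0" for r
    proof -
      have "of_real r * cis (Arg x + Arg (cis d' / x)) \<in> arc_sector x d d'"
        by (rule in_arc_sectorI[OF x'(1) that]) simp
      then show ?thesis using arc cis_relative_angle[OF x'(1), of d'] by auto
    qed
    then show ?thesis unfolding q_laplace_def
      by (intro arg_cong2[of _ _ _ _ "(*)"] set_lebesgue_integral_cong) (auto simp: eq)
  qed
  also have "\<dots> = h2' (of_real s * x) m"
    using P(2) Rb_scale[OF x(2) s] unfolding borel_pair_def by simp
  finally show ?thesis .
qed

text \<open>Any radius less than \<open>r0\<close> would serve: the functions of level two have to be defined on a whole arc of this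
  radius.\<close>

definition R :: real where "R = r0 / 2"

lemma R_bounds: "0 < R" "R < r0"
  using r0 by (simp_all add: R_def)

lemma nu_condition_at: "x \<in> Rb d \<Longrightarrow> \<nu> + k / ln q * ln (norm x) \<le> 0"
proof -
  assume "x \<in> Rb d"
  then have "0 < norm x" "norm x \<le> r0" by (auto simp: Rb_def c(3))
  then have "ln (norm x) \<le> ln r0" using r0 by simp
  then have "k / ln q * ln (norm x) \<le> k / ln q * ln r0" using q k by (intro mult_left_mono) auto
  then show ?thesis using \<nu> by linarith
qed

lemma rotate_to_bisector:
  assumes P: "borel_pair d U S h1 h2" and x: "x \<in> Rb d"
    and arc: "arc_sector x d \<gamma> \<subseteq> S" and off: "cis \<gamma> \<noteq> - sgn x"
  shows "q_laplace q k \<gamma> (\<lambda>\<tau>. h2 \<tau> m) x = q_laplace q k d (\<lambda>\<tau>. h2 \<tau> m) x"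
proof -
  have S: "unbounded_sector d S" and sub: "S \<subseteq> R_set d \<delta>'" using P by (auto simp: borel_pair_def)
  have x': "x \<noteq> 0" "Re (cis d / x) > - c * norm (cis d / x)" using x by (auto simp: Rb_def c(3))
  have "(\<lambda>\<tau>. h2 \<tau> m) holomorphic_on S \<union> Rb d" using P unfolding borel_pair_def by blast
  then have hol: "(\<lambda>\<tau>. h2 \<tau> m) holomorphic_on S" by (rule holomorphic_on_subset) auto
  show ?thesis
  proof (rule level2_rotate[OF q k x'(1) nu_condition_at[OF x] R_bounds(1) _ _ unbounded_sector_props(1,2)[OF S] hol arc
        relative_angle_cos(2)[OF x'(1) c(2) x'(2)] off])
    show "norm (h2 u m) \<le> K0 * exp (- \<beta> * \<bar>m\<bar>)" if "u \<in> S" "norm u \<le> R" for u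
      by (rule Rb_bounded[OF P]) (use that sub R_bounds in \<open>auto simp: Rb_def\<close>)
    show "norm (h2 u m) \<le> N2 * exp (- \<beta> * \<bar>m\<bar>) * exp (k * (ln (norm u))\<^sup>2 / (2 * ln q) + \<nu> * ln (norm u))"
      if "u \<in> S" "norm u \<ge> R" for u
    proof -
      have "norm (h2 u m) \<le> N2 * exp (k * (ln (norm u))\<^sup>2 / (2 * ln q) + \<nu> * ln (norm u)) * exp (- \<beta> * \<bar>m\<bar>)"
        using P that(1) unfolding borel_pair_def by blast
      then show ?thesis by (simp only: mult_ac)
    qed
  qed (use K0_nonneg N in auto)
qed

definition tb :: "complex \<Rightarrow> real" where "tb x = tail_bound q k \<nu> R (norm x)"

definition K1 :: real where
  "K1 = N2 * (2 / b2) * pi + K0 / b2 * exp (- (k * (ln R)\<^sup>2 / (2 * ln q) + \<nu> * ln R)) * pi"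

lemma K1_nonneg: "K1 \<ge> 0"
proof -
  have "b2 > 0" using b2_lower by (simp add: theta_lower_def)
  then show ?thesis unfolding K1_def using N K0_nonneg by (intro add_nonneg_nonneg mult_nonneg_nonneg) auto
qed

lemma distance_to_middle:
  assumes P: "borel_pair d U S h1 h2" and x: "x \<in> Rb d"
  shows "qPi q k \<noteq> 0 \<Longrightarrow> norm (of_real (qPi q k) * q_laplace q k d (\<lambda>\<tau>. h2 \<tau> m) x
      - (LINT r:{0<..R}|lborel. h2 (of_real r * cis (Arg x)) m / qTheta q k (of_real r * cis (Arg x) / x) / of_real r))
    \<le> K1 * tb x * exp (- \<beta> * \<bar>m\<bar>)"
    and "norm (q_laplace q k d (\<lambda>\<tau>. h2 \<tau> m) x)
    \<le> (K0 * (2 * exp (ln q / (2 * k)) / b2) * pi + N2 * (2 / b2) * tb x * pi) / \<bar>qPi q k\<bar> * exp (- \<beta> * \<bar>m\<bar>)"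
proof -
  define e where "e = exp (- \<beta> * \<bar>m\<bar>)"
  have e: "e \<ge> 0" by (simp add: e_def)
  have S: "unbounded_sector d S" and sub: "S \<subseteq> R_set d \<delta>'" using P by (auto simp: borel_pair_def)
  have x': "x \<noteq> 0" "x \<in> R_set d \<delta>'" using x by (auto simp: Rb_def c(3))
  have KN: "K0 * e \<ge> 0" "N2 * e \<ge> 0" using K0_nonneg N e by auto
  have ray: "of_real r * cis d \<in> S" if "r > 0" for r
    by (rule unbounded_sector_props(2)[OF S unbounded_sector_props(3)[OF S] that])
  have "(\<lambda>\<tau>. h2 \<tau> m) holomorphic_on S \<union> Rb d" using P unfolding borel_pair_def by blast
  then have hol: "(\<lambda>\<tau>. h2 \<tau> m) holomorphic_on R_set d \<delta>' \<inter> ball 0 r0" and holS: "(\<lambda>\<tau>. h2 \<tau> m) holomorphic_on S"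
    by (auto intro: holomorphic_on_subset simp: Rb_def)
  have cont: "continuous_on {0<..} (\<lambda>r. h2 (of_real r * cis d) m)"
    by (rule continuous_on_compose2[OF holomorphic_on_imp_continuous_on[OF holS]])
      (use ray in \<open>auto intro!: continuous_intros\<close>)
  have bK: "norm (h2 u m) \<le> K0 * e" if "u \<in> R_set d \<delta>'" "norm u < r0" for u
    unfolding e_def by (rule Rb_bounded[OF P]) (use that in \<open>auto simp: Rb_def\<close>)
  have bN: "norm (h2 (of_real r * cis d) m) \<le> N2 * e * exp (k * (ln r)\<^sup>2 / (2 * ln q) + \<nu> * ln r)" if "r \<ge> R" for r
  proof -
    have r: "r > 0" using that R_bounds by linarith
    have "norm (h2 (of_real r * cis d) m)
      \<le> N2 * exp (k * (ln (norm (of_real r * cis d)))\<^sup>2 / (2 * ln q) + \<nu> * ln (norm (of_real r * cis d))) * exp (- \<beta> * \<bar>m\<bar>)"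
      using P ray[OF r] unfolding borel_pair_def by blast
    moreover have "norm (of_real r * cis d) = r" using r by (simp add: norm_mult)
    ultimately show ?thesis unfolding e_def by (simp only: mult_ac)
  qed
  note L = level2_to_middle[OF q k b2_lower c(1,2) x'(1) nu_condition_at[OF x] R_bounds KN c(3) open_R_set[OF \<delta>'] x'(2) hol cont]
  show "norm (of_real (qPi q k) * q_laplace q k d (\<lambda>\<tau>. h2 \<tau> m) x
      - (LINT r:{0<..R}|lborel. h2 (of_real r * cis (Arg x)) m / qTheta q k (of_real r * cis (Arg x) / x) / of_real r))
    \<le> K1 * tb x * exp (- \<beta> * \<bar>m\<bar>)" if nz: "qPi q k \<noteq> 0"
  proof -
    define F where "F = exp (- (k * (ln R)\<^sup>2 / (2 * ln q) + \<nu> * ln R))"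
    have "norm (of_real (qPi q k) * q_laplace q k d (\<lambda>\<tau>. h2 \<tau> m) x
      - (LINT r:{0<..R}|lborel. h2 (of_real r * cis (Arg x)) m / qTheta q k (of_real r * cis (Arg x) / x) / of_real r))
      \<le> (N2 * e * (2 / b2) * pi + K0 * e / b2 * F * pi) * tb x"
      unfolding F_def tb_def by (rule L(1)[OF bK bN nz])
    also have "\<dots> = K1 * tb x * e" unfolding K1_def F_def[symmetric] by (simp add: algebra_simps)
    finally show ?thesis unfolding e_def .
  qed
  define F where "F = 2 * exp (ln q / (2 * k)) / b2"
  have "norm (q_laplace q k d (\<lambda>\<tau>. h2 \<tau> m) x) \<le> (K0 * e * F * pi + N2 * e * (2 / b2) * tb x * pi) / \<bar>qPi q k\<bar>"
    unfolding F_def tb_def by (rule L(2)[OF bK bN])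
  also have "K0 * e * F * pi + N2 * e * (2 / b2) * tb x * pi = (K0 * F * pi + N2 * (2 / b2) * tb x * pi) * e"
    by (simp add: algebra_simps)
  finally show "norm (q_laplace q k d (\<lambda>\<tau>. h2 \<tau> m) x)
    \<le> (K0 * (2 * exp (ln q / (2 * k)) / b2) * pi + N2 * (2 / b2) * tb x * pi) / \<bar>qPi q k\<bar> * exp (- \<beta> * \<bar>m\<bar>)"
    unfolding F_def[symmetric] e_def[symmetric] by simp
qed

text \<open>The integrals along the direction of \<open>x\<close> below radius \<open>R\<close> coincide for the two pairs and cancel. If the
  normalising constant \<open>qPi\<close> were \<open>0\<close>, both transforms would be \<open>0\<close> by the convention for division.\<close>

lemma difference_bound:
  assumes P: "borel_pair d U S h1 h2" "borel_pair d' U' S' h1' h2'"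
    and eq: "\<And>u m. u \<in> U \<inter> U' \<Longrightarrow> h1 u m = h1' u m"
    and x: "x \<in> Rb d" "x \<in> Rb d'" and arc: "arc_sector x d d' \<subseteq> U \<inter> U'"
  shows "norm (q_laplace q k d' (\<lambda>\<tau>. h2' \<tau> m) x - q_laplace q k d (\<lambda>\<tau>. h2 \<tau> m) x)
    \<le> 2 * K1 / \<bar>qPi q k\<bar> * tb x * exp (- \<beta> * \<bar>m\<bar>)"
proof (cases "qPi q k = 0")
  case True
  then show ?thesis by (simp add: q_laplace_def)
next
  case False
  let ?I = "\<lambda>h. LINT r:{0<..R}|lborel. h (of_real r * cis (Arg x)) m / qTheta q k (of_real r * cis (Arg x) / x) / of_real r"
  have x0: "x \<noteq> 0" using x by (auto simp: Rb_def c(3))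
  have I: "?I h2 = ?I h2'"
  proof (rule set_lebesgue_integral_cong)
    show "\<forall>r. r \<in> {0<..R} \<longrightarrow> h2 (of_real r * cis (Arg x)) m / qTheta q k (of_real r * cis (Arg x) / x) / of_real r
      = h2' (of_real r * cis (Arg x)) m / qTheta q k (of_real r * cis (Arg x) / x) / of_real r"
    proof (intro allI impI)
      fix r assume r: "r \<in> {0<..R}"
      have s: "r / norm x > 0" "r / norm x * norm x < r0" using r x0 R_bounds by auto
      have "of_real r * cis (Arg x) = of_real (r / norm x) * x" using x0 by (simp add: cis_Arg sgn_eq)
      then show "h2 (of_real r * cis (Arg x)) m / qTheta q k (of_real r * cis (Arg x) / x) / of_real r
        = h2' (of_real r * cis (Arg x)) m / qTheta q k (of_real r * cis (Arg x) / x) / of_real r"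
        using agree_on_ray[OF P eq x arc s] by simp
    qed
  qed simp
  let ?L = "q_laplace q k d (\<lambda>\<tau>. h2 \<tau> m) x" and ?L' = "q_laplace q k d' (\<lambda>\<tau>. h2' \<tau> m) x"
  have "of_real (qPi q k) * (?L' - ?L) = (of_real (qPi q k) * ?L' - ?I h2') - (of_real (qPi q k) * ?L - ?I h2)"
    unfolding I by (simp add: algebra_simps)
  then have "norm (of_real (qPi q k) * (?L' - ?L))
    \<le> norm (of_real (qPi q k) * ?L' - ?I h2') + norm (of_real (qPi q k) * ?L - ?I h2)"
    by (simp only: norm_triangle_ineq4)
  also have "\<dots> \<le> K1 * tb x * exp (- \<beta> * \<bar>m\<bar>) + K1 * tb x * exp (- \<beta> * \<bar>m\<bar>)"
    by (intro add_mono distance_to_middle(1)[OF P(1) x(1) False] distance_to_middle(1)[OF P(2) x(2) False])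
  finally have "norm (?L' - ?L) * \<bar>qPi q k\<bar> \<le> 2 * (K1 * tb x * exp (- \<beta> * \<bar>m\<bar>))"
    by (simp only: norm_mult norm_of_real mult.commute mult_2)
  then have "norm (?L' - ?L) \<le> 2 * (K1 * tb x * exp (- \<beta> * \<bar>m\<bar>)) / \<bar>qPi q k\<bar>"
    using False by (subst pos_le_divide_eq) auto
  then show ?thesis by simp
qed

lemma transform_measurable:
  assumes P: "borel_pair d U S h1 h2" and x: "x \<in> Rb d"
  shows "(\<lambda>m. q_laplace q k d (\<lambda>\<tau>. h2 \<tau> m) x) \<in> borel_measurable lborel"
proof -
  have S: "unbounded_sector d S" using P by (auto simp: borel_pair_def)
  have x': "x \<noteq> 0" "Re (cis d / x) > - c * norm (cis d / x)" using x by (auto simp: Rb_def c(3))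
  have ray: "of_real r * cis d \<in> S" if "r > 0" for r
    by (rule unbounded_sector_props(2)[OF S unbounded_sector_props(3)[OF S] that])
  have cont: "continuous_on (S \<times> UNIV) (\<lambda>(u, m). h2 u m)" using P unfolding borel_pair_def by blast
  show ?thesis
  proof (rule q_laplace_measurable[OF q k x'(1)])
    show "of_real r * cis d / x \<notin> \<real>\<^sub>\<le>\<^sub>0" if "r > 0" for r
    proof -
      have "of_real r * cis d / x = of_real r * cis (Arg x + Arg (cis d / x)) / x"
        using cis_relative_angle[OF x'(1), of d] by simp
      also have "\<dots> = of_real (r / norm x) * cis (Arg (cis d / x))" by (rule polar_div[OF x'(1)])
      finally show ?thesis
        using off_negative_axis[OF relative_angle_cos(2)[OF x'(1) c(2) x'(2)], of "r / norm x"] that x'(1) by simp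
    qed
    show "continuous_on (UNIV \<times> {0<..}) (\<lambda>(m, r). h2 (of_real r * cis d) m)"
      unfolding case_prod_unfold
      by (rule continuous_on_compose2[OF cont[unfolded case_prod_unfold],
            of _ "\<lambda>p. (of_real (snd p) * cis d, fst p)", simplified])
        (use ray in \<open>auto intro!: continuous_intros\<close>)
  qed
qed

lemma inv_fourier_difference_bound:
  assumes P: "borel_pair d U S h1 h2" "borel_pair d' U' S' h1' h2'"
    and eq: "\<And>u m. u \<in> U \<inter> U' \<Longrightarrow> h1 u m = h1' u m"
    and x: "x \<in> Rb d" "x \<in> Rb d'" and arc: "arc_sector x d d' \<subseteq> U \<inter> U'"
    and b: "0 < \<beta>'" "\<beta>' < \<beta>" and z: "\<bar>Im z\<bar> < \<beta>'"
  shows "norm (inv_fourier (\<lambda>m. q_laplace q k d' (\<lambda>\<tau>. h2' \<tau> m) x) z - inv_fourier (\<lambda>m. q_laplace q k d (\<lambda>\<tau>. h2 \<tau> m) x) z)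
    \<le> 2 * K1 / \<bar>qPi q k\<bar> * (LINT m|lborel. exp (- (\<beta> - \<beta>') * \<bar>m\<bar>)) * tb x"
proof -
  have "norm (inv_fourier (\<lambda>m. q_laplace q k d' (\<lambda>\<tau>. h2' \<tau> m) x) z - inv_fourier (\<lambda>m. q_laplace q k d (\<lambda>\<tau>. h2 \<tau> m) x) z)
    \<le> 2 * K1 / \<bar>qPi q k\<bar> * tb x * (LINT m|lborel. exp (- (\<beta> - \<beta>') * \<bar>m\<bar>))"
    by (rule inv_fourier_diff_bound[OF b transform_measurable[OF P(2) x(2)] transform_measurable[OF P(1) x(1)]
          distance_to_middle(2)[OF P(2) x(2)] distance_to_middle(2)[OF P(1) x(1)]
          difference_bound[OF P eq x arc] z])
  then show ?thesis by (simp only: mult_ac)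
qed

text \<open>The function \<open>h1\<close> may belong to a space of smaller order \<open>\<kappa>'\<close>: for the forcing term of level one this is
  \<open>k1 \<le> \<kappa>\<close>.\<close>

lemma borel_pairI:
  assumes U: "unbounded_sector d U" "unbounded_sector d S" "S \<subseteq> R_set d \<delta>'" and \<mu>: "\<mu> \<ge> 0"
    and h1: "h1 \<in> Exp_disc_space U \<rho> \<delta> q \<kappa>' \<beta> \<mu> \<alpha>" "Exp_disc_norm U \<rho> \<delta> q \<kappa>' \<beta> \<mu> \<alpha> h1 \<le> n" "\<kappa>' \<le> \<kappa>"
    and B: "\<And>u. u \<in> U \<Longrightarrow> exp (\<kappa> * (ln (norm (u + of_real \<delta>)))\<^sup>2 / (2 * ln q) + \<alpha> * ln (norm (u + of_real \<delta>)))
      \<le> B * growth q \<kappa> \<alpha> (norm u)"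
    and n: "\<bar>n\<bar> * B \<le> N1"
    and h2: "h2 \<in> Exp_sect_space S (Rb d) q k \<beta> \<mu> \<nu>" "Exp_sect_norm S (Rb d) q k \<beta> \<mu> \<nu> h2 \<le> N2"
    and L: "\<And>u m. u \<in> Rb d \<Longrightarrow> h2 u m = q_laplace q \<kappa> d (\<lambda>v. h1 v m) u"
  shows "borel_pair d U S h1 h2"
proof -
  have p1: "(1 + \<bar>m\<bar>) powr - \<mu> \<le> 1" for m :: real
  proof -
    have "(1 + \<bar>m\<bar>) powr - \<mu> \<le> (1 + \<bar>m\<bar>) powr 0" using \<mu> by (intro powr_mono) auto
    then show ?thesis by (simp add: add_nonneg_eq_0_iff powr_zero_eq_one split: if_splits)
  qed
  have hol1: "(\<lambda>u. h1 u m) holomorphic_on U" for m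
    using h1(1) by (auto simp: Exp_disc_space_def Exp_gen_space_def intro: holomorphic_on_subset)
  have b1: "norm (h1 u m) \<le> N1 * growth q \<kappa> \<alpha> (norm u) * exp (- \<beta> * \<bar>m\<bar>)" if u: "u \<in> U" for u m
  proof -
    define y where "y = ln (norm (u + of_real \<delta>))"
    have g: "growth q \<kappa> \<alpha> (norm u) \<ge> 0" by (simp add: growth_def)
    have "norm (h1 u m) \<le> n * (1 + \<bar>m\<bar>) powr - \<mu> * exp (- \<beta> * \<bar>m\<bar>) * exp (\<kappa>' * y\<^sup>2 / (2 * ln q) + \<alpha> * y)"
      unfolding y_def by (rule Exp_gen_bound[OF h1(1)[unfolded Exp_disc_space_def] h1(2)[unfolded Exp_disc_norm_def]])
        (use u in \<open>simp add: disc_dom_def\<close>)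
    also have "\<dots> \<le> \<bar>n\<bar> * 1 * exp (- \<beta> * \<bar>m\<bar>) * (B * growth q \<kappa> \<alpha> (norm u))"
    proof (intro mult_mono p1 order_refl)
      have "exp (\<kappa>' * y\<^sup>2 / (2 * ln q) + \<alpha> * y) \<le> exp (\<kappa> * y\<^sup>2 / (2 * ln q) + \<alpha> * y)"
        using h1(3) q by (simp add: divide_right_mono mult_right_mono)
      also have "\<dots> \<le> B * growth q \<kappa> \<alpha> (norm u)" unfolding y_def by (rule B[OF u])
      finally show "exp (\<kappa>' * y\<^sup>2 / (2 * ln q) + \<alpha> * y) \<le> B * growth q \<kappa> \<alpha> (norm u)" .
    qed auto
    also have "\<dots> = (\<bar>n\<bar> * B) * growth q \<kappa> \<alpha> (norm u) * exp (- \<beta> * \<bar>m\<bar>)" by simp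
    also have "\<dots> \<le> N1 * growth q \<kappa> \<alpha> (norm u) * exp (- \<beta> * \<bar>m\<bar>)"
      using g by (intro mult_right_mono n) auto
    finally show ?thesis .
  qed
  have sub: "S \<subseteq> sect_dom S (Rb d)" by (auto simp: sect_dom_def)
  have c2: "continuous_on (S \<times> UNIV) (\<lambda>(u, m). h2 u m)"
    using h2(1) sub by (auto simp: Exp_sect_space_def Exp_gen_space_def intro: continuous_on_subset)
  have hol2: "(\<lambda>u. h2 u m) holomorphic_on S \<union> Rb d" for m
    using h2(1) by (simp add: Exp_sect_space_def Exp_gen_space_def)
  have b2: "norm (h2 u m) \<le> N2 * exp (k * (ln (norm u))\<^sup>2 / (2 * ln q) + \<nu> * ln (norm u)) * exp (- \<beta> * \<bar>m\<bar>)" if u: "u \<in> S" for u m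
  proof -
    have "norm (h2 u m) \<le> N2 * (1 + \<bar>m\<bar>) powr - \<mu> * exp (- \<beta> * \<bar>m\<bar>)
      * exp (k * (ln (norm (u + of_real 0)))\<^sup>2 / (2 * ln q) + \<nu> * ln (norm (u + of_real 0)))"
      by (rule Exp_gen_bound[OF h2(1)[unfolded Exp_sect_space_def] h2(2)[unfolded Exp_sect_norm_def]]) (use u sub in blast)
    also have "\<dots> \<le> N2 * 1 * exp (- \<beta> * \<bar>m\<bar>)
      * exp (k * (ln (norm (u + of_real 0)))\<^sup>2 / (2 * ln q) + \<nu> * ln (norm (u + of_real 0)))"
      by (intro mult_right_mono mult_left_mono p1 N) auto
    finally show ?thesis by (simp add: mult_ac)
  qed
  show ?thesis unfolding borel_pair_def using U hol1 b1 c2 hol2 b2 L by blast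
qed

end

section \<open>The flat difference of neighbouring solutions\<close>

theorem proposition13:
  fixes q :: real and k1 k2 D dD :: nat and \<kappa> :: real
    and I :: "nat \<Rightarrow> nat set" and dl :: "nat \<Rightarrow> nat" and d \<Delta> :: "nat \<Rightarrow> nat \<Rightarrow> nat"
    and Q :: "complex poly" and R :: "nat \<Rightarrow> complex poly"
    and rQR dQR \<eta>QR \<beta> \<beta>' \<mu> \<epsilon>0 \<rho> CF :: real
    and C :: "nat \<Rightarrow> nat \<Rightarrow> real \<Rightarrow> complex \<Rightarrow> complex" and Ct :: "nat \<Rightarrow> nat \<Rightarrow> real"
    and F :: "nat \<Rightarrow> real \<Rightarrow> complex \<Rightarrow> complex"
    and \<sigma> :: nat and E :: "nat \<Rightarrow> complex set"
    and dir :: "nat \<Rightarrow> real" and U S Rb :: "nat \<Rightarrow> complex set" and \<T> :: "complex set"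
    and \<delta> \<delta>' rT \<alpha> \<nu> \<zeta> \<zeta>2 r0 :: real
    and rts :: "nat \<Rightarrow> real \<Rightarrow> complex"
    and \<psi>1 \<psi>2 w1 w2 :: "nat \<Rightarrow> complex \<Rightarrow> real \<Rightarrow> complex \<Rightarrow> complex"
    and \<gamma> :: "nat \<Rightarrow> complex \<Rightarrow> real"
    and u f :: "nat \<Rightarrow> complex \<Rightarrow> complex \<Rightarrow> complex \<Rightarrow> complex"
    and p :: nat
  assumes
    \<comment> \<open>data of the equation\<close>
    "q > 1" and "1 \<le> k1" and "k1 < k2" and "D \<ge> 3" and "dD \<ge> 1"
    and "1 / \<kappa> = 1 / real k1 - 1 / real k2"
    and "\<forall>l\<in>{1..D-1}. finite (I l) \<and> I l \<noteq> {} \<and> dl l \<ge> 1"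
    and "\<forall>l\<in>{1..D-1}. \<forall>j\<in>I l. d j l \<ge> 1"
    and "dl 1 = 1" and "\<forall>l\<in>{1..D-2}. dl l < dl (l + 1)"
    and "\<forall>l\<in>{1..D-1}. \<forall>j\<in>I l. \<Delta> j l \<ge> d j l
           \<and> real (d j l) / real k2 + 1 \<ge> real (dl l)
           \<and> (real dD - 1) / real k2 + 1 \<ge> real (dl l)"
    and "degree Q \<ge> degree (R D)" and "\<forall>l\<in>{1..D-1}. degree (R D) \<ge> degree (R l)"
    and "\<forall>m::real. poly Q (\<i> * complex_of_real m) \<noteq> 0"
    and "\<forall>m::real. poly (R D) (\<i> * complex_of_real m) \<noteq> 0"
    and "rQR > 0" and "\<eta>QR > 0"
    and "\<forall>m::real. poly Q (\<i> * complex_of_real m) / poly (R D) (\<i> * complex_of_real m)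
           \<in> {complex_of_real r * cis \<theta> | r \<theta>. r \<ge> rQR \<and> \<bar>\<theta> - dQR\<bar> \<le> \<eta>QR}"
    and "\<beta> > 0" and "\<mu> > real (degree (R D)) + 1" and "0 < \<beta>'" and "\<beta>' < \<beta>"
    and "\<rho> > 0"
    and "\<forall>l\<in>{1..D-1}. \<forall>j\<in>I l. \<forall>\<epsilon>\<in>ball 0 \<epsilon>0.
           (\<lambda>m. C j l m \<epsilon>) \<in> E_space \<beta> \<mu> \<and> E_norm \<beta> \<mu> (\<lambda>m. C j l m \<epsilon>) \<le> Ct j l"
    and "\<forall>l\<in>{1..D-1}. \<forall>j\<in>I l. \<forall>m. (\<lambda>\<epsilon>. C j l m \<epsilon>) holomorphic_on ball 0 \<epsilon>0"
    and "\<forall>n. \<forall>\<epsilon>\<in>ball 0 \<epsilon>0. (\<lambda>m. F n m \<epsilon>) \<in> E_space \<beta> \<mu>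
           \<and> E_norm \<beta> \<mu> (\<lambda>m. F n m \<epsilon>)
               \<le> CF * (1 / \<rho>) ^ n * q powr (real n * (real n - 1) / (2 * real k1))"
    and "\<forall>n m. (\<lambda>\<epsilon>. F n m \<epsilon>) holomorphic_on ball 0 \<epsilon>0"
    \<comment> \<open>good covering and associated family\<close>
    and "good_covering \<sigma> \<epsilon>0 E"
    and "\<forall>p<\<sigma>. unbounded_sector (dir p) (U p) \<and> unbounded_sector (dir p) (S p)"
    and "\<delta> > 0" and "\<forall>p<\<sigma>. infdist (- complex_of_real \<delta>) (U p \<union> ball 0 \<rho>) > 0"
    and "\<delta>' > 0" and "bounded_sector rT \<T>"
    and "\<forall>p<\<sigma>. Rb p = R_set (dir p) \<delta>' \<inter> ball 0 (\<epsilon>0 * rT) \<and> Rb p \<subseteq> cball 0 \<rho>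
           \<and> S p \<subseteq> R_set (dir p) \<delta>'"
    and "0 < \<epsilon>0" and "\<epsilon>0 < 1" and "0 < rT" and "rT < 1" and "\<alpha> > 0"
    and "\<nu> + real k2 / ln q * ln rT < 0"
    and "\<alpha> + \<kappa> / ln q * ln (\<epsilon>0 * rT) < 0"
    and "\<epsilon>0 * rT \<le> q powr ((1 / 2 - \<nu>) / real k2) / 2"
    and "\<forall>m. bij_betw (\<lambda>l. rts l m) {..<dD}
           {\<tau>. poly Q (\<i> * complex_of_real m) / complex_of_real (qc q k2 k2)
                - poly (R D) (\<i> * complex_of_real m) / complex_of_real (qc q k2 (dD + k2)) * \<tau> ^ dD = 0}"
    and "\<exists>M1>0. \<forall>l<dD. \<forall>m. \<forall>p<\<sigma>. \<forall>\<tau>\<in>S p \<union> cball 0 \<rho>.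
           cmod (\<tau> - rts l m) \<ge> M1 * (1 + cmod \<tau>)"
    and "\<exists>M2>0. \<exists>l0<dD. \<forall>m. \<forall>p<\<sigma>. \<forall>\<tau>\<in>S p \<union> cball 0 \<rho>.
           cmod (\<tau> - rts l0 m) \<ge> M2 * cmod (rts l0 m)"
    and "\<forall>p<\<sigma>. Rb p \<inter> Rb (Suc p mod \<sigma>) \<noteq> {}"
    and "\<forall>p<\<sigma>. \<forall>t\<in>\<T>. \<forall>\<epsilon>\<in>E p. \<epsilon> * t \<in> Rb p"
    \<comment> \<open>forcing term\<close>
    and "\<forall>p<\<sigma>. \<forall>\<epsilon>\<in>ball 0 \<epsilon>0. \<forall>m. \<forall>\<tau>\<in>ball 0 \<rho>.
           (\<lambda>n. F n m \<epsilon> * \<tau> ^ n / complex_of_real (qc q k1 n)) sums \<psi>1 p \<tau> m \<epsilon>"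
    and "\<forall>p<\<sigma>. \<forall>\<epsilon>\<in>ball 0 \<epsilon>0.
           (\<lambda>\<tau> m. \<psi>1 p \<tau> m \<epsilon>) \<in> Exp_disc_space (U p) \<rho> \<delta> q k1 \<beta> \<mu> \<alpha>
           \<and> Exp_disc_norm (U p) \<rho> \<delta> q k1 \<beta> \<mu> \<alpha> (\<lambda>\<tau> m. \<psi>1 p \<tau> m \<epsilon>) \<le> \<zeta>"
    and "\<forall>p \<tau> m \<epsilon>. \<psi>2 p \<tau> m \<epsilon> = q_laplace q \<kappa> (dir p) (\<lambda>h. \<psi>1 p h m \<epsilon>) \<tau>"
    and "\<forall>p<\<sigma>. \<forall>\<epsilon>\<in>ball 0 \<epsilon>0.
           (\<lambda>\<tau> m. \<psi>2 p \<tau> m \<epsilon>) \<in> Exp_sect_space (S p) (Rb p) q k2 \<beta> \<mu> \<nu>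
           \<and> Exp_sect_norm (S p) (Rb p) q k2 \<beta> \<mu> \<nu> (\<lambda>\<tau> m. \<psi>2 p \<tau> m \<epsilon>) \<le> \<zeta>2"
    and "\<forall>p t z \<epsilon>. f p t z \<epsilon> =
           inv_fourier (\<lambda>m. q_laplace q k2 (dir p) (\<lambda>\<tau>. \<psi>2 p \<tau> m \<epsilon>) (\<epsilon> * t)) z"
    \<comment> \<open>construction of the solutions\<close>
    and "r0 > 0"
    and "\<forall>p<\<sigma>. \<forall>\<epsilon>\<in>ball 0 \<epsilon>0.
           (let Sol = {w. w \<in> Exp_disc_space (U p) \<rho> \<delta> q \<kappa> \<beta> \<mu> \<alpha>
                  \<and> Exp_disc_norm (U p) \<rho> \<delta> q \<kappa> \<beta> \<mu> \<alpha> w \<le> r0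
                  \<and> aux_equation (disc_dom (U p) \<rho>) q k1 (- real dD / \<kappa>) Q R D dD I dl d \<Delta> C \<epsilon>
                       (\<lambda>\<tau> m. \<psi>1 p \<tau> m \<epsilon>) w}
            in (\<lambda>\<tau> m. w1 p \<tau> m \<epsilon>) \<in> Sol
               \<and> (\<forall>w\<in>Sol. \<forall>\<tau>\<in>disc_dom (U p) \<rho>. \<forall>m. w \<tau> m = w1 p \<tau> m \<epsilon>))"
    and "\<forall>p<\<sigma>. \<forall>\<epsilon>\<in>ball 0 \<epsilon>0.
           (let Sol = {w. w \<in> Exp_sect_space (S p) (Rb p) q k2 \<beta> \<mu> \<nu>
                  \<and> aux_equation (sect_dom (S p) (Rb p)) q k2 0 Q R D dD I dl d \<Delta> C \<epsilon>
                       (\<lambda>\<tau> m. \<psi>2 p \<tau> m \<epsilon>) w}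
            in (\<lambda>\<tau> m. w2 p \<tau> m \<epsilon>) \<in> Sol
               \<and> (\<forall>w\<in>Sol. \<forall>\<tau>\<in>sect_dom (S p) (Rb p). \<forall>m. w \<tau> m = w2 p \<tau> m \<epsilon>)
               \<and> Exp_sect_norm (S p) (Rb p) q k2 \<beta> \<mu> \<nu> (\<lambda>\<tau> m. w2 p \<tau> m \<epsilon>) \<le> r0)"
    and "\<forall>p<\<sigma>. \<forall>m. \<forall>\<tau>\<in>disc_dom (U p) \<rho>. (\<lambda>\<epsilon>. w1 p \<tau> m \<epsilon>) holomorphic_on ball 0 \<epsilon>0"
    and "\<forall>p<\<sigma>. \<forall>m. \<forall>\<tau>\<in>sect_dom (S p) (Rb p). (\<lambda>\<epsilon>. w2 p \<tau> m \<epsilon>) holomorphic_on ball 0 \<epsilon>0"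
    and "\<forall>p<\<sigma>. \<forall>\<epsilon>\<in>ball 0 \<epsilon>0. \<forall>m. \<forall>\<tau>\<in>Rb p.
           w2 p \<tau> m \<epsilon> = q_laplace q \<kappa> (dir p) (\<lambda>h. w1 p h m \<epsilon>) \<tau>"
    \<comment> \<open>the half-line of direction \<open>\<gamma> p (\<epsilon> * t)\<close> lies in \<open>S p\<close>, and neither it nor the sector between
        it and the bisector of \<open>S p\<close> meets the zeros of the Theta kernel\<close>
    and "\<forall>p<\<sigma>. \<forall>t\<in>\<T>. \<forall>\<epsilon>\<in>E p.
           arc_sector (\<epsilon> * t) (dir p) (\<gamma> p (\<epsilon> * t)) \<subseteq> S p \<and> cis (\<gamma> p (\<epsilon> * t)) \<noteq> - sgn (\<epsilon> * t)"
    and "\<forall>p t z \<epsilon>. u p t z \<epsilon> =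
           inv_fourier (\<lambda>m. q_laplace q k2 (\<gamma> p (\<epsilon> * t)) (\<lambda>\<tau>. w2 p \<tau> m \<epsilon>) (\<epsilon> * t)) z"
    \<comment> \<open>hypotheses of the proposition\<close>
    and "p < \<sigma>"
    and "\<forall>t\<in>\<T>. \<forall>\<epsilon>\<in>E p \<inter> E (Suc p mod \<sigma>).
           arc_sector (\<epsilon> * t) (dir p) (dir (Suc p mod \<sigma>)) \<subseteq> U p \<inter> U (Suc p mod \<sigma>)"
  shows "\<exists>K1>0. \<exists>K2::real. \<forall>t\<in>\<T>. \<forall>z. \<bar>Im z\<bar> < \<beta>' \<longrightarrow> (\<forall>\<epsilon>\<in>E p \<inter> E (Suc p mod \<sigma>).
           cmod (u (Suc p mod \<sigma>) t z \<epsilon> - u p t z \<epsilon>)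
             \<le> K1 * exp (- (real k2 / (2 * ln q)) * (ln (cmod \<epsilon>))\<^sup>2) * cmod \<epsilon> powr K2
         \<and> cmod (f (Suc p mod \<sigma>) t z \<epsilon> - f p t z \<epsilon>)
             \<le> K1 * exp (- (real k2 / (2 * ln q)) * (ln (cmod \<epsilon>))\<^sup>2) * cmod \<epsilon> powr K2)"
proof -
  define p' where "p' = Suc p mod \<sigma>"
  have "\<sigma> \<ge> 2" using assms(28) by (simp add: good_covering_def)
  then have p': "p' < \<sigma>" by (simp add: p'_def)
  have p: "p < \<sigma>" by (rule assms(61))
  have k: "real k1 > 0" "real k2 > 0" "real k1 < real k2" using assms(2,3) by auto
  have "1 / \<kappa> > 0" using k unfolding assms(6) by (simp add: frac_less2)
  then have \<kappa>: "\<kappa> > 0" by simp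
  have k1\<kappa>: "real k1 \<le> \<kappa>"
  proof -
    have "1 / \<kappa> \<le> 1 / real k1" unfolding assms(6) using k by simp
    then show ?thesis using \<kappa> k by (simp add: field_simps)
  qed
  have sec: "unbounded_sector (dir i) (U i)" "unbounded_sector (dir i) (S i)" "S i \<subseteq> R_set (dir i) \<delta>'"
    "Rb i = R_set (dir i) \<delta>' \<inter> ball 0 (\<epsilon>0 * rT)" if "i < \<sigma>" for i
    using assms(29,34) that by auto
  \<comment> \<open>The sets \<open>R_set\<close> are not empty, and the parameter 0 of the ray gives distance 1.\<close>
  have d1: "\<delta>' < 1"
  proof -
    have "cis (dir p) \<in> R_set (dir p) \<delta>'" using unbounded_sector_props(3)[OF sec(2)[OF p]] sec(3)[OF p] by blast
    then have "norm (1 + cis (dir p) * of_real 0 / cis (dir p)) > \<delta>'" unfolding R_set_def by blast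
    then show ?thesis by simp
  qed
  obtain c where c: "0 \<le> c" "c < 1" "\<And>d. R_set d \<delta>' = {T. T \<noteq> 0 \<and> Re (cis d / T) > - c * norm (cis d / T)}"
    using R_set_angle[OF assms(32) d1] by blast
  have \<mu>: "\<mu> \<ge> 0" "\<mu> \<ge> real (degree (R D))" using assms(20) by auto
  have shift: "\<exists>B>0. \<forall>u\<in>U i \<union> ball 0 \<rho>. exp (\<kappa> * (ln (norm (u + of_real \<delta>)))\<^sup>2 / (2 * ln q) + \<alpha> * ln (norm (u + of_real \<delta>)))
      \<le> B * growth q \<kappa> \<alpha> (norm u)" if "i < \<sigma>" for i
    using shifted_weight_le_growth[OF assms(1) \<kappa> assms(39,30) assms(31)[rule_format, OF that]] by metis
  obtain B0 where B0: "B0 > 0" "\<And>u. u \<in> U p \<union> ball 0 \<rho> \<Longrightarrow> exp (\<kappa> * (ln (norm (u + of_real \<delta>)))\<^sup>2 / (2 * ln q) + \<alpha> * ln (norm (u + of_real \<delta>)))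
      \<le> B0 * growth q \<kappa> \<alpha> (norm u)" using shift[OF p] by blast
  obtain B1 where B1: "B1 > 0" "\<And>u. u \<in> U p' \<union> ball 0 \<rho> \<Longrightarrow> exp (\<kappa> * (ln (norm (u + of_real \<delta>)))\<^sup>2 / (2 * ln q) + \<alpha> * ln (norm (u + of_real \<delta>)))
      \<le> B1 * growth q \<kappa> \<alpha> (norm u)" using shift[OF p'] by blast
  define B where "B = max B0 B1"
  have B: "B > 0" "exp (\<kappa> * (ln (norm (u + of_real \<delta>)))\<^sup>2 / (2 * ln q) + \<alpha> * ln (norm (u + of_real \<delta>)))
      \<le> B * growth q \<kappa> \<alpha> (norm u)" if "i = p \<or> i = p'" "u \<in> U i \<union> ball 0 \<rho>" for i u
  proof -
    show "B > 0" using B0 by (auto simp: B_def)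
    have "b * growth q \<kappa> \<alpha> (norm u) \<le> B * growth q \<kappa> \<alpha> (norm u)" if "b = B0 \<or> b = B1" for b
      using that by (intro mult_right_mono) (auto simp: B_def growth_def)
    then show "exp (\<kappa> * (ln (norm (u + of_real \<delta>)))\<^sup>2 / (2 * ln q) + \<alpha> * ln (norm (u + of_real \<delta>)))
      \<le> B * growth q \<kappa> \<alpha> (norm u)"
      using that B0(2)[of u] B1(2)[of u] by (metis order_trans)
  qed
  have Bpos: "B > 0" using B0 by (auto simp: B_def)
  define N1 where "N1 = (\<bar>r0\<bar> + \<bar>\<zeta>\<bar>) * B"
  define N2 where "N2 = \<bar>r0\<bar> + \<bar>\<zeta>2\<bar>"
  have rr: "0 < \<epsilon>0 * rT" "\<epsilon>0 * rT \<le> 1" "\<epsilon>0 * rT \<le> rT"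
    using assms(35-38) by (auto simp: mult_le_one mult_left_le_one_le)
  interpret L: two_levels q \<kappa> "real k2" \<alpha> \<nu> \<beta> "\<epsilon>0 * rT" \<delta>' N1 N2 c
  proof
    have "ln (\<epsilon>0 * rT) \<le> ln rT" using rr(1,3) assms(37) by (subst ln_le_cancel_iff) auto
    then have "real k2 / ln q * ln (\<epsilon>0 * rT) \<le> real k2 / ln q * ln rT"
      using assms(1) by (intro mult_left_mono) auto
    then show "\<nu> + real k2 / ln q * ln (\<epsilon>0 * rT) \<le> 0" using assms(40) by linarith
    show "N1 \<ge> 0" "N2 \<ge> 0" using Bpos by (auto simp: N1_def N2_def)
  qed (use assms(1,32,41) k \<kappa> rr d1 c in auto)
  have LRb: "L.Rb (dir i) = Rb i" if "i < \<sigma>" for i unfolding L.Rb_def using sec(4)[OF that] by simp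
  have w1: "(\<lambda>\<tau> m. w1 i \<tau> m \<epsilon>) \<in> Exp_disc_space (U i) \<rho> \<delta> q \<kappa> \<beta> \<mu> \<alpha>"
    "Exp_disc_norm (U i) \<rho> \<delta> q \<kappa> \<beta> \<mu> \<alpha> (\<lambda>\<tau> m. w1 i \<tau> m \<epsilon>) \<le> r0"
    "aux_equation (disc_dom (U i) \<rho>) q k1 (- real dD / \<kappa>) Q R D dD I dl d \<Delta> C \<epsilon> (\<lambda>\<tau> m. \<psi>1 i \<tau> m \<epsilon>) (\<lambda>\<tau> m. w1 i \<tau> m \<epsilon>)"
    if "i < \<sigma>" "\<epsilon> \<in> ball 0 \<epsilon>0" for i \<epsilon>
    using assms(54)[rule_format, OF that] unfolding Let_def by auto
  have w2: "(\<lambda>\<tau> m. w2 i \<tau> m \<epsilon>) \<in> Exp_sect_space (S i) (Rb i) q k2 \<beta> \<mu> \<nu>"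
    "Exp_sect_norm (S i) (Rb i) q k2 \<beta> \<mu> \<nu> (\<lambda>\<tau> m. w2 i \<tau> m \<epsilon>) \<le> r0"
    if "i < \<sigma>" "\<epsilon> \<in> ball 0 \<epsilon>0" for i \<epsilon>
    using assms(55)[rule_format, OF that] unfolding Let_def by auto
  have r0N: "\<bar>r0\<bar> * B \<le> N1" "\<bar>\<zeta>\<bar> * B \<le> N1" "r0 \<le> N2" "\<zeta>2 \<le> N2"
    using Bpos by (auto simp: N1_def N2_def intro: mult_right_mono)
  have pairw: "L.borel_pair (dir i) (U i) (S i) (\<lambda>\<tau> m. w1 i \<tau> m \<epsilon>) (\<lambda>\<tau> m. w2 i \<tau> m \<epsilon>)"
    if i: "i < \<sigma>" "i = p \<or> i = p'" and e: "\<epsilon> \<in> ball 0 \<epsilon>0" for i \<epsilon>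
    by (rule L.borel_pairI[OF sec(1-3)[OF i(1)] \<mu>(1) w1(1,2)[OF i(1) e] order_refl B(2)[OF i(2)] r0N(1)])
      (use w2[OF i(1) e] LRb[OF i(1)] r0N(3) assms(58) i e in auto)
  have pairf: "L.borel_pair (dir i) (U i) (S i) (\<lambda>\<tau> m. \<psi>1 i \<tau> m \<epsilon>) (\<lambda>\<tau> m. \<psi>2 i \<tau> m \<epsilon>)"
    if i: "i < \<sigma>" "i = p \<or> i = p'" and e: "\<epsilon> \<in> ball 0 \<epsilon>0" for i \<epsilon>
    by (rule L.borel_pairI[OF sec(1-3)[OF i(1)] \<mu>(1) assms(49)[rule_format, OF i(1) e, THEN conjunct1]
          assms(49)[rule_format, OF i(1) e, THEN conjunct2] k1\<kappa> B(2)[OF i(2)] r0N(2)])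
      (use assms(51)[rule_format, OF i(1) e] LRb[OF i(1)] r0N(4) assms(50) i e in auto)
  have hol1: "(\<lambda>\<tau>. w1 i \<tau> m \<epsilon>) holomorphic_on U i \<union> ball 0 \<rho>" "(\<lambda>\<tau>. \<psi>1 i \<tau> m \<epsilon>) holomorphic_on U i \<union> ball 0 \<rho>"
    if "i < \<sigma>" "\<epsilon> \<in> ball 0 \<epsilon>0" for i m \<epsilon>
    using w1(1)[OF that] assms(49)[rule_format, OF that] by (simp_all add: Exp_disc_space_def Exp_gen_space_def)
  have cone: "open (U i)" "\<And>u r. u \<in> U i \<Longrightarrow> r > 0 \<Longrightarrow> of_real r * u \<in> U i" if "i < \<sigma>" for i
    using unbounded_sector_props[OF sec(1)[OF that]] by auto
  have \<psi>disc: "\<psi>1 p \<tau> m \<epsilon> = \<psi>1 p' \<tau> m \<epsilon>" if "\<epsilon> \<in> ball 0 \<epsilon>0" "\<tau> \<in> ball 0 \<rho>" for \<tau> m \<epsilon>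
    using assms(48)[rule_format, OF p that(1) that(2), of m] assms(48)[rule_format, OF p' that(1) that(2), of m]
    by (rule sums_unique2)
  have \<psi>eq: "\<psi>1 p u m \<epsilon> = \<psi>1 p' u m \<epsilon>" if e: "\<epsilon> \<in> ball 0 \<epsilon>0" and u: "u \<in> U p \<inter> U p'" for u m \<epsilon>
    by (rule holomorphic_eq_disc_cone[OF hol1(2)[OF p e] hol1(2)[OF p' e] cone[OF p] cone[OF p'] assms(23) order_refl])
      (use \<psi>disc[OF e] u in auto)
  have weq: "w1 p u m \<epsilon> = w1 p' u m \<epsilon>" if e: "\<epsilon> \<in> ball 0 \<epsilon>0" and u: "u \<in> U p \<inter> U p'" for u m \<epsilon>
  proof -
    \<comment> \<open>Within the unit disc the growth weight is 1.\<close>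
    define \<rho>1 where "\<rho>1 = min \<rho> 1"
    have \<rho>1: "0 < \<rho>1" "\<rho>1 \<le> \<rho>" "\<rho>1 \<le> 1" using assms(23) by (auto simp: \<rho>1_def)
    have b1: "ball 0 \<rho>1 \<subseteq> disc_dom (U i) \<rho>" for i using \<rho>1 by (auto simp: disc_dom_def)
    obtain Kp where Kp: "Kp > 0" "\<And>m. norm (poly (R D) (\<i> * of_real m)) \<le> Kp * (1 + \<bar>m\<bar>) ^ degree (R D)"
      using poly_imag_bound[of "R D"] by blast
    have "\<forall>l\<in>{1..D-1}. \<exists>K>0. \<forall>m. norm (poly (R l) (\<i> * of_real m)) \<le> K * norm (poly (R D) (\<i> * of_real m))"
      using assms(13,15) by (auto intro!: poly_ratio_bounded)
    then obtain Kl where Kl: "\<And>l m. l \<in> {1..D-1} \<Longrightarrow> norm (poly (R l) (\<i> * of_real m)) \<le> Kl l * norm (poly (R D) (\<i> * of_real m))"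
      by metis
    have Qb: "rQR * norm (poly (R D) (\<i> * of_real m)) \<le> norm (poly Q (\<i> * of_real m))" for m
    proof -
      obtain r \<theta> where r: "poly Q (\<i> * of_real m) / poly (R D) (\<i> * of_real m) = of_real r * cis \<theta>" "r \<ge> rQR"
        using assms(18) by blast
      have "norm (poly Q (\<i> * of_real m)) / norm (poly (R D) (\<i> * of_real m)) = r"
        unfolding norm_divide[symmetric] r(1) using r(2) assms(16) by (simp add: norm_mult)
      then have "norm (poly Q (\<i> * of_real m)) = r * norm (poly (R D) (\<i> * of_real m))"
        using assms(15) by (auto simp: field_simps)
      then show ?thesis using r(2) by (simp add: mult_right_mono)
    qed
    have bw: "norm (poly (R D) (\<i> * of_real m)) * norm (w1 i \<tau> m \<epsilon>) \<le> Kp * (r0 * B)"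
      if i: "i < \<sigma>" "i = p \<or> i = p'" and t: "\<tau> \<in> ball 0 \<rho>1" for i \<tau> m
    proof -
      have t': "\<tau> \<in> disc_dom (U i) \<rho>" "\<tau> \<in> U i \<union> ball 0 \<rho>" using subsetD[OF b1 t] t \<rho>1 by auto
      have g1: "growth q \<kappa> \<alpha> (norm \<tau>) = 1"
      proof (cases "\<tau> = 0")
        case True then show ?thesis by (simp add: growth_def)
      next
        case False
        then have "ln (norm \<tau>) \<le> 0" using t \<rho>1 by (simp add: ln_le_zero_iff)
        then show ?thesis by (simp add: growth_def max_def)
      qed
      have "norm (w1 i \<tau> m \<epsilon>) \<le> r0 * (1 + \<bar>m\<bar>) powr - \<mu> * exp (- \<beta> * \<bar>m\<bar>)
        * exp (\<kappa> * (ln (norm (\<tau> + of_real \<delta>)))\<^sup>2 / (2 * ln q) + \<alpha> * ln (norm (\<tau> + of_real \<delta>)))"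
        by (rule Exp_gen_bound[OF w1(1)[OF i(1) e, unfolded Exp_disc_space_def] w1(2)[OF i(1) e, unfolded Exp_disc_norm_def] t'(1)])
      also have "\<dots> \<le> r0 * (1 + \<bar>m\<bar>) powr - \<mu> * 1 * B"
        using B(2)[OF i(2) t'(2)] assms(19,53) unfolding g1 by (intro mult_mono) auto
      finally have w: "norm (w1 i \<tau> m \<epsilon>) \<le> (1 + \<bar>m\<bar>) powr - \<mu> * (r0 * B)" by (simp add: mult_ac)
      have "norm (poly (R D) (\<i> * of_real m)) \<le> Kp * (1 + \<bar>m\<bar>) powr \<mu>"
      proof -
        have "(1 + \<bar>m\<bar>) ^ degree (R D) = (1 + \<bar>m\<bar>) powr real (degree (R D))" by (simp add: powr_realpow)
        also have "\<dots> \<le> (1 + \<bar>m\<bar>) powr \<mu>" using \<mu> by (intro powr_mono) auto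
        finally show ?thesis using Kp(1) order_trans[OF Kp(2)[of m]] by (simp add: mult_left_mono)
      qed
      then have "norm (poly (R D) (\<i> * of_real m)) * norm (w1 i \<tau> m \<epsilon>)
        \<le> (Kp * (1 + \<bar>m\<bar>) powr \<mu>) * ((1 + \<bar>m\<bar>) powr - \<mu> * (r0 * B))"
        using Kp(1) by (intro mult_mono w) auto
      also have "\<dots> = Kp * (r0 * B) * ((1 + \<bar>m\<bar>) powr \<mu> * (1 + \<bar>m\<bar>) powr - \<mu>)" by (simp only: mult_ac)
      also have "(1 + \<bar>m\<bar>) powr \<mu> * (1 + \<bar>m\<bar>) powr - \<mu> = 1" by (simp add: powr_add[symmetric])
      finally show ?thesis by simp
    qed
    have cw: "continuous_on UNIV (\<lambda>m. w1 i \<tau> m \<epsilon>)" if i: "i < \<sigma>" and t: "\<tau> \<in> ball 0 \<rho>1" for i \<tau>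
    proof -
      have "continuous_on (disc_dom (U i) \<rho> \<times> UNIV) (\<lambda>(\<tau>, m). w1 i \<tau> m \<epsilon>)"
        using w1(1)[OF i e] by (simp add: Exp_disc_space_def Exp_gen_space_def)
      moreover have "continuous_on UNIV (\<lambda>m::real. (\<tau>, m))" by (intro continuous_intros)
      moreover have "range (\<lambda>m::real. (\<tau>, m)) \<subseteq> disc_dom (U i) \<rho> \<times> UNIV" using subsetD[OF b1 t] by auto
      ultimately have "continuous_on UNIV (\<lambda>m. case (\<tau>, m) of (\<tau>, m) \<Rightarrow> w1 i \<tau> m \<epsilon>)"
        by (rule continuous_on_compose2)
      then show ?thesis by simp
    qed
    have dl: "real (dl l) - real (d j l) / real k1 - 1 \<le> 0" if "l \<in> {1..D-1}" "j \<in> I l" for l j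
    proof -
      have "real (d j l) / real k2 \<le> real (d j l) / real k1" using k by (intro divide_left_mono) auto
      moreover have "real (d j l) / real k2 + 1 \<ge> real (dl l)" using assms(11) that by blast
      ultimately show ?thesis by linarith
    qed
    have eps: "norm \<epsilon> \<le> 1" using e assms(36) by simp
    have Cc: "continuous_on UNIV (\<lambda>m. C j l m \<epsilon>)" "norm (C j l m \<epsilon>) \<le> Ct j l * exp (- \<beta> * \<bar>m\<bar>)"
      if "l \<in> {1..D-1}" "j \<in> I l" for j l m
    proof -
      have C: "(\<lambda>m. C j l m \<epsilon>) \<in> E_space \<beta> \<mu>" "E_norm \<beta> \<mu> (\<lambda>m. C j l m \<epsilon>) \<le> Ct j l"
        using assms(24) that e by blast+
      show "continuous_on UNIV (\<lambda>m. C j l m \<epsilon>)" using C(1) by (simp add: E_space_def)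
      show "norm (C j l m \<epsilon>) \<le> Ct j l * exp (- \<beta> * \<bar>m\<bar>)" by (rule E_space_bound[OF C \<mu>(1)])
    qed
    have e0: "- real dD / \<kappa> \<le> 0" using \<kappa> by simp
    have \<psi>\<rho>1: "\<psi>1 p \<tau> m \<epsilon> = \<psi>1 p' \<tau> m \<epsilon>" if "\<tau> \<in> ball 0 \<rho>1" for \<tau> m
      using \<psi>disc[OF e] that \<rho>1 by simp
    have "\<exists>r>0. \<forall>\<tau> m. \<tau> \<noteq> 0 \<longrightarrow> norm \<tau> \<le> r \<longrightarrow> w1 p \<tau> m \<epsilon> = w1 p' \<tau> m \<epsilon>"
    proof (rule aux_equation_unique_near_0[where \<beta> = \<beta> and rQ = rQR and Ct = Ct and K = Kl and B = "Kp * (r0 * B)",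
          OF w1(3)[OF p e] w1(3)[OF p' e] b1 b1 \<psi>\<rho>1 assms(1) e0 assms(5) \<rho>1(1) eps])
      show "finite (I l)" if "l \<in> {1..D-1}" for l using assms(7) that by blast
      show "d j l \<ge> 1" if "l \<in> {1..D-1}" "j \<in> I l" for l j using assms(8) that by blast
      show "poly (R D) (\<i> * of_real m) \<noteq> 0" for m using assms(15) by blast
      show "norm (poly (R D) (\<i> * of_real m)) * norm (w1 p \<tau> m \<epsilon>) \<le> Kp * (r0 * B)" if "\<tau> \<in> ball 0 \<rho>1" for \<tau> m
        using bw[OF p _ that] by simp
      show "norm (poly (R D) (\<i> * of_real m)) * norm (w1 p' \<tau> m \<epsilon>) \<le> Kp * (r0 * B)" if "\<tau> \<in> ball 0 \<rho>1" for \<tau> m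
        using bw[OF p' _ that] by simp
    qed (assumption | rule dl assms(19) Cc Kl Qb cw[OF p] cw[OF p'] assms(16))+
    then obtain r where r: "0 < r" "\<And>\<tau> m. \<tau> \<noteq> 0 \<Longrightarrow> norm \<tau> \<le> r \<Longrightarrow> w1 p \<tau> m \<epsilon> = w1 p' \<tau> m \<epsilon>"
      by blast
    define r' where "r' = min r \<rho>"
    have r': "0 < r'" "r' \<le> \<rho>" "r' \<le> r" using r(1) assms(23) by (auto simp: r'_def)
    show ?thesis
    proof (rule holomorphic_eq_disc_cone[OF hol1(1)[OF p e] hol1(1)[OF p' e] cone[OF p] cone[OF p'] r'(1,2)])
      show "w1 p \<tau> m \<epsilon> = w1 p' \<tau> m \<epsilon>" if "\<tau> \<noteq> 0" "norm \<tau> < r'" for \<tau> using r(2)[OF that(1)] that(2) r'(3) by simp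
    qed (use u in auto)
  qed
  define J where "J = (LINT m|lborel. exp (- (\<beta> - \<beta>') * \<bar>m\<bar>))"
  define K where "K = real k2 * ln L.R / ln q + 1 / 2"
  define M where "M = 2 * L.K1 / \<bar>qPi q k2\<bar> * J * exp (ln L.R * (\<nu> - 1 / 2) + K\<^sup>2 * ln q / (2 * real k2))"
  have J: "J \<ge> 0" unfolding J_def by (rule integral_nonneg_AE) simp
  have C0: "2 * L.K1 / \<bar>qPi q k2\<bar> * J \<ge> 0" using L.K1_nonneg J by simp
  have M: "M \<ge> 0" unfolding M_def by (rule mult_nonneg_nonneg[OF C0]) simp
  have main: "norm (u p' t z \<epsilon> - u p t z \<epsilon>)
        \<le> (M + 1) * exp (- (real k2 / (2 * ln q)) * (ln (norm \<epsilon>))\<^sup>2) * norm \<epsilon> powr K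
      \<and> norm (f p' t z \<epsilon> - f p t z \<epsilon>)
        \<le> (M + 1) * exp (- (real k2 / (2 * ln q)) * (ln (norm \<epsilon>))\<^sup>2) * norm \<epsilon> powr K"
    if "t \<in> \<T>" "\<bar>Im z\<bar> < \<beta>'" "\<epsilon> \<in> E p \<inter> E p'" for t z \<epsilon>
  proof
    note t = that(1) and z = that(2) and eE = that(3)
    
    define x where "x = \<epsilon> * t"
    have "E p \<subseteq> ball 0 \<epsilon>0" using assms(28) p by (auto simp: good_covering_def bounded_sector_def)
    then have e: "\<epsilon> \<in> ball 0 \<epsilon>0" using eE by auto
    have xR: "x \<in> L.Rb (dir p)" "x \<in> L.Rb (dir p')"
      using assms(47) p p' t eE by (auto simp: LRb x_def)
    have x0: "x \<noteq> 0" using xR(1) by (auto simp: L.Rb_def c(3))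
    have arc: "arc_sector x (dir p) (dir p') \<subseteq> U p \<inter> U p'"
      using assms(62) t eE unfolding p'_def x_def by blast
    have tT: "norm t < rT" using assms(33) t by (auto simp: bounded_sector_def)
    have n: "0 < norm \<epsilon>" "norm \<epsilon> \<le> 1" "0 < norm t" "norm t \<le> 1"
      using x0 e assms(36,38) tT by (auto simp: x_def)
    define X where "X = exp (- (real k2 / (2 * ln q)) * (ln (norm \<epsilon>))\<^sup>2) * norm \<epsilon> powr K"
    have X: "X \<ge> 0" by (simp add: X_def)
    have tb: "L.tb x \<le> exp (ln L.R * (\<nu> - 1 / 2) + K\<^sup>2 * ln q / (2 * real k2)) * X"
      unfolding L.tb_def x_def norm_mult K_def X_def by (rule tail_bound_product[OF assms(1) k(2) n])
    have "2 * L.K1 / \<bar>qPi q k2\<bar> * J * L.tb x \<le> M * X"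
      using mult_left_mono[OF tb C0] by (simp add: M_def mult.assoc)
    also have "\<dots> \<le> (M + 1) * X" using X by (intro mult_right_mono) auto
    finally have fin: "2 * L.K1 / \<bar>qPi q k2\<bar> * J * L.tb x \<le> (M + 1) * exp (- (real k2 / (2 * ln q)) * (ln (norm \<epsilon>))\<^sup>2) * norm \<epsilon> powr K"
      by (simp add: X_def mult.assoc)
    have rot: "q_laplace q k2 (\<gamma> i x) (\<lambda>\<tau>. w2 i \<tau> m \<epsilon>) x = q_laplace q k2 (dir i) (\<lambda>\<tau>. w2 i \<tau> m \<epsilon>) x"
      if i: "i < \<sigma>" "i = p \<or> i = p'" for i m
    proof (rule L.rotate_to_bisector[OF pairw[OF i e]])
      show "x \<in> L.Rb (dir i)" using xR i by auto
      have "\<epsilon> \<in> E i" using eE i by auto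
      then show "arc_sector x (dir i) (\<gamma> i x) \<subseteq> S i" "cis (\<gamma> i x) \<noteq> - sgn x"
        using assms(59) i(1) t unfolding x_def by blast+
    qed
    have "norm (u p' t z \<epsilon> - u p t z \<epsilon>) \<le> 2 * L.K1 / \<bar>qPi q k2\<bar> * J * L.tb x"
      unfolding assms(60)[rule_format] x_def[symmetric] rot[OF p disjI1[OF refl]] rot[OF p' disjI2[OF refl]] J_def
      by (rule L.inv_fourier_difference_bound[OF pairw[OF p disjI1[OF refl] e] pairw[OF p' disjI2[OF refl] e] weq[OF e] xR arc assms(21,22) z])
    then show "norm (u p' t z \<epsilon> - u p t z \<epsilon>) \<le> (M + 1) * exp (- (real k2 / (2 * ln q)) * (ln (norm \<epsilon>))\<^sup>2) * norm \<epsilon> powr K"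
      using fin by (rule order_trans)
    have "norm (f p' t z \<epsilon> - f p t z \<epsilon>) \<le> 2 * L.K1 / \<bar>qPi q k2\<bar> * J * L.tb x"
      unfolding assms(52)[rule_format] x_def[symmetric] J_def
      by (rule L.inv_fourier_difference_bound[OF pairf[OF p disjI1[OF refl] e] pairf[OF p' disjI2[OF refl] e] \<psi>eq[OF e] xR arc assms(21,22) z])
    then show "norm (f p' t z \<epsilon> - f p t z \<epsilon>) \<le> (M + 1) * exp (- (real k2 / (2 * ln q)) * (ln (norm \<epsilon>))\<^sup>2) * norm \<epsilon> powr K"
      using fin by (rule order_trans)
  qed
  have "M + 1 > 0" using M by simp
  then show ?thesis unfolding p'_def[symmetric] using main by blast
qed

end
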